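(* Assume that $(A_1)$–$(A_3)$ hold and that $\varepsilon>0$ is sufficiently small. For any solution $\varphi^\varepsilon(t,\omega)=(x^\varepsilon(t,\omega),y^\varepsilon(t,\omega))$ with initial condition $z_0=(x_0,y_0)$ of the slow-fast system $$dx^\varepsilon=Sx^\varepsilon dt+g_1(x^\varepsilon,y^\varepsilon)dt,\qquad dy^\varepsilon=\tfrac1\varepsilon Fy^\varepsilon dt+\tfrac1\varepsilon g_2(x^\varepsilon,y^\varepsilon)dt+\sigma\varepsilon^{-\frac1\alpha}dL_t^\alpha,$$ there exists a solution $\bar\varphi^\varepsilon(t,\omega)=(\bar x^\varepsilon(t,\omega),\bar y^\varepsilon(t,\omega))$ with initial point $\bar z_0=(\bar x_0,\bar y_0)$ on the manifold $M^\varepsilon(\omega)=\{(x_0,h^\varepsilon(\omega,x_0)):x_0\in\mathbb R^{n_1}\}$ which satisfies the reduction system $$d\bar x^\varepsilon=S\bar x^\varepsilon dt+g_1(\bar x^\varepsilon,h^\varepsilon(\theta_t\omega,\bar x^\varepsilon))dt,$$ such that, for almost every $\omega\in\Omega$ and all $t\ge0$, $$|\varphi^\varepsilon(t,\omega)-\bar\varphi^\varepsilon(t,\omega)|\le\frac{e^{-\frac\gamma\varepsilon t}}{1-\left(\frac{\varepsilon K}{\gamma+\varepsilon\gamma_s}-\frac{K}{\gamma+\gamma_f}\right)}|z_0-\bar z_0| ,$$ where $-\gamma/\varepsilon<0$.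
   Context: Setting. $|\cdot|$ is the Euclidean norm, $n=n_1+n_2$, $\sigma>0$, $1<\alpha<2$. $S$ is an $n_1\times n_1$ matrix all of whose eigenvalues have non-negative real part, $F$ is an $n_2\times n_2$ matrix all of whose eigenvalues have negative real part, and $g_i:\mathbb R^{n_1}\times\mathbb R^{n_2}\to\mathbb R^{n_i}$ ($i=1,2$) are Lipschitz continuous with $g_i(0,0)=0$. Hypotheses. $(A_1)$: there are constants $\gamma_s>0$ and $\gamma_f<0$ such that $|e^{St}x|\le e^{\gamma_st}|x|$ for $t\le0$, $x\in\mathbb R^{n_1}$, and $|e^{Ft}y|\le e^{\gamma_ft}|y|$ for $t\ge0$, $y\in\mathbb R^{n_2}$. $(A_2)$: there is $K>0$ with $|g_i(x_1,y_1)-g_i(x_2,y_2)|\le K(|x_1-x_2|+|y_1-y_2|)$ for all $(x_j,y_j)\in\mathbb R^n$, $i=1,2$. $(A_3)$: $K<-\gamma_f$. A number $\gamma>0$ with $K<-(\gamma+\gamma_f)$ is fixed, and $\beta=-\gamma/\varepsilon$. Noise. $\Omega=\mathcal D_0(\mathbb R,\mathbb R^{n_2})$ is the space of càdlàg functions $\omega:\mathbb R\to\mathbb R^{n_2}$ with $\omega(0)=0$, with the Borel $\sigma$-algebra of the Skorokhod topology; $\mathbb P$ is the law making $L_t^\alpha(\omega)=\omega(t)$ a two-sided $\alpha$-stable Lévy process; $\theta_t\omega=\omega(\cdot+t)-\omega(t)$ is the shift flow, which preserves $\mathbb P$. On a $\theta$-invariant set of full measure (again denoted $\Omega$) put $\eta^{\frac1\varepsilon}(\omega)=\varepsilon^{-\frac1\alpha}\int_{-\infty}^0e^{-Fs/\varepsilon}dL_s^\alpha(\omega)$;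 $t\mapsto\eta^{\frac1\varepsilon}(\theta_t\omega)$ is the càdlàg stationary solution of $d\eta=\frac1\varepsilon F\eta\,dt+\varepsilon^{-1/\alpha}dL_t^\alpha$, with sublinear growth. Solutions. Let $\hat\phi^\varepsilon(t,\omega,(x_0,y_0))$ be the solution starting at $(x_0,y_0)$ of $d\hat x^\varepsilon=S\hat x^\varepsilon dt+g_1(\hat x^\varepsilon,\hat y^\varepsilon+\sigma\eta^{\frac1\varepsilon}(\theta_t\omega))dt$, $d\hat y^\varepsilon=\frac1\varepsilon F\hat y^\varepsilon dt+\frac1\varepsilon g_2(\hat x^\varepsilon,\hat y^\varepsilon+\sigma\eta^{\frac1\varepsilon}(\theta_t\omega))dt$. Solutions of the slow-fast system starting at $(x_0,y_0)$ are $\varphi^\varepsilon(t,\omega)=\hat\phi^\varepsilon(t,\omega,(x_0,y_0-\sigma\eta^{\frac1\varepsilon}(\omega)))+(0,\sigma\eta^{\frac1\varepsilon}(\theta_t\omega))$. Manifold. $C_\beta^-$ is the Banach space of continuous $(\phi^s,\phi^f):(-\infty,0]\to\mathbb R^{n_1}\times\mathbb R^{n_2}$ with finite norm $\sup_{t\le0}|e^{-\beta t}\phi^s_t|+\sup_{t\le0}|e^{-\beta t}\phi^f_t|$. For sufficiently small $\varepsilon$, $\{(x_0,y_0)\in\mathbb R^n:\hat\phi^\varepsilon(\cdot,\omega,(x_0,y_0))\in C_\beta^-\}$ is the graph of a Lipschitz function $\hat h^\varepsilon(\omega,\cdot):\mathbb R^{n_1}\to\mathbb R^{n_2}$, and $h^\varepsilon(\omega,x_0)=\hat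 h^\varepsilon(\omega,x_0)+\sigma\eta^{\frac1\varepsilon}(\omega)$. That the solution on the manifold satisfies the reduction system means that $\bar x^\varepsilon$ solves it, with $\bar y^\varepsilon(t,\omega)=h^\varepsilon(\theta_t\omega,\bar x^\varepsilon(t,\omega))$. *)

theory Defs
  imports "HOL-Probability.Probability"
begin

section \<open>Matrices\<close>

definition cmatrix :: "real^'n^'n \<Rightarrow> complex^'n^'n" where
  "cmatrix A = (\<chi> i j. complex_of_real (A $ i $ j))"

definition eigenvalue :: "real^'n^'n \<Rightarrow> complex \<Rightarrow> bool" where
  "eigenvalue A c \<longleftrightarrow> (\<exists>v. v \<noteq> 0 \<and> cmatrix A *v v = c *s v)"

text \<open>Multiplication of the class \<^class>\<open>times\<close> is componentwise on \<^typ>\<open>real^'n^'n\<close>, so powers are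
  taken with \<^const>\<open>matrix_matrix_mult\<close>.\<close>

definition matrix_exp :: "real^'n^'n \<Rightarrow> real^'n^'n" where
  "matrix_exp A = (\<Sum>k. (1 / fact k) *\<^sub>R (((**) A ^^ k) (mat 1)))"


section \<open>The Skorokhod space of two-sided cadlag paths\<close>

definition cadlag :: "(real \<Rightarrow> 'a::topological_space) \<Rightarrow> bool" where
  "cadlag x \<longleftrightarrow> (\<forall>t. (x \<longlongrightarrow> x t) (at_right t) \<and> (\<exists>l. (x \<longlongrightarrow> l) (at_left t)))"

definition D0 :: "(real \<Rightarrow> 'a::real_normed_vector) set" where
  "D0 = {\<omega>. cadlag \<omega> \<and> \<omega> 0 = 0}"

text \<open>Billingsley's metric for the Skorokhod (J1) topology on a non-compact time axis, with the
  windows \<open>[0,m]\<close> replaced by \<open>[-m,m]\<close>: paths are damped to zero at the ends of the window,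
  compared there up to a time change with small logarithmic slopes, and the distances
  for \<open>m = 1, 2, \<dots>\<close> are summed with weights \<open>2^{-m}\<close>.\<close>

definition time_changes :: "real \<Rightarrow> (real \<Rightarrow> real) set" where
  "time_changes m =
     {l. strict_mono_on {-m..m} l \<and> continuous_on {-m..m} l \<and> l ` {-m..m} = {-m..m}}"

definition window_dist :: "real \<Rightarrow> (real \<Rightarrow> 'a::real_normed_vector) \<Rightarrow> (real \<Rightarrow> 'a) \<Rightarrow> real" where
  "window_dist m x y = Inf {r. \<exists>l\<in>time_changes m.
     (\<forall>t\<in>{-m..m}. norm (x t - y (l t)) \<le> r) \<and>
     (\<forall>s\<in>{-m..m}. \<forall>t\<in>{-m..m}. s < t \<longrightarrow> \<bar>ln ((l t - l s) / (t - s))\<bar> \<le> r)}"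

definition damped :: "real \<Rightarrow> (real \<Rightarrow> 'a::real_normed_vector) \<Rightarrow> real \<Rightarrow> 'a" where
  "damped m x = (\<lambda>t. max 0 (min 1 (m - \<bar>t\<bar>)) *\<^sub>R x t)"

definition skorokhod_dist :: "(real \<Rightarrow> 'a::real_normed_vector) \<Rightarrow> (real \<Rightarrow> 'a) \<Rightarrow> real" where
  "skorokhod_dist x y = (\<Sum>k. (1/2) ^ Suc k *
     min 1 (window_dist (real (Suc k)) (damped (real (Suc k)) x) (damped (real (Suc k)) y)))"

definition skorokhod_open :: "(real \<Rightarrow> 'a::real_normed_vector) set \<Rightarrow> bool" where
  "skorokhod_open U \<longleftrightarrow> U \<subseteq> D0 \<and>
     (\<forall>x\<in>U. \<exists>r>0. \<forall>y\<in>D0. skorokhod_dist x y < r \<longrightarrow> y \<in> U)"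

definition skorokhod_borel :: "(real \<Rightarrow> 'a::real_normed_vector) measure" where
  "skorokhod_borel = sigma D0 {U. skorokhod_open U}"

definition path_shift :: "real \<Rightarrow> (real \<Rightarrow> 'a::real_normed_vector) \<Rightarrow> real \<Rightarrow> 'a" where
  "path_shift t \<omega> = (\<lambda>s. \<omega> (s + t) - \<omega> t)"


section \<open>Two-sided stable Levy processes\<close>

definition two_sided_levy_process ::
    "'w measure \<Rightarrow> (real \<Rightarrow> 'w \<Rightarrow> 'a::euclidean_space) \<Rightarrow> bool" where
  "two_sided_levy_process M X \<longleftrightarrow>
     prob_space M \<and>
     (\<forall>t. X t \<in> borel_measurable M) \<and>
     (\<forall>\<omega>\<in>space M. cadlag (\<lambda>t. X t \<omega>)) \<and>
     (AE \<omega> in M. X 0 \<omega> = 0) \<and>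
     (\<forall>(k::nat) \<tau>. strict_mono_on {..k} \<tau> \<longrightarrow>
        prob_space.indep_vars M (\<lambda>_. borel) (\<lambda>i \<omega>. X (\<tau> (Suc i)) \<omega> - X (\<tau> i) \<omega>) {..<k}) \<and>
     (\<forall>s t. s < t \<longrightarrow>
        distr M borel (\<lambda>\<omega>. X t \<omega> - X s \<omega>) = distr M borel (X (t - s))) \<and>
     (\<forall>s. \<forall>e>0. ((\<lambda>t. measure M {\<omega>\<in>space M. norm (X t \<omega> - X s \<omega>) > e}) \<longlongrightarrow> 0) (at s))"

text \<open>Stability in the sense of Sato: up to a deterministic drift, rescaling time by \<open>a\<close> amounts to
  rescaling space by \<open>a^{1/\<alpha>}\<close>. Neither symmetry nor isotropy is required. For Levy processes
  the laws of the single \<open>X t\<close> determine the law of the process.\<close>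

definition two_sided_stable_levy_process ::
    "real \<Rightarrow> 'w measure \<Rightarrow> (real \<Rightarrow> 'w \<Rightarrow> 'a::euclidean_space) \<Rightarrow> bool" where
  "two_sided_stable_levy_process \<alpha> M X \<longleftrightarrow>
     two_sided_levy_process M X \<and>
     (\<forall>a>0. \<exists>c. \<forall>t\<ge>0. distr M borel (X (a * t)) =
        distr M borel (\<lambda>\<omega>. a powr (1/\<alpha>) *\<^sub>R X t \<omega> + t *\<^sub>R c))"


section \<open>The stationary process\<close>

text \<open>Riemann--Stieltjes integral of a matrix-valued integrand against a vector-valued path, as a
  limit over tagged divisions whose mesh tends to zero. It exists for a smooth integrand and a
  cadlag path, and realises the stochastic integral path by path.\<close>

definition has_rs_integral ::
    "(real \<Rightarrow> real^'n^'n) \<Rightarrow> (real \<Rightarrow> real^'n) \<Rightarrow> real \<Rightarrow> real \<Rightarrow> real^'n \<Rightarrow> bool" where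
  "has_rs_integral f \<omega> a b I \<longleftrightarrow>
     (\<forall>e>0. \<exists>d>0. \<forall>p. p tagged_division_of {a..b} \<and> (\<forall>(s, k)\<in>p. diameter k < d) \<longrightarrow>
        norm ((\<Sum>(s, k)\<in>p. f s *v (\<omega> (Sup k) - \<omega> (Inf k))) - I) < e)"

definition rs_integral ::
    "(real \<Rightarrow> real^'n^'n) \<Rightarrow> (real \<Rightarrow> real^'n) \<Rightarrow> real \<Rightarrow> real \<Rightarrow> real^'n" where
  "rs_integral f \<omega> a b = (THE I. has_rs_integral f \<omega> a b I)"

definition eta :: "real^'n^'n \<Rightarrow> real \<Rightarrow> real \<Rightarrow> (real \<Rightarrow> real^'n) \<Rightarrow> real^'n" where
  "eta F \<alpha> \<epsilon> \<omega> = \<epsilon> powr (- 1/\<alpha>) *\<^sub>R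
     Lim at_bot (\<lambda>a. rs_integral (\<lambda>s. matrix_exp ((- s / \<epsilon>) *\<^sub>R F)) \<omega> a 0)"


section \<open>Solutions\<close>

text \<open>\<open>solves f N z0 z\<close>: the path \<open>z\<close> satisfies \<open>dz = f(t, z) dt + dN\<close>, \<open>z(0) = z0\<close> on the whole
  time axis, in integrated form, for an additive forcing with \<open>N 0 = 0\<close>.
  For negative times the integral is the oriented one.\<close>

definition solves ::
    "(real \<Rightarrow> 'a \<Rightarrow> 'a) \<Rightarrow> (real \<Rightarrow> 'a) \<Rightarrow> 'a \<Rightarrow> (real \<Rightarrow> 'a::euclidean_space) \<Rightarrow> bool" where
  "solves f N z0 z \<longleftrightarrow>
     (\<forall>t. interval_lebesgue_integrable lborel (ereal 0) (ereal t) (\<lambda>s. f s (z s)) \<and>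
          z t = z0 + (LBINT s=ereal 0..ereal t. f s (z s)) + N t)"

definition slow_fast_solution ::
    "real^'n1^'n1 \<Rightarrow> real^'n2^'n2 \<Rightarrow> ((real^'n1) \<times> (real^'n2) \<Rightarrow> real^'n1) \<Rightarrow>
     ((real^'n1) \<times> (real^'n2) \<Rightarrow> real^'n2) \<Rightarrow> real \<Rightarrow> real \<Rightarrow> real \<Rightarrow> (real \<Rightarrow> real^'n2) \<Rightarrow>
     (real^'n1) \<times> (real^'n2) \<Rightarrow> (real \<Rightarrow> (real^'n1) \<times> (real^'n2)) \<Rightarrow> bool" where
  "slow_fast_solution S F g1 g2 \<sigma> \<alpha> \<epsilon> \<omega> z0 z \<longleftrightarrow>
     solves
       (\<lambda>t (x, y). (S *v x + g1 (x, y), (1/\<epsilon>) *\<^sub>R (F *v y) + (1/\<epsilon>) *\<^sub>R g2 (x, y)))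
       (\<lambda>t. (0, (\<sigma> * \<epsilon> powr (- 1/\<alpha>)) *\<^sub>R \<omega> t)) z0 z"

definition hat_flow ::
    "real^'n1^'n1 \<Rightarrow> real^'n2^'n2 \<Rightarrow> ((real^'n1) \<times> (real^'n2) \<Rightarrow> real^'n1) \<Rightarrow>
     ((real^'n1) \<times> (real^'n2) \<Rightarrow> real^'n2) \<Rightarrow> real \<Rightarrow> real \<Rightarrow> real \<Rightarrow> (real \<Rightarrow> real^'n2) \<Rightarrow>
     (real^'n1) \<times> (real^'n2) \<Rightarrow> real \<Rightarrow> (real^'n1) \<times> (real^'n2)" where
  "hat_flow S F g1 g2 \<sigma> \<alpha> \<epsilon> \<omega> z0 = (THE z. solves
       (\<lambda>t (x, y).
          (S *v x + g1 (x, y + \<sigma> *\<^sub>R eta F \<alpha> \<epsilon> (path_shift t \<omega>)),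
           (1/\<epsilon>) *\<^sub>R (F *v y) + (1/\<epsilon>) *\<^sub>R g2 (x, y + \<sigma> *\<^sub>R eta F \<alpha> \<epsilon> (path_shift t \<omega>))))
       (\<lambda>t. 0) z0 z)"


section \<open>The slow manifold\<close>

definition C_minus :: "real \<Rightarrow> (real \<Rightarrow> 'a::real_normed_vector \<times> 'b::real_normed_vector) set" where
  "C_minus \<beta> = {\<phi>. continuous_on {..0} \<phi> \<and>
     bdd_above ((\<lambda>t. norm (exp (- \<beta> * t) *\<^sub>R fst (\<phi> t))) ` {..0}) \<and>
     bdd_above ((\<lambda>t. norm (exp (- \<beta> * t) *\<^sub>R snd (\<phi> t))) ` {..0})}"

definition hat_manifold ::
    "real^'n1^'n1 \<Rightarrow> real^'n2^'n2 \<Rightarrow> ((real^'n1) \<times> (real^'n2) \<Rightarrow> real^'n1) \<Rightarrow>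
     ((real^'n1) \<times> (real^'n2) \<Rightarrow> real^'n2) \<Rightarrow> real \<Rightarrow> real \<Rightarrow> real \<Rightarrow> real \<Rightarrow> (real \<Rightarrow> real^'n2) \<Rightarrow>
     ((real^'n1) \<times> (real^'n2)) set" where
  "hat_manifold S F g1 g2 \<sigma> \<alpha> \<gamma> \<epsilon> \<omega> =
     {z0. hat_flow S F g1 g2 \<sigma> \<alpha> \<epsilon> \<omega> z0 \<in> C_minus (- \<gamma> / \<epsilon>)}"

definition h_hat ::
    "real^'n1^'n1 \<Rightarrow> real^'n2^'n2 \<Rightarrow> ((real^'n1) \<times> (real^'n2) \<Rightarrow> real^'n1) \<Rightarrow>
     ((real^'n1) \<times> (real^'n2) \<Rightarrow> real^'n2) \<Rightarrow> real \<Rightarrow> real \<Rightarrow> real \<Rightarrow> real \<Rightarrow> (real \<Rightarrow> real^'n2) \<Rightarrow>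
     real^'n1 \<Rightarrow> real^'n2" where
  "h_hat S F g1 g2 \<sigma> \<alpha> \<gamma> \<epsilon> \<omega> =
     (THE h. hat_manifold S F g1 g2 \<sigma> \<alpha> \<gamma> \<epsilon> \<omega> = range (\<lambda>x. (x, h x)))"

definition h_slow ::
    "real^'n1^'n1 \<Rightarrow> real^'n2^'n2 \<Rightarrow> ((real^'n1) \<times> (real^'n2) \<Rightarrow> real^'n1) \<Rightarrow>
     ((real^'n1) \<times> (real^'n2) \<Rightarrow> real^'n2) \<Rightarrow> real \<Rightarrow> real \<Rightarrow> real \<Rightarrow> real \<Rightarrow> (real \<Rightarrow> real^'n2) \<Rightarrow>
     real^'n1 \<Rightarrow> real^'n2" where
  "h_slow S F g1 g2 \<sigma> \<alpha> \<gamma> \<epsilon> \<omega> x0 =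
     h_hat S F g1 g2 \<sigma> \<alpha> \<gamma> \<epsilon> \<omega> x0 + \<sigma> *\<^sub>R eta F \<alpha> \<epsilon> \<omega>"

definition slow_manifold ::
    "real^'n1^'n1 \<Rightarrow> real^'n2^'n2 \<Rightarrow> ((real^'n1) \<times> (real^'n2) \<Rightarrow> real^'n1) \<Rightarrow>
     ((real^'n1) \<times> (real^'n2) \<Rightarrow> real^'n2) \<Rightarrow> real \<Rightarrow> real \<Rightarrow> real \<Rightarrow> real \<Rightarrow> (real \<Rightarrow> real^'n2) \<Rightarrow>
     ((real^'n1) \<times> (real^'n2)) set" where
  "slow_manifold S F g1 g2 \<sigma> \<alpha> \<gamma> \<epsilon> \<omega> =
     range (\<lambda>x0. (x0, h_slow S F g1 g2 \<sigma> \<alpha> \<gamma> \<epsilon> \<omega> x0))"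

definition reduced_solution ::
    "real^'n1^'n1 \<Rightarrow> real^'n2^'n2 \<Rightarrow> ((real^'n1) \<times> (real^'n2) \<Rightarrow> real^'n1) \<Rightarrow>
     ((real^'n1) \<times> (real^'n2) \<Rightarrow> real^'n2) \<Rightarrow> real \<Rightarrow> real \<Rightarrow> real \<Rightarrow> real \<Rightarrow> (real \<Rightarrow> real^'n2) \<Rightarrow>
     real^'n1 \<Rightarrow> (real \<Rightarrow> (real^'n1) \<times> (real^'n2)) \<Rightarrow> bool" where
  "reduced_solution S F g1 g2 \<sigma> \<alpha> \<gamma> \<epsilon> \<omega> x0 z \<longleftrightarrow>
     solves (\<lambda>t x. S *v x + g1 (x, h_slow S F g1 g2 \<sigma> \<alpha> \<gamma> \<epsilon> (path_shift t \<omega>) x))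
       (\<lambda>t. 0) x0 (\<lambda>t. fst (z t)) \<and>
     (\<forall>t. snd (z t) = h_slow S F g1 g2 \<sigma> \<alpha> \<gamma> \<epsilon> (path_shift t \<omega>) (fst (z t)))"

end

theory Submission
  imports Defs
begin

text \<open>Subtracting the stationary process from a solution of the slow-fast system leaves a continuous
  solution of a random differential equation whose right-hand side is cadlag in time. For such
  equations integrals can be traded for right derivatives: a continuous path is determined by its right
  derivative, and all estimates come from a mean value inequality for right derivatives.

  In the Lyapunov--Perron equation the slow component is solved backwards from \<open>+\<infinity>\<close>, the
  fast component forwards from \<open>-\<infinity>\<close>. With respect to the weight \<open>exp (- \<gamma> t / \<epsilon>)\<close> on the
  whole time axis it is a contraction with constant \<open>\<epsilon> K / (\<gamma> + \<epsilon> \<gamma>\<^sub>s) - K / (\<gamma> + \<gamma>\<^sub>f)\<close>.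
  Its fixed point yields the points of the slow manifold, and also, in one stroke, a solution that lies
  on the manifold (growth bound at \<open>-\<infinity>\<close>) and tracks the given one (decay at \<open>+\<infinity>\<close>).
  The constant in the estimate is the contraction constant on the half line \<open>t \<ge> 0\<close>, where the
  initial deviation of the fast component acts as an inhomogeneity.

  Probability enters only through the bound \<open>C exp (\<gamma> |t| / \<epsilon>)\<close> for almost all paths at \<open>-\<infinity>\<close>.
  It follows from a tail estimate for \<open>X 1\<close>, obtained from stability, by Ottaviani's maximal
  inequality and the Borel--Cantelli lemma.\<close>

text \<open>The noise jumps, so right-hand sides are only right continuous and a solution may fail
  to be differentiable at a jump; its right derivative exists at every time, with no exceptional
  null set. The weight exponent b = -gamma/epsilon lies strictly between the fast rate
  gamma_f/epsilon and the slow rate gamma_s. A forcing of size C exp(b t) therefore determines one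
  slow and one fast solution of the same order, with constants C/(gamma_s - b) and C/(b -
  gamma_f/epsilon). Multiplied by the Lipschitz constants K and K/epsilon these are the two summands
  of the contraction constant: the first tends to 0 with epsilon, the second is below 1 by the
  choice of gamma. This is what small epsilon means. The obstacle to tracking is that the given
  solution fits the weight at neither end: it need not be bounded by it at -infinity and need not
  decay at +infinity. Hence the fixed point is a correction to a reference path glued at time 0. The
  stationary process is given as a limit of Stieltjes integrals; integration by parts expresses it
  through a linear equation forced by the path itself.\<close>

abbreviation has_rderiv :: "(real \<Rightarrow> 'a::real_normed_vector) \<Rightarrow> 'a \<Rightarrow> real \<Rightarrow> bool" where
  "has_rderiv f D t \<equiv> (f has_vector_derivative D) (at t within {t..})"

section \<open>Right derivatives and the mean value inequality\<close>

lemma has_rderiv_iff: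
  "has_rderiv f D t \<longleftrightarrow>
     (\<forall>e>0. \<exists>d>0. \<forall>s. t \<le> s \<and> s < t + d \<longrightarrow> norm (f s - f t - (s - t) *\<^sub>R D) \<le> e * (s - t))"
  unfolding has_vector_derivative_def has_derivative_within_alt
proof safe
  fix e :: real assume "\<forall>e>0. \<exists>d>0. \<forall>y\<in>{t..}. norm (y - t) < d \<longrightarrow> norm (f y - f t - (y - t) *\<^sub>R D)
      \<le> e * norm (y - t)" "e > 0"
  then obtain d where d: "d > 0" "\<forall>y\<in>{t..}. norm (y - t) < d \<longrightarrow> norm (f y - f t - (y - t) *\<^sub>R D)
      \<le> e * norm (y - t)" by blast
  show "\<exists>d>0. \<forall>s. t \<le> s \<and> s < t + d \<longrightarrow> norm (f s - f t - (s - t) *\<^sub>R D) \<le> e * (s - t)"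
  proof (intro exI[of _ d] conjI allI impI)
    fix s assume s: "t \<le> s \<and> s < t + d"
    then show "norm (f s - f t - (s - t) *\<^sub>R D) \<le> e * (s - t)" using d(2)[rule_format, of s] by auto
  qed (use d in auto)
next
  fix e :: real assume "\<forall>e>0. \<exists>d>0. \<forall>s. t \<le> s \<and> s < t + d \<longrightarrow> norm (f s - f t - (s - t) *\<^sub>R D)
      \<le> e * (s - t)" "e > 0"
  then obtain d where d: "d > 0" "\<forall>s. t \<le> s \<and> s < t + d \<longrightarrow> norm (f s - f t - (s - t) *\<^sub>R D)
      \<le> e * (s - t)" by blast
  show "\<exists>d>0. \<forall>y\<in>{t..}. norm (y - t) < d \<longrightarrow> norm (f y - f t - (y - t) *\<^sub>R D) \<le> e * norm (y - t)"
  proof (intro exI[of _ d] conjI ballI impI)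
    fix y assume y: "y \<in> {t..}" "norm (y - t) < d"
    then show "norm (f y - f t - (y - t) *\<^sub>R D) \<le> e * norm (y - t)" using d(2)[rule_format, of y]
      by auto
  qed (use d in auto)
qed (auto intro: bounded_linear_intros)

text \<open>Continuous induction with a slack of slope \<open>e\<close>: the set of times up to
  which the inequality holds contains its supremum by continuity, and at a supremum before
  \<open>b\<close> the two first-order expansions push it further. Extension only ever goes to the
  right, so one-sided derivatives suffice.\<close>

lemma right_mvt:
  fixes q :: "real \<Rightarrow> 'a::real_normed_vector"
  assumes "a \<le> b" and cont: "continuous_on {a..b} q"
    and q': "\<And>t. a \<le> t \<Longrightarrow> t < b \<Longrightarrow> has_rderiv q (q' t) t"
    and mu: "\<And>t. a \<le> t \<Longrightarrow> t \<le> b \<Longrightarrow> (\<mu> has_real_derivative \<mu>' t) (at t)"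
    and le: "\<And>t. a \<le> t \<Longrightarrow> t < b \<Longrightarrow> norm (q' t) \<le> \<mu>' t"
  shows "norm (q b - q a) \<le> \<mu> b - \<mu> a"
proof (rule field_le_epsilon)
  fix e0 :: real assume "e0 > 0"
  \<comment> \<open>The \<open>+ 1\<close> keeps \<open>e\<close> positive when
    \<open>a = b\<close>.\<close>
  define e where "e = e0 / (b - a + 1)"
  have e: "e > 0" "e * (b - a) \<le> e0" using \<open>e0 > 0\<close> \<open>a \<le> b\<close> by (auto simp: e_def field_simps)
  define \<psi> where "\<psi> s = \<mu> s - \<mu> a + e * (s - a) - norm (q s - q a)" for s
  have muc: "continuous_on {a..b} \<mu>"
    using mu by (meson DERIV_continuous_on DERIV_subset atLeastAtMost_iff top_greatest)
  have psic: "continuous_on {a..b} \<psi>"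
    unfolding \<psi>_def by (intro continuous_intros cont muc)
  define S where "S = {t\<in>{a..b}. \<forall>s\<in>{a..t}. \<psi> s \<ge> 0}"
  have aS: "a \<in> S" using \<open>a \<le> b\<close> by (auto simp: S_def \<psi>_def)
  have bdd: "bdd_above S" by (rule bdd_aboveI[of _ b]) (auto simp: S_def)
  define c where "c = Sup S"
  have cab: "a \<le> c" "c \<le> b"
    unfolding c_def using aS by (auto intro!: cSup_upper[OF _ bdd] cSup_least) (auto simp: S_def)
  have less: "\<psi> s \<ge> 0" if "a \<le> s" "s < c" for s
  proof -
    from that(2) obtain t where "t \<in> S" "s < t" unfolding c_def using aS bdd less_cSup_iff by blast
    then show ?thesis using that by (auto simp: S_def)
  qed
  have cc: "\<psi> c \<ge> 0"
  proof (cases "a = c")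
    case True then show ?thesis by (auto simp: \<psi>_def)
  next
    case False
    then have "a < c" using cab by auto
    have "continuous_on {a..c} \<psi>" by (rule continuous_on_subset[OF psic]) (use cab in auto)
    then have "(\<psi> \<longlongrightarrow> \<psi> c) (at_left c)"
      using \<open>a < c\<close> by (auto simp: continuous_on_Icc_at_leftD)
    moreover have "eventually (\<lambda>s. \<psi> s \<ge> 0) (at_left c)"
      using eventually_at_left_real[OF \<open>a < c\<close>] by eventually_elim (auto intro: less)
    ultimately show ?thesis
      by (intro tendsto_lowerbound) auto
  qed
  have "c = b"
  proof (rule ccontr)
    assume "c \<noteq> b"
    then have "c < b" using cab by auto
    from q'[OF cab(1) this] obtain d1 where d1: "d1 > 0"
      "\<And>s. c \<le> s \<Longrightarrow> s < c + d1 \<Longrightarrow> norm (q s - q c - (s - c) *\<^sub>R q' c) \<le> (e/2) * (s - c)"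
      unfolding has_rderiv_iff using e by (meson half_gt_zero)
    have "has_rderiv \<mu> (\<mu>' c) c"
      using mu[OF cab] has_real_derivative_iff_has_vector_derivative
      by (blast intro: has_vector_derivative_at_within)
    then obtain d2 where d2: "d2 > 0"
      "\<And>s. c \<le> s \<Longrightarrow> s < c + d2 \<Longrightarrow> norm (\<mu> s - \<mu> c - (s - c) *\<^sub>R \<mu>' c) \<le> (e/2) * (s - c)"
      unfolding has_rderiv_iff using e by (meson half_gt_zero)
    define t where "t = min b (c + min d1 d2 / 2)"
    have t: "c < t" "t \<le> b" "t < c + d1" "t < c + d2" using d1 d2 \<open>c < b\<close> by (auto simp: t_def)
    have "\<psi> s \<ge> 0" if "a \<le> s" "s \<le> t" for s
    proof (cases "s \<le> c")
      case True then show ?thesis using cc less that by (cases "s = c") auto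
    next
      case False
      have "norm (q s - q c) \<le> norm (q s - q c - (s - c) *\<^sub>R q' c) + norm ((s - c) *\<^sub>R q' c)"
        by (metis diff_add_cancel norm_triangle_ineq)
      also have "norm ((s - c) *\<^sub>R q' c) \<le> (s - c) * \<mu>' c"
        using False le[OF cab(1) \<open>c < b\<close>] by (auto intro: mult_left_mono)
      finally have "norm (q s - q c) \<le> (e/2) * (s - c) + (s - c) * \<mu>' c"
        using d1(2)[of s] False t that by auto
      moreover have "\<bar>\<mu> s - \<mu> c - (s - c) * \<mu>' c\<bar> \<le> (e/2) * (s - c)"
        using d2(2)[of s] False t that by simp
      then have "(s - c) * \<mu>' c \<le> \<mu> s - \<mu> c + (e/2) * (s - c)" by linarith
      moreover have "norm (q s - q a) \<le> norm (q s - q c) + norm (q c - q a)"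
        using norm_triangle_ineq[of "q s - q c" "q c - q a"] by simp
      \<comment> \<open>The slack gained after \<open>c\<close> pays for both expansion errors, half
        for \<open>q\<close> and half for \<open>\<mu>\<close>.\<close>
      moreover have "e * (s - a) = (e/2) * (s - c) + (e/2) * (s - c) + e * (c - a)"
        by (simp add: field_simps)
      ultimately show ?thesis using cc unfolding \<psi>_def by linarith
    qed
    then have "t \<in> S" using t cab by (auto simp: S_def)
    then have "t \<le> c" unfolding c_def using bdd by (intro cSup_upper) auto
    then show False using t by auto
  qed
  then show "norm (q b - q a) \<le> \<mu> b - \<mu> a + e0" using cc e by (auto simp: \<psi>_def)
qed

lemma rderiv_zero_const:
  fixes q :: "real \<Rightarrow> 'a::real_normed_vector"
  assumes "continuous_on {a..b} q" "\<And>t. a \<le> t \<Longrightarrow> t < b \<Longrightarrow> has_rderiv q 0 t" "a \<le> b"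
  shows "q b = q a"
  using right_mvt[of a b q "\<lambda>_. 0" "\<lambda>_. 0" "\<lambda>_. 0"] assms by auto

section \<open>Cadlag paths\<close>

lemma cadlagD: "cadlag f \<Longrightarrow> (f \<longlongrightarrow> f t) (at_right t)"
  and cadlagE: "cadlag f \<Longrightarrow> \<exists>l. (f \<longlongrightarrow> l) (at_left t)"
  unfolding cadlag_def by auto

lemma cadlag_continuous:
  "continuous_on UNIV f \<Longrightarrow> cadlag f"
  unfolding cadlag_def continuous_on_def by (meson UNIV_I filterlim_at_split)

lemma cadlag_compose:
  assumes "cadlag f" "continuous_on UNIV g"
  shows "cadlag (\<lambda>t. g (f t))"
  unfolding cadlag_def
proof safe
  fix t
  show "((\<lambda>t. g (f t)) \<longlongrightarrow> g (f t)) (at_right t)"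
    by (rule continuous_on_tendsto_compose[OF assms(2) cadlagD[OF assms(1)]]) auto
  obtain l where "(f \<longlongrightarrow> l) (at_left t)" using cadlagE[OF assms(1)] by blast
  then show "\<exists>l. ((\<lambda>t. g (f t)) \<longlongrightarrow> l) (at_left t)"
    by (intro exI[of _ "g l"] continuous_on_tendsto_compose[OF assms(2)]) auto
qed

lemma cadlag_Pair:
  assumes "cadlag f" "cadlag g" shows "cadlag (\<lambda>t. (f t, g t))"
  unfolding cadlag_def
proof safe
  fix t
  show "((\<lambda>t. (f t, g t)) \<longlongrightarrow> (f t, g t)) (at_right t)"
    by (intro tendsto_Pair cadlagD assms)
  obtain l m where "(f \<longlongrightarrow> l) (at_left t)" "(g \<longlongrightarrow> m) (at_left t)"
    using cadlagE[OF assms(1)] cadlagE[OF assms(2)] by blast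
  then show "\<exists>l. ((\<lambda>t. (f t, g t)) \<longlongrightarrow> l) (at_left t)"
    by (intro exI[of _ "(l, m)"] tendsto_Pair)
qed

lemma cadlag_compose2:
  assumes "cadlag f" "cadlag g" "continuous_on UNIV (\<lambda>(x, y). h x y)"
  shows "cadlag (\<lambda>t. h (f t) (g t))"
  using cadlag_compose[OF cadlag_Pair[OF assms(1,2)] assms(3)] by simp

lemma cadlag_const [simp]: "cadlag (\<lambda>t. c)"
  by (rule cadlag_continuous) auto

lemma cadlag_add: "cadlag f \<Longrightarrow> cadlag g \<Longrightarrow> cadlag (\<lambda>t. f t + (g t :: 'a::real_normed_vector))"
  and cadlag_diff: "cadlag f \<Longrightarrow> cadlag g \<Longrightarrow> cadlag (\<lambda>t. f t - (g t :: 'a::real_normed_vector))"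
  by (rule cadlag_compose2; auto intro!: continuous_intros simp: case_prod_beta)+

lemma cadlag_shift:
  assumes "cadlag f" shows "cadlag (\<lambda>t. f (t + s))"
  unfolding cadlag_def
proof safe
  fix t
  show "((\<lambda>t. f (t + s)) \<longlongrightarrow> f (t + s)) (at_right t)"
  proof (rule filterlim_compose[OF cadlagD[OF assms]])
    show "filterlim (\<lambda>t. t + s) (at_right (t + s)) (at_right t)"
      unfolding filterlim_at by (auto intro!: tendsto_intros simp: eventually_at_filter)
  qed
  obtain l where "(f \<longlongrightarrow> l) (at_left (t + s))" using cadlagE[OF assms] by blast
  moreover have "filterlim (\<lambda>t. t + s) (at_left (t + s)) (at_left t)"
    unfolding filterlim_at
    by (auto intro!: tendsto_intros simp: eventually_at_filter)
  ultimately show "\<exists>l. ((\<lambda>t. f (t + s)) \<longlongrightarrow> l) (at_left t)"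
    using filterlim_compose by blast
qed

text \<open>Serves for forcings switched at time 0. The strict inequality matters: at
  \<open>c\<close> the second path already applies, so right continuity there comes from
  \<open>g\<close> and the left limit from \<open>f\<close>.\<close>

lemma cadlag_split:
  assumes "cadlag f" "cadlag g"
  shows "cadlag (\<lambda>t. if t < c then f t else g t)"
  unfolding cadlag_def
proof (intro allI conjI)
  fix t :: real
  let ?h = "\<lambda>t. if t < c then f t else g t"
  show "(?h \<longlongrightarrow> ?h t) (at_right t)"
  proof (cases "t < c")
    case True
    have "eventually (\<lambda>s. ?h s = f s) (at_right t)"
      using eventually_at_right_real[OF True] by eventually_elim auto
    then show ?thesis using cadlagD[OF assms(1), of t] True by (simp add: tendsto_cong)
  next
    case False
    have "eventually (\<lambda>s. ?h s = g s) (at_right t)"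
      unfolding eventually_at_filter using False by (intro always_eventually) auto
    then show ?thesis using cadlagD[OF assms(2), of t] False by (simp add: tendsto_cong)
  qed
  show "\<exists>l. (?h \<longlongrightarrow> l) (at_left t)"
  proof (cases "t \<le> c")
    case True
    have "eventually (\<lambda>s. ?h s = f s) (at_left t)"
      unfolding eventually_at_filter using True by (intro always_eventually) auto
    then show ?thesis using cadlagE[OF assms(1), of t] by (simp add: tendsto_cong)
  next
    case False
    then have "c < t" by simp
    have "eventually (\<lambda>s. ?h s = g s) (at_left t)"
      using eventually_at_left_real[OF \<open>c < t\<close>] by eventually_elim auto
    then show ?thesis using cadlagE[OF assms(2), of t] by (simp add: tendsto_cong)
  qed
qed

text \<open>Near each time the path is controlled by its left limit on one side and by its value on
  the other; finitely many such neighbourhoods cover the compact interval.\<close>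

lemma cadlag_bounded:
  fixes f :: "real \<Rightarrow> 'a::real_normed_vector"
  assumes "cadlag f"
  shows "\<exists>B>0. \<forall>t\<in>{a..b}. norm (f t) \<le> B"
proof -
  have "\<exists>d>0. \<exists>B. \<forall>s\<in>ball t d. norm (f s) \<le> B" for t
  proof -
    obtain l where l: "(f \<longlongrightarrow> l) (at_left t)" using cadlagE[OF assms] by blast
    have "eventually (\<lambda>s. norm (f s) < norm l + 1) (at_left t)"
      by (rule order_tendstoD(2)[OF tendsto_norm[OF l]]) simp
    then obtain b1 where b1: "b1 < t" "\<And>s. b1 < s \<Longrightarrow> s < t \<Longrightarrow> norm (f s) < norm l + 1"
      unfolding eventually_at_left_field by blast
    have "eventually (\<lambda>s. norm (f s) < norm (f t) + 1) (at_right t)"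
      by (rule order_tendstoD(2)[OF tendsto_norm[OF cadlagD[OF assms]]]) simp
    then obtain b2 where b2: "b2 > t" "\<And>s. t < s \<Longrightarrow> s < b2 \<Longrightarrow> norm (f s) < norm (f t) + 1"
      unfolding eventually_at_right_field by blast
    show ?thesis
    proof (rule exI[of _ "min (t - b1) (b2 - t)"], intro conjI exI[of _ "norm l + norm (f t) + 1"]
      ballI)
      fix s assume s: "s \<in> ball t (min (t - b1) (b2 - t))"
      then have "b1 < s" "s < b2" by (auto simp: dist_real_def)
      then show "norm (f s) \<le> norm l + norm (f t) + 1"
        using b1(2)[of s] b2(2)[of s] by (cases s t rule: linorder_cases) (auto simp: add.commute
          add_increasing intro: less_imp_le order.trans)
    qed (use b1 b2 in auto)
  qed
  then obtain d B where d: "\<And>t. d t > 0" and B: "\<And>t s. s \<in> ball t (d t) \<Longrightarrow> norm (f s) \<le> B t"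
    by metis
  have "{a..b} \<subseteq> (\<Union>t\<in>{a..b}. ball t (d t))" using d by (meson UN_I centre_in_ball subsetI)
  from compactE_image[OF compact_Icc _ this]
  obtain T where T: "finite T" "{a..b} \<subseteq> (\<Union>t\<in>T. ball t (d t))"
    by (metis open_ball)
  show ?thesis
  proof (intro exI[of _ "1 + (\<Sum>t\<in>T. \<bar>B t\<bar>)"] conjI ballI)
    show "1 + (\<Sum>t\<in>T. \<bar>B t\<bar>) > 0" by (simp add: sum_nonneg add_pos_nonneg)
    fix s assume "s \<in> {a..b}"
    then obtain t where "t \<in> T" "s \<in> ball t (d t)" using T by blast
    then have "norm (f s) \<le> B t" using B by blast
    also have "\<dots> \<le> (\<Sum>t\<in>T. \<bar>B t\<bar>)" using \<open>t \<in> T\<close> T(1)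
      by (intro order.trans[OF _ member_le_sum]) auto
    finally show "norm (f s) \<le> 1 + (\<Sum>t\<in>T. \<bar>B t\<bar>)" by simp
  qed
qed

text \<open>Because of the \<open>+ 1\<close> the grid point lies strictly after \<open>t\<close>
  even when \<open>t\<close> is itself on the grid. The sequence thus stays in
  \<open>at_right t\<close>, where a cadlag path converges to its value.\<close>

lemma floor_approx_at_right:
  fixes t :: real and m :: "nat \<Rightarrow> nat"
  assumes m: "\<And>n. m n > 0" and lim: "(\<lambda>n. 1 / real (m n)) \<longlonglongrightarrow> 0"
  shows "filterlim (\<lambda>n. (of_int \<lfloor>t * real (m n)\<rfloor> + 1) / real (m n)) (at_right t) sequentially"
proof -
  let ?s = "\<lambda>n. (of_int \<lfloor>t * real (m n)\<rfloor> + 1) / real (m n)"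
  have gt: "?s n > t" for n
    using floor_correct[of "t * real (m n)"] m[of n] by (simp add: pos_less_divide_eq)
  have le: "?s n \<le> t + 1 / real (m n)" for n
  proof -
    have "?s n \<le> (t * real (m n) + 1) / real (m n)"
      by (intro divide_right_mono add_right_mono of_int_floor_le) simp
    then show ?thesis using m[of n] by (simp add: add_divide_distrib)
  qed
  have "(\<lambda>n. t + 1 / real (m n)) \<longlonglongrightarrow> t + 0" by (intro tendsto_intros lim)
  then have "?s \<longlonglongrightarrow> t"
    by (intro real_tendsto_sandwich[of "\<lambda>_. t" ?s sequentially "\<lambda>n. t + 1 / real (m n)"])
      (use gt le in \<open>auto intro!: always_eventually less_imp_le\<close>)
  then show ?thesis
    unfolding filterlim_at
  proof (intro conjI always_eventually allI)
    show "?s n \<noteq> t" "?s n \<in> {t<..}" for n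
      using gt[of n] by (simp_all only: greaterThan_iff less_imp_neq[symmetric] not_False_eq_True)
  qed
qed

text \<open>Evaluation at the next grid point factors through an integer-valued floor, hence is
  measurable; right continuity makes these step functions converge pointwise.\<close>

lemma cadlag_measurable [measurable]:
  fixes f :: "real \<Rightarrow> 'a::{second_countable_topology, metric_space}"
  assumes "cadlag f"
  shows "f \<in> borel_measurable borel"
proof (rule borel_measurable_LIMSEQ_metric)
  fix n :: nat
  have "(\<lambda>t::real. (\<lambda>i::int. f ((of_int i + 1) / of_nat (Suc n))) \<lfloor>t * of_nat (Suc n)\<rfloor>) \<in>
      borel_measurable borel"
  proof (rule measurable_compose[of "\<lambda>t::real. \<lfloor>t * of_nat (Suc n)\<rfloor>" borel "count_space UNIV"])
    show "(\<lambda>t::real. \<lfloor>t * of_nat (Suc n)\<rfloor>) \<in> borel \<rightarrow>\<^sub>M count_space UNIV"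
      by (rule measurable_compose[OF _ measurable_real_floor]) simp
  qed simp
  then show "(\<lambda>t::real. f ((of_int \<lfloor>t * of_nat (Suc n)\<rfloor> + 1) / of_nat (Suc n))) \<in> borel_measurable
      borel" by simp
next
  fix t :: real
  show "(\<lambda>n. f ((of_int \<lfloor>t * of_nat (Suc n)\<rfloor> + 1) / of_nat (Suc n))) \<longlonglongrightarrow> f t"
    by (rule filterlim_compose[OF cadlagD[OF assms] floor_approx_at_right[of Suc]])
      (use LIMSEQ_Suc[OF lim_1_over_n] in auto)
qed

section \<open>Indefinite integrals of cadlag paths\<close>

lemma cadlag_set_integrable:
  fixes p :: "real \<Rightarrow> 'a::euclidean_space"
  assumes "cadlag p" shows "set_integrable lborel {a..b} p"
proof -
  obtain B where B: "\<forall>t\<in>{a..b}. norm (p t) \<le> B" using cadlag_bounded[OF assms] by blast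
  show ?thesis
    unfolding set_integrable_def
  proof (rule integrableI_bounded_set_indicator[where B=B])
    show "emeasure lborel {a..b} < \<infinity>" by (simp add: emeasure_lborel_Icc_eq)
    show "p \<in> borel_measurable lborel" using cadlag_measurable[OF assms] by simp
    show "AE x in lborel. x \<in> {a..b} \<longrightarrow> norm (p x) \<le> B" using B by (intro AE_I2) blast
  qed simp
qed

lemma cadlag_interval_integrable:
  fixes p :: "real \<Rightarrow> 'a::euclidean_space"
  assumes "cadlag p" shows "interval_lebesgue_integrable lborel (ereal a) (ereal b) p"
  unfolding interval_lebesgue_integrable_def
  by (auto intro: set_integrable_subset[OF cadlag_set_integrable[OF assms, of a b]]
      set_integrable_subset[OF cadlag_set_integrable[OF assms, of b a]] simp: subset_iff)

lemma cadlag_integral_diff: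
  fixes p :: "real \<Rightarrow> 'a::euclidean_space"
  assumes "cadlag p"
  shows "(LBINT r=ereal 0..ereal t. p r) - (LBINT r=ereal 0..ereal s. p r) = (LBINT r=ereal s..ereal
      t. p r)"
proof -
  have "(LBINT r=ereal 0..ereal s. p r) + (LBINT r=ereal s..ereal t. p r) = (LBINT r=ereal 0..ereal
      t. p r)"
    by (rule interval_integral_sum)
      (use cadlag_interval_integrable[OF assms, of "min 0 (min s t)" "max 0 (max s t)"] in simp)
  then show ?thesis by (simp add: algebra_simps)
qed

lemma cadlag_integral_norm_le:
  fixes p :: "real \<Rightarrow> 'a::euclidean_space"
  assumes "cadlag p" "s \<le> t"
  shows "norm (LBINT r=ereal s..ereal t. p r) \<le> (LBINT r=ereal s..ereal t. norm (p r))"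
proof (cases "s < t")
  case True
  then show ?thesis
    by (intro interval_integral_norm) (use cadlag_interval_integrable[OF assms(1)] in auto)
next
  case False
  then have "s = t" using \<open>s \<le> t\<close> by simp
  then show ?thesis by simp
qed

lemma cadlag_integral_step:
  fixes p :: "real \<Rightarrow> 'a::euclidean_space"
  assumes p: "cadlag p" and "s \<le> t" and B: "\<And>r. s < r \<Longrightarrow> r < t \<Longrightarrow> norm (p r - c) \<le> B"
  shows "norm ((LBINT r=ereal 0..ereal t. p r) - (LBINT r=ereal 0..ereal s. p r) - (t - s) *\<^sub>R c)
      \<le> B * (t - s)"
proof -
  have "(LBINT r=ereal s..ereal t. c) = (t - s) *\<^sub>R c"
    using \<open>s \<le> t\<close> by (simp add: interval_lebesgue_integral_le_eq set_integral_const)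
  then have "(LBINT r=ereal s..ereal t. p r) - (t - s) *\<^sub>R c = (LBINT r=ereal s..ereal t. p r - c)"
    by (subst interval_lebesgue_integral_diff(2)) (auto intro!: cadlag_interval_integrable p)
  moreover have "norm (LBINT r=ereal s..ereal t. p r - c) \<le> B * (t - s)"
  proof (cases "s < t")
    case True
    have pc: "cadlag (\<lambda>r. p r - c)" by (intro cadlag_diff p) auto
    have "norm (LBINT r=ereal s..ereal t. p r - c) \<le> (LBINT r=ereal s..ereal t. norm (p r - c))"
      by (rule cadlag_integral_norm_le[OF pc \<open>s \<le> t\<close>])
    also have "\<dots> \<le> (LBINT r=ereal s..ereal t. B)"
      unfolding interval_lebesgue_integral_le_eq[OF ereal_less_eq(3)[THEN iffD2, OF \<open>s \<le> t\<close>]]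
    proof (rule set_integral_mono)
      show "set_integrable lborel (einterval (ereal s) (ereal t)) (\<lambda>r. norm (p r - c))"
        using cadlag_interval_integrable[OF pc, of s t] True
        by (intro set_integrable_norm) (auto simp: interval_lebesgue_integrable_def)
      show "set_integrable lborel (einterval (ereal s) (ereal t)) (\<lambda>r. B)"
        using True cadlag_interval_integrable[OF cadlag_const, of s t B]
        by (simp only: interval_lebesgue_integrable_def ereal_less_eq less_imp_le if_True)
    qed (use B in auto)
    also have "\<dots> = B * (t - s)" using True by (simp add: mult.commute)
    finally show ?thesis .
  next
    case False
    then have "s = t" using \<open>s \<le> t\<close> by simp
    then show ?thesis by simp
  qed
  ultimately show ?thesis by (simp add: cadlag_integral_diff[OF p])
qed

lemma cadlag_integral_rderiv:
  fixes p :: "real \<Rightarrow> 'a::euclidean_space"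
  assumes p: "cadlag p"
  shows "has_rderiv (\<lambda>t. LBINT r=ereal 0..ereal t. p r) (p t) t"
  unfolding has_rderiv_iff
proof (intro allI impI)
  fix e :: real assume "e > 0"
  have "eventually (\<lambda>s. norm (p s - p t) < e) (at_right t)"
    using tendstoD[OF cadlagD[OF p, of t] \<open>e > 0\<close>] by (simp add: dist_norm)
  then obtain b where b: "b > t" "\<And>s. t < s \<Longrightarrow> s < b \<Longrightarrow> norm (p s - p t) < e"
    unfolding eventually_at_right_field by blast
  show "\<exists>d>0. \<forall>s. t \<le> s \<and> s < t + d \<longrightarrow>
     norm ((LBINT r=ereal 0..ereal s. p r) - (LBINT r=ereal 0..ereal t. p r) - (s - t) *\<^sub>R p t) \<le> e
       * (s - t)"
    by (intro exI[of _ "b - t"] conjI allI impI cadlag_integral_step[OF p])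
      (use b in \<open>auto intro!: less_imp_le\<close>)
qed

text \<open>Only integrability is assumed, because \<open>solves\<close> provides nothing more;
  continuity of the integral is the first step towards showing that a solution is cadlag.\<close>

lemma interval_integral_continuous:
  fixes p :: "real \<Rightarrow> 'a::euclidean_space"
  assumes "\<And>t. interval_lebesgue_integrable lborel (ereal 0) (ereal t) p"
  shows "continuous_on UNIV (\<lambda>t. LBINT s=ereal 0..ereal t. p s)"
proof -
  have si: "set_integrable lborel {-a..a} p" if "a > 0" for a
  proof -
    have "set_integrable lborel {-(a+1)<..<0} p" "set_integrable lborel {0<..<a+1} p"
      using assms[of "- (a+1)"] assms[of "a+1"] that
        by (auto simp: interval_lebesgue_integrable_def)
    \<comment> \<open>Interval integrability speaks of open intervals, so the common end point 0 has
      to be glued in separately.\<close>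
    moreover have "set_integrable lborel {0::real} p"
    proof -
      have "(\<lambda>x. indicator {0::real} x *\<^sub>R p x) = (\<lambda>x. indicator {0} x *\<^sub>R p 0)"
        by (auto simp: indicator_def)
      then show ?thesis unfolding set_integrable_def by simp
    qed
    ultimately have "set_integrable lborel ({-(a+1)<..<0} \<union> {0<..<a+1} \<union> {0}) p"
      by (intro set_integrable_Un) auto
    then show ?thesis by (rule set_integrable_subset) auto
  qed
  have c: "continuous_on {-a..a} (\<lambda>t. LBINT s=ereal 0..ereal t. p s)" if "a > 0" for a
  proof -
    have io: "p integrable_on {-a..a}" using set_borel_integral_eq_integral(1)[OF si[OF that]] .
    have eq: "(LBINT s=ereal 0..ereal t. p s) = integral {-a..t} p - integral {-a..0} p"
      if t: "t \<in> {-a..a}" for t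
    proof -
      have *: "(LBINT s=ereal (-a)..ereal r. p s) = integral {-a..r} p" if "r \<in> {-a..a}" for r
        by (rule interval_integral_eq_integral) (use that in \<open>auto intro: set_integrable_subset[OF
          si[OF \<open>a > 0\<close>]]\<close>)
      have "(LBINT s=ereal (-a)..ereal 0. p s) + (LBINT s=ereal 0..ereal t.
          p s) = (LBINT s=ereal (-a)..ereal t. p s)"
        by (rule interval_integral_sum)
          (use t \<open>a > 0\<close> in \<open>auto simp: interval_lebesgue_integrable_def min_def max_def intro:
            set_integrable_subset[OF si[OF \<open>a > 0\<close>]]\<close>)
      then show ?thesis using *[of 0] *[of t] t \<open>a > 0\<close> by (simp add: algebra_simps)
    qed
    have "continuous_on {-a..a} (\<lambda>t. integral {-a..t} p - integral {-a..0} p)"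
      by (intro continuous_intros indefinite_integral_continuous_1 io)
    then show ?thesis by (rule continuous_on_eq) (simp add: eq)
  qed
  have "continuous_on {-a<..<a} (\<lambda>t. LBINT s=ereal 0..ereal t. p s)" for a
    by (cases "a > 0") (auto intro: continuous_on_subset[OF c])
  moreover have "(\<Union>a. {-a<..<a::real}) = UNIV"
  proof -
    have "x \<in> {-(\<bar>x\<bar>+1)<..<\<bar>x\<bar>+1}" for x :: real by auto
    then show ?thesis by blast
  qed
  ultimately show ?thesis
    using continuous_on_open_UN[of UNIV "\<lambda>a. {-a<..<a::real}" "\<lambda>t. LBINT s=ereal 0..ereal t. p s"]
      by simp
qed

lemma cadlag_integral_continuous:
  fixes p :: "real \<Rightarrow> 'a::euclidean_space"
  assumes "cadlag p"
  shows "continuous_on UNIV (\<lambda>t. LBINT r=ereal 0..ereal t. p r)"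
  by (intro interval_integral_continuous cadlag_interval_integrable assms)

text \<open>The bridge between integral equations and right derivatives. For the converse,
  \<open>z\<close> minus the integral is continuous with right derivative 0, hence constant.\<close>

lemma integral_eq_iff_rderiv:
  fixes p :: "real \<Rightarrow> 'a::euclidean_space"
  assumes p: "cadlag p"
  shows "(\<forall>t. z t = z0 + (LBINT s=ereal 0..ereal t. p s)) \<longleftrightarrow>
     z 0 = z0 \<and> continuous_on UNIV z \<and> (\<forall>t. has_rderiv z (p t) t)"
proof (intro iffI conjI allI)
  assume *: "\<forall>t. z t = z0 + (LBINT s=ereal 0..ereal t. p s)"
  then have z: "z = (\<lambda>t. z0 + (LBINT s=ereal 0..ereal t. p s))" by auto
  show "z 0 = z0" by (simp add: z)
  show "continuous_on UNIV z" unfolding z by (intro continuous_intros cadlag_integral_continuous p)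
  show "has_rderiv z (p t) t" for t
    unfolding z using has_vector_derivative_add[OF has_vector_derivative_const
      cadlag_integral_rderiv[OF p]] by auto
next
  let ?P = "\<lambda>t. LBINT r=ereal 0..ereal t. p r"
  assume *: "z 0 = z0 \<and> continuous_on UNIV z \<and> (\<forall>t. has_rderiv z (p t) t)"
  fix t
  have c: "continuous_on A (\<lambda>t. z t - ?P t)" for A
    by (rule continuous_on_subset[OF _ subset_UNIV]) (intro continuous_intros
      cadlag_integral_continuous p, use * in auto)
  have d: "has_rderiv (\<lambda>t. z t - ?P t) 0 t" for t
    using has_vector_derivative_diff[OF _ cadlag_integral_rderiv[OF p]] * by fastforce
  have "z t - ?P t = z 0 - ?P 0"
    using rderiv_zero_const[OF c d, of 0 t] rderiv_zero_const[OF c d, of t 0]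
      by (cases "0 \<le> t") auto
  then show "z t = z0 + ?P t" using * by (simp add: algebra_simps)
qed

section \<open>Matrix exponential\<close>

abbreviation matrix_power :: "real^'n^'n \<Rightarrow> nat \<Rightarrow> real^'n^'n" where
  "matrix_power A k \<equiv> ((**) A ^^ k) (mat 1)"

lemma scaleR_matrix_mult: "(k *\<^sub>R A) ** (B :: real^'n^'m) = k *\<^sub>R (A ** B)"
  and matrix_mult_scaleR: "C ** (k *\<^sub>R B) = k *\<^sub>R (C ** (B :: real^'n^'m))"
  by (simp_all add: vec_eq_iff matrix_matrix_mult_def sum_distrib_left ac_simps)

lemma matrix_add_mult_distrib: "(A + B) ** (C :: real^'n^'m) = A ** C + B ** C"
  by (simp add: vec_eq_iff matrix_matrix_mult_def sum.distrib algebra_simps)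

lemma matrix_power_commute: "A ** matrix_power A k = matrix_power A k ** A"
  by (induction k) (simp_all add: matrix_mul_assoc)

lemma matrix_power_scaleR: "matrix_power (t *\<^sub>R A) k = t ^ k *\<^sub>R matrix_power A k"
  by (induction k) (simp_all add: scaleR_matrix_mult matrix_mult_scaleR mult.commute)

lemma norm_matrix_mult_le:
  fixes A :: "real^'n^'n"
  obtains B where "B > 0" "\<And>X :: real^'n^'n. norm (A ** X) \<le> B * norm X"
proof -
  have "linear (\<lambda>X :: real^'n^'n. A ** X)"
    by (rule linearI) (simp_all add: matrix_add_ldistrib matrix_mult_scaleR scaleR_matrix_mult)
  then show thesis using linear_bounded_pos that by (metis mult.commute)
qed

lemma summable_matrix_exp:
  fixes A :: "real^'n^'n"
  shows "summable (\<lambda>k. (t ^ k / fact k) *\<^sub>R matrix_power A k)"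
proof -
  obtain B where B: "B > 0" "\<And>X :: real^'n^'n. norm (A ** X) \<le> B * norm X"
    using norm_matrix_mult_le[of A] by blast
  have bound: "norm (matrix_power A k) \<le> B ^ k * norm (mat 1 :: real^'n^'n)" for k
  proof (induction k)
    case (Suc k)
    have "norm (A ** matrix_power A k) \<le> B * norm (matrix_power A k)" by (rule B)
    also have "\<dots> \<le> B * (B ^ k * norm (mat 1 :: real^'n^'n))" using Suc B
      by (intro mult_left_mono) auto
    finally show ?case by (simp add: mult.assoc)
  qed simp
  show ?thesis
  proof (rule summable_comparison_test')
    show "summable (\<lambda>k. norm (mat 1 :: real^'n^'n) * (inverse (fact k) * (\<bar>t\<bar> * B) ^ k))"
      by (intro summable_mult summable_exp)
    show "norm ((t ^ k / fact k) *\<^sub>R matrix_power A k) \<le> norm (mat 1 :: real^'n^'n) * (inverse (fact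
        k) * (\<bar>t\<bar> * B) ^ k)"
      for k
    proof -
      have "norm ((t ^ k / fact k) *\<^sub>R matrix_power A k) = \<bar>t\<bar> ^ k / fact k * norm (matrix_power A
          k)"
        by (simp add: power_abs)
      also have "\<dots> \<le> \<bar>t\<bar> ^ k / fact k * (B ^ k * norm (mat 1 :: real^'n^'n))"
        by (intro mult_left_mono bound) auto
      finally show ?thesis by (simp add: field_simps power_mult_distrib)
    qed
  qed
qed

lemma matrix_exp_scaleR: "matrix_exp (t *\<^sub>R A) = (\<Sum>k. (t ^ k / fact k) *\<^sub>R matrix_power A k)"
  unfolding matrix_exp_def matrix_power_scaleR by simp

text \<open>The factor \<open>M\<close> allows two uses: \<open>mat 1\<close> gives the entries of
  the exponential, \<open>A\<close> those of its derivative.\<close>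

lemma matrix_exp_component_sums:
  fixes A M :: "real^'n^'n"
  shows "(\<lambda>k. (t ^ k / fact k) * (M ** matrix_power A k) $ i $ j) sums (M ** matrix_exp (t *\<^sub>R A)) $
      i $ j"
proof -
  have lin: "linear (\<lambda>X :: real^'n^'n. (M ** X) $ i $ j)"
    by (rule linearI) (simp_all add: matrix_add_ldistrib matrix_mult_scaleR scaleR_matrix_mult)
  have "(\<lambda>k. (t ^ k / fact k) *\<^sub>R matrix_power A k) sums matrix_exp (t *\<^sub>R A)"
    unfolding matrix_exp_scaleR using summable_matrix_exp by (rule summable_sums)
  from bounded_linear.sums[OF linear_conv_bounded_linear[THEN iffD1, OF lin] this]
  show ?thesis by (simp add: linear_cmul[OF lin])
qed

lemma matrix_exp_commute:
  fixes A :: "real^'n^'n"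
  shows "A ** matrix_exp (t *\<^sub>R A) = matrix_exp (t *\<^sub>R A) ** A"
proof -
  have lin: "linear (\<lambda>X :: real^'n^'n. A ** X)" "linear (\<lambda>X :: real^'n^'n. X ** A)"
    by (rule linearI; simp add: matrix_add_ldistrib matrix_add_mult_distrib matrix_mult_scaleR
      scaleR_matrix_mult)+
  have s: "(\<lambda>k. (t ^ k / fact k) *\<^sub>R matrix_power A k) sums matrix_exp (t *\<^sub>R A)"
    unfolding matrix_exp_scaleR using summable_matrix_exp by (rule summable_sums)
  have "(\<lambda>k. (t ^ k / fact k) *\<^sub>R (A ** matrix_power A k)) sums (A ** matrix_exp (t *\<^sub>R A))"
    using bounded_linear.sums[OF linear_conv_bounded_linear[THEN iffD1, OF lin(1)] s]
      by (simp add: linear_cmul[OF lin(1)])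
  moreover have "(\<lambda>k. (t ^ k / fact k) *\<^sub>R (matrix_power A k ** A)) sums (matrix_exp (t *\<^sub>R A) **
      A)"
    using bounded_linear.sums[OF linear_conv_bounded_linear[THEN iffD1, OF lin(2)] s]
      by (simp add: linear_cmul[OF lin(2)])
  ultimately show ?thesis by (simp add: matrix_power_commute sums_unique2)
qed

lemma matrix_exp_zero [simp]: "matrix_exp (0 :: real^'n^'n) = mat 1"
proof -
  have "(\<Sum>k. (0 ^ k / fact k) *\<^sub>R matrix_power (0 :: real^'n^'n) k) = mat 1"
    by (subst suminf_finite[of "{0}"]) auto
  then show ?thesis using matrix_exp_scaleR[of 0 "0 :: real^'n^'n"] by simp
qed

text \<open>Each entry is a scalar power series convergent everywhere, so it may be differentiated
  term by term.\<close>

lemma matrix_exp_component_deriv: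
  "((\<lambda>t. matrix_exp (t *\<^sub>R A) $ i $ j) has_real_derivative (A ** matrix_exp (t *\<^sub>R A)) $ i $ j) (at
      t)"
proof -
  define c where "c k = matrix_power A k $ i $ j / fact k" for k
  have s: "(\<lambda>k. c k * x ^ k) sums matrix_exp (x *\<^sub>R A) $ i $ j" for x
    using matrix_exp_component_sums[of x "mat 1" A i j] by (simp add: c_def field_simps)
  have d: "diffs c k * x ^ k = (x ^ k / fact k) * (A ** matrix_power A k) $ i $ j" for k x
  proof -
    have "diffs c k * x ^ k = (real (Suc k) / fact (Suc k)) * (x ^ k * (A ** matrix_power A k) $ i $
        j)"
      by (simp add: diffs_def c_def)
    also have "real (Suc k) / fact (Suc k) = 1 / fact k"
      by (subst fact_Suc) (simp del: of_nat_Suc)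
    finally show ?thesis by simp
  qed
  have "((\<lambda>x. \<Sum>k. c k * x ^ k) has_real_derivative (\<Sum>k. diffs c k * t ^ k)) (at t)"
    by (rule termdiffs_strong_converges_everywhere) (use s in \<open>auto intro: sums_summable\<close>)
  moreover have "(\<Sum>k. diffs c k * t ^ k) = (A ** matrix_exp (t *\<^sub>R A)) $ i $ j"
    unfolding d using matrix_exp_component_sums by (rule sums_unique[symmetric])
  moreover have "(\<lambda>x. \<Sum>k. c k * x ^ k) = (\<lambda>x. matrix_exp (x *\<^sub>R A) $ i $ j)"
    using s by (auto simp: sums_iff)
  ultimately show ?thesis by simp
qed

lemma matrix_exp_has_vector_derivative:
  "((\<lambda>t. matrix_exp (t *\<^sub>R A)) has_vector_derivative A ** matrix_exp (t *\<^sub>R A)) (at t within X)"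
proof -
  have "((\<lambda>t. matrix_exp (t *\<^sub>R A) $ i $ j) has_vector_derivative (A ** matrix_exp (t *\<^sub>R A)) $ i $
      j) (at t within X)" for i j
    using matrix_exp_component_deriv has_real_derivative_iff_has_vector_derivative
      has_vector_derivative_at_within by blast
  then have "((\<lambda>t. matrix_exp (t *\<^sub>R A)) has_vector_derivative (\<chi> i. \<chi> j.
      (A ** matrix_exp (t *\<^sub>R A)) $ i $ j)) (at t within X)"
    unfolding has_vector_derivative_def has_derivative_componentwise_within[of "\<lambda>t.
        matrix_exp (t *\<^sub>R A)"]
    by (auto simp: Basis_vec_def inner_axis)
  then show ?thesis by simp
qed

lemma bounded_bilinear_matrix_vector: "bounded_bilinear ((*v) :: real^'n^'m \<Rightarrow> real^'n \<Rightarrow> real^'m)"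
  unfolding bilinear_conv_bounded_bilinear[symmetric] bilinear_def
  by (auto intro!: linearI simp: matrix_vector_mult_add_rdistrib matrix_vector_right_distrib
    scaleR_matrix_vector_assoc
      matrix_vector_mult_scaleR)

definition mexp :: "real^'n^'n \<Rightarrow> real \<Rightarrow> real^'n \<Rightarrow> real^'n" where
  "mexp A t x = matrix_exp (t *\<^sub>R A) *v x"

lemma mexp_zero [simp]: "mexp A 0 x = x"
  by (simp add: mexp_def)

lemma linear_mexp: "linear (mexp A t)"
  unfolding mexp_def by (rule matrix_vector_mul_linear)

lemma mexp_vec_zero [simp]: "mexp A t 0 = 0"
  by (simp add: mexp_def)

lemma mexp_add: "mexp A t (x + y) = mexp A t x + mexp A t y"
  and mexp_diff: "mexp A t (x - y) = mexp A t x - mexp A t y"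
  and mexp_scaleR: "mexp A t (c *\<^sub>R x) = c *\<^sub>R mexp A t x"
  and mexp_minus: "mexp A t (- x) = - mexp A t x"
  by (simp_all add: linear_add linear_diff linear_cmul linear_neg linear_mexp)

lemma mexp_commute: "A *v mexp A t x = mexp A t (A *v x)"
  unfolding mexp_def by (simp add: matrix_vector_mul_assoc matrix_exp_commute)

lemma mexp_has_vector_derivative:
  assumes "(f has_vector_derivative f') (at t within X)"
  shows "((\<lambda>t. mexp A t (f t)) has_vector_derivative mexp A t (A *v f t + f')) (at t within X)"
proof -
  have "((\<lambda>t. matrix_exp (t *\<^sub>R A) *v f t) has_vector_derivative
      (matrix_exp (t *\<^sub>R A) *v f' + (A ** matrix_exp (t *\<^sub>R A)) *v f t)) (at t within X)"
    by (rule bounded_bilinear.has_vector_derivative[OF bounded_bilinear_matrix_vector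
          matrix_exp_has_vector_derivative assms])
  moreover have "matrix_exp (t *\<^sub>R A) *v f' + (A ** matrix_exp (t *\<^sub>R A)) *v f t
      = mexp A t (A *v f t + f')"
    unfolding mexp_def by (simp add: matrix_vector_right_distrib matrix_vector_mul_assoc
      matrix_exp_commute)
  ultimately show ?thesis by (simp add: mexp_def)
qed

text \<open>Made for variation of constants: when \<open>\<tau>\<close> runs backwards,
  \<open>c = -1\<close> cancels the linear part of \<open>f'\<close> and leaves only the transported
  forcing.\<close>

lemma mexp_comp_deriv:
  assumes "(\<tau> has_vector_derivative c) (at t within X)" "(f has_vector_derivative f') (at t within
      X)"
  shows "((\<lambda>t. mexp A (\<tau> t) (f t)) has_vector_derivative mexp A (\<tau> t) (c *\<^sub>R (A *v f t) + f')) (at t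
      within X)"
proof -
  have "((\<lambda>t. matrix_exp (\<tau> t *\<^sub>R A)) has_vector_derivative c *\<^sub>R (A ** matrix_exp (\<tau> t *\<^sub>R A))) (at
      t within X)"
    using vector_diff_chain_within[OF assms(1) matrix_exp_has_vector_derivative, of A]
      by (simp add: o_def)
  from bounded_bilinear.has_vector_derivative[OF bounded_bilinear_matrix_vector this assms(2)]
  have "((\<lambda>t. matrix_exp (\<tau> t *\<^sub>R A) *v f t) has_vector_derivative
      (matrix_exp (\<tau> t *\<^sub>R A) *v f' + (c *\<^sub>R (A ** matrix_exp (\<tau> t *\<^sub>R A))) *v f t)) (at t within
        X)" .
  moreover have "matrix_exp (\<tau> t *\<^sub>R A) *v f' + (c *\<^sub>R (A ** matrix_exp (\<tau> t *\<^sub>R A))) *v f t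
      = mexp A (\<tau> t) (c *\<^sub>R (A *v f t) + f')"
    unfolding mexp_def
    by (simp add: matrix_vector_right_distrib matrix_vector_mul_assoc matrix_exp_commute
       scaleR_matrix_vector_assoc[symmetric] matrix_vector_mult_scaleR)
  ultimately show ?thesis by (simp add: mexp_def)
qed

lemma continuous_on_mexp [continuous_intros]:
  assumes "continuous_on X \<tau>" "continuous_on X f"
  shows "continuous_on X (\<lambda>t. mexp A (\<tau> t) (f t))"
proof -
  have "continuous_on UNIV (\<lambda>t. matrix_exp (t *\<^sub>R A))"
    by (auto intro!: continuous_at_imp_continuous_on has_vector_derivative_continuous[OF
      matrix_exp_has_vector_derivative])
  then have "continuous_on X (\<lambda>t. matrix_exp (\<tau> t *\<^sub>R A))"
    by (rule continuous_on_compose2[OF _ assms(1)]) auto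
  then show ?thesis
    unfolding mexp_def by (rule bounded_bilinear.continuous_on[OF bounded_bilinear_matrix_vector _
      assms(2)])
qed

text \<open>Moving time \<open>r\<close> from the outer to the inner exponential does not change the
  value, since the derivative in \<open>r\<close> vanishes; the claim compares \<open>r = 0\<close>
  with \<open>r = s\<close>.\<close>

lemma mexp_semigroup: "mexp A s (mexp A t x) = mexp A (s + t) x"
proof -
  have d: "((\<lambda>r. mexp A (s - r) (mexp A (t + r) x)) has_vector_derivative 0) (at r)" for r
  proof -
    have "((\<lambda>r. mexp A (t + r) x) has_vector_derivative mexp A (t + r) (1 *\<^sub>R (A *v x) + 0)) (at r)"
      by (rule mexp_comp_deriv) (auto intro!: derivative_eq_intros)
    then have "((\<lambda>r. mexp A (s - r) (mexp A (t + r) x)) has_vector_derivative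
       mexp A (s - r) ((-1) *\<^sub>R (A *v (mexp A (t + r) x)) + mexp A (t + r) (1 *\<^sub>R (A *v x) + 0)))
         (at r)"
      by (intro mexp_comp_deriv) (auto intro!: derivative_eq_intros)
    then show ?thesis by (simp add: mexp_commute)
  qed
  obtain c where "mexp A (s - r) (mexp A (t + r) x) = c" for r
    using has_vector_derivative_zero_constant[of UNIV "\<lambda>r. mexp A (s - r) (mexp A (t + r) x)"] d
      by auto
  from this[of 0] this[of s] show ?thesis by (simp add: add.commute)
qed

lemma mexp_inverse [simp]: "mexp A (- t) (mexp A t x) = x" "mexp A t (mexp A (- t) x) = x"
  by (simp_all add: mexp_semigroup)

lemma mexp_matrix_scaleR: "mexp (c *\<^sub>R A) t x = mexp A (t * c) x"
  by (simp add: mexp_def)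

section \<open>Riemann--Stieltjes integrals against cadlag paths\<close>

text \<open>A cadlag path oscillates by less than \<open>e\<close> on each half of a small enough
  ball around any time. \<open>T\<close> collects the break points of a finite cover by such
  balls.\<close>

lemma cadlag_oscillation:
  fixes f :: "real \<Rightarrow> 'a::real_normed_vector"
  assumes f: "cadlag f" and "e > 0"
  obtains T where "finite T"
    "\<And>s t. a \<le> s \<Longrightarrow> s \<le> t \<Longrightarrow> t \<le> b \<Longrightarrow> (\<And>c. c \<in> T \<Longrightarrow> \<not> (s < c \<and> c \<le> t)) \<Longrightarrow> norm (f s - f t) < e"
proof -
  have "\<exists>d>0. (\<forall>s r. t - d < s \<and> s < t \<and> t - d < r \<and> r < t \<longrightarrow> norm (f s - f r) < e) \<and>
    (\<forall>s r. t \<le> s \<and> s < t + d \<and> t \<le> r \<and> r < t + d \<longrightarrow> norm (f s - f r) < e)" for t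
  proof -
    obtain l where l: "(f \<longlongrightarrow> l) (at_left t)" using cadlagE[OF f] by blast
    have "eventually (\<lambda>s. dist (f s) l < e/2) (at_left t)" using l \<open>e > 0\<close> tendstoD half_gt_zero
      by blast
    then obtain b1 where b1: "b1 < t" "\<And>s. b1 < s \<Longrightarrow> s < t \<Longrightarrow> dist (f s) l < e/2"
      unfolding eventually_at_left_field by blast
    have "eventually (\<lambda>s. dist (f s) (f t) < e/2) (at_right t)"
      using cadlagD[OF f] \<open>e > 0\<close> tendstoD half_gt_zero by blast
    then obtain b2 where b2: "b2 > t" "\<And>s. t < s \<Longrightarrow> s < b2 \<Longrightarrow> dist (f s) (f t) < e/2"
      unfolding eventually_at_right_field by blast
    have b2': "dist (f s) (f t) < e/2" if "t \<le> s" "s < b2" for s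
      using b2(2)[of s] that \<open>e > 0\<close> by (cases "s = t") auto
    have *: "norm (f s - f r) < e" if "dist (f s) c < e/2" "dist (f r) c < e/2" for s r c
      using dist_triangle_half_l[OF that] by (simp add: dist_norm)
    show ?thesis
    proof (rule exI[of _ "min (t - b1) (b2 - t)"], intro conjI allI impI)
      fix s r assume "t - min (t - b1) (b2 - t) < s \<and> s < t \<and> t - min (t - b1) (b2 - t) < r \<and> r < t"
      then show "norm (f s - f r) < e" by (intro *[of s l r] b1) auto
    next
      fix s r assume "t \<le> s \<and> s < t + min (t - b1) (b2 - t) \<and> t \<le> r \<and> r < t + min (t - b1) (b2 - t)"
      then show "norm (f s - f r) < e" by (intro *[of s "f t" r] b2') auto
    qed (use b1 b2 in auto)
  qed
  then obtain d where d: "\<And>t. d t > 0"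
    and d1: "\<And>t s r. t - d t < s \<Longrightarrow> s < t \<Longrightarrow> t - d t < r \<Longrightarrow> r < t \<Longrightarrow> norm (f s - f r) < e"
    and d2: "\<And>t s r. t \<le> s \<Longrightarrow> s < t + d t \<Longrightarrow> t \<le> r \<Longrightarrow> r < t + d t \<Longrightarrow> norm (f s - f r) < e"
    by metis
  have "{a..b} \<subseteq> (\<Union>t\<in>{a..b}. ball t (d t))" using d by (meson UN_I centre_in_ball subsetI)
  from compactE_image[OF compact_Icc _ this]
  obtain T where T: "finite T" "{a..b} \<subseteq> (\<Union>t\<in>T. ball t (d t))"
    by (metis open_ball)
  \<comment> \<open>Centres and right end points both count: if \<open>s\<close> lies in the ball
    around \<open>c\<close>, avoiding \<open>c\<close> keeps \<open>s\<close> and \<open>t\<close>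
    on the same side of it, and avoiding \<open>c + d c\<close> keeps \<open>t\<close> inside the
    ball.\<close>
  show thesis
  proof (rule that[of "T \<union> (\<lambda>t. t + d t) ` T"])
    fix s t assume st: "a \<le> s" "s \<le> t" "t \<le> b"
      and no: "\<And>c. c \<in> T \<union> (\<lambda>t. t + d t) ` T \<Longrightarrow> \<not> (s < c \<and> c \<le> t)"
    then have "s \<in> {a..b}" by simp
    then obtain c where c: "c \<in> T" "\<bar>c - s\<bar> < d c" using T(2) by (fastforce simp: dist_real_def)
    have n1: "\<not> (s < c \<and> c \<le> t)" and n2: "\<not> (s < c + d c \<and> c + d c \<le> t)"
      using no[of c] no[of "c + d c"] c(1) by auto
    show "norm (f s - f t) < e"
    proof (cases "t < c")
      case True then show ?thesis using c st by (intro d1[of c]) auto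
    next
      case False then show ?thesis using c st n1 n2 by (intro d2[of c]) auto
    qed
  qed (use T in auto)
qed

text \<open>\<open>Q\<close> is a primitive of the ordinary integrand. On each piece of a division
  the error is at most \<open>M\<close> times the oscillation of the path times the length. The
  oscillation is small unless the piece meets the finite set \<open>T\<close> of
  \<open>cadlag_oscillation\<close>, and pieces meeting \<open>T\<close> have small total
  length.\<close>

lemma has_rs_integral_by_parts:
  fixes f :: "real \<Rightarrow> real^'n^'n" and \<omega> :: "real \<Rightarrow> real^'n"
  assumes "a \<le> b" and \<omega>: "cadlag \<omega>"
    and f: "\<And>r. (f has_vector_derivative f' r) (at r)" and f': "continuous_on UNIV f'"
    and Q: "continuous_on UNIV Q" "\<And>r. has_rderiv Q (f' r *v \<omega> r) r"
  shows "has_rs_integral f \<omega> a b (f b *v \<omega> b - f a *v \<omega> a - (Q b - Q a))"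
  unfolding has_rs_integral_def
proof (intro allI impI)
  fix e0 :: real assume "e0 > 0"
  interpret mv: bounded_bilinear "(*v) :: real^'n^'n \<Rightarrow> real^'n \<Rightarrow> real^'n"
    by (rule bounded_bilinear_matrix_vector)
  obtain M where M: "M > 0" "\<And>r x. r \<in> {a..b} \<Longrightarrow> norm (f' r *v x) \<le> M * norm x"
  proof -
    obtain c where c: "c > 0" "\<And>A x. norm ((A :: real^'n^'n) *v x) \<le> norm A * norm x * c"
      using mv.pos_bounded by blast
    have "compact (f' ` {a..b})"
      by (intro compact_continuous_image continuous_on_subset[OF f']) auto
    then obtain m where m: "m > 0" "\<forall>y\<in>f' ` {a..b}. norm y \<le> m"
      using compact_imp_bounded bounded_pos by blast
    show thesis
    proof (rule that[of "m * c"])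
      fix r x assume "r \<in> {a..b}"
      have "norm (f' r *v x) \<le> norm (f' r) * norm x * c" by (rule c)
      also have "\<dots> \<le> m * norm x * c" using m c \<open>r \<in> {a..b}\<close> by (intro mult_right_mono) auto
      finally show "norm (f' r *v x) \<le> m * c * norm x" by (simp add: mult_ac)
    qed (use m c in simp)
  qed
  obtain B where B: "B > 0" "\<forall>t\<in>{a..b}. norm (\<omega> t) \<le> B" using cadlag_bounded[OF \<omega>] by blast
  \<comment> \<open>Pieces that avoid \<open>T\<close> may use up half of \<open>e0\<close>; the
    extra 1 in the denominator makes their share strictly less.\<close>
  define e where "e = e0 / (2 * M * (b - a + 1))"
  have "b - a + 1 > 0" using \<open>a \<le> b\<close> by simp
  then have "e > 0" using \<open>e0 > 0\<close> M(1) by (simp add: e_def)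
  moreover have "M * e * (b - a + 1) = e0 / 2"
  proof -
    have "M * (e0 / (2 * M * D)) * D = e0 / 2" if "D > 0" for D using that M(1) by simp
    then show ?thesis unfolding e_def using \<open>b - a + 1 > 0\<close> by blast
  qed
  moreover have "M * e > 0" using M(1) \<open>e > 0\<close> by simp
  ultimately have e: "e > 0" "M * e * (b - a) < e0 / 2"
    by (simp_all add: distrib_left)
  obtain T where T: "finite T"
    "\<And>s t. a \<le> s \<Longrightarrow> s \<le> t \<Longrightarrow> t \<le> b \<Longrightarrow> (\<And>c. c \<in> T \<Longrightarrow> \<not> (s < c \<and> c \<le> t)) \<Longrightarrow> norm (\<omega> s - \<omega> t) < e"
    using cadlag_oscillation[OF \<omega> e(1), of a b] by blast
  \<comment> \<open>Each point of \<open>T\<close> spoils pieces of total length at most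
    \<open>2 * d\<close>, where the oscillation is only known to be at most \<open>2 * B\<close>;
    the joint cost is then at most \<open>e0 / 2\<close>.\<close>
  define d where "d = e0 / (8 * M * B * (real (card T) + 1))"
  have d: "d > 0" "4 * M * B * real (card T) * d \<le> e0 / 2"
    using \<open>e0 > 0\<close> M(1) B(1) by (auto simp: d_def field_simps add_pos_nonneg)
  \<comment> \<open>total length of the pieces of a fine division that contain \<open>c\<close>, as the increment of a
    monotone function\<close>
  define g where "g c t = max (c - d) (min (c + d) t)" for c t
  define G where "G t = M * e * t + (\<Sum>c\<in>T. 2 * M * B * g c t)" for t
  show "\<exists>d>0. \<forall>p. p tagged_division_of {a..b} \<and> (\<forall>(s, k)\<in>p. diameter k < d) \<longrightarrow>
        norm ((\<Sum>(s, k)\<in>p. f s *v (\<omega> (Sup k) - \<omega> (Inf k))) - (f b *v \<omega> b - f a *v \<omega> a - (Q b - Q a)))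
          < e0"
  proof (intro exI[of _ d] conjI allI impI)
    fix p :: "(real \<times> real set) set" assume p: "p tagged_division_of {a..b} \<and> (\<forall>(s, k)\<in>p.
        diameter k < d)"
    \<comment> \<open>The claimed value is an increment of \<open>h\<close>, so it telescopes over
      the division and can be compared piece by piece.\<close>
    define h where "h t = f t *v \<omega> t - Q t" for t
    have hsum: "(\<Sum>(s, k)\<in>p. h (Sup k) - h (Inf k)) = h b - h a"
      and Gsum: "(\<Sum>(s, k)\<in>p. G (Sup k) - G (Inf k)) = G b - G a"
      using additive_tagged_division_1[OF \<open>a \<le> b\<close>] p by blast+
    have piece: "norm (f s *v (\<omega> (Sup k) - \<omega> (Inf k)) - (h (Sup k) - h (Inf k)))
        \<le> G (Sup k) - G (Inf k)"
      if sk: "(s, k) \<in> p" for s k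
    proof -
      obtain l u where k: "k = cbox l u" using p sk by (meson tagged_division_ofD(4))
      have "s \<in> k" "k \<subseteq> {a..b}" using p sk by (auto dest: tagged_division_ofD)
      then have lu: "l \<le> s" "s \<le> u" "a \<le> l" "u \<le> b" using k by auto
      have Sk: "Sup k = u" "Inf k = l" using k lu by auto
      have dk: "u - l < d" using p sk k lu by (force simp: diameter_closed_interval)
      have est: "norm (f x2 *v c - f x1 *v c - (Q x2 - Q x1)) \<le> M * D * (x2 - x1)"
        if x: "l \<le> x1" "x1 \<le> x2" "x2 \<le> u" and D: "\<And>r. x1 \<le> r \<Longrightarrow> r \<le> x2 \<Longrightarrow> norm (c - \<omega> r) \<le> D"
          for x1 x2 c D
      proof -
        have "norm ((f x2 *v c - Q x2) - (f x1 *v c - Q x1)) \<le> M * D * x2 - M * D * x1"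
        proof (rule right_mvt[where q' = "\<lambda>r. f' r *v c - f' r *v \<omega> r" and \<mu>' = "\<lambda>_. M * D"])
          show "continuous_on {x1..x2} (\<lambda>r. f r *v c - Q r)"
            by (intro continuous_intros mv.continuous_on continuous_on_subset[OF Q(1)]
                continuous_at_imp_continuous_on) (use has_vector_derivative_continuous[OF f] in
                  auto)
          show "has_rderiv (\<lambda>r. f r *v c - Q r) (f' t *v c - f' t *v \<omega> t) t" for t
            using has_vector_derivative_diff[OF mv.has_vector_derivative[OF
                has_vector_derivative_at_within[OF f[of t]] has_vector_derivative_const[of c]]
                  Q(2)[of t]] by simp
          fix t assume "x1 \<le> t" "t < x2"
          then have "norm (f' t *v (c - \<omega> t)) \<le> M * D"
            using x lu D[of t] M(1) by (intro order.trans[OF M(2)] mult_left_mono) auto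
          then show "norm (f' t *v c - f' t *v \<omega> t) \<le> M * D" by (simp add: mv.diff_right)
        qed (use x in \<open>auto intro!: derivative_eq_intros\<close>)
        then show ?thesis by (simp add: algebra_simps)
      qed
      \<comment> \<open>The piece is split at its tag: right of \<open>s\<close> the path is
        compared with the constant \<open>\<omega> u\<close>, left of \<open>s\<close> with
        \<open>\<omega> l\<close>.\<close>
      have id: "f s *v (\<omega> (Sup k) - \<omega> (Inf k)) - (h (Sup k) - h (Inf k)) =
        - (f u *v \<omega> u - f s *v \<omega> u - (Q u - Q s)) - (f s *v \<omega> l - f l *v \<omega> l - (Q s - Q l))"
        unfolding Sk h_def by (simp add: mv.diff_right)
      have bnd: "norm (f s *v (\<omega> (Sup k) - \<omega> (Inf k)) - (h (Sup k) - h (Inf k))) \<le> M * D * (u - l)"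
        if D: "\<And>r r'. l \<le> r \<Longrightarrow> r \<le> u \<Longrightarrow> l \<le> r' \<Longrightarrow> r' \<le> u \<Longrightarrow> norm (\<omega> r - \<omega> r') \<le> D" for D
      proof -
        have "norm (f u *v \<omega> u - f s *v \<omega> u - (Q u - Q s)) \<le> M * D * (u - s)"
          using lu by (intro est D) auto
        moreover have "norm (f s *v \<omega> l - f l *v \<omega> l - (Q s - Q l)) \<le> M * D * (s - l)"
          using lu by (intro est D) auto
        moreover have "M * D * (u - l) = M * D * (u - s) + M * D * (s - l)"
          by (simp add: algebra_simps)
        ultimately show ?thesis unfolding id
          by (intro order.trans[OF norm_triangle_ineq4]) (simp only: norm_minus_cancel)
      qed
      have gm: "g c u - g c l \<ge> 0" for c using lu by (auto simp: g_def)
      have GG: "G u - G l = M * e * (u - l) + (\<Sum>c\<in>T. 2 * M * B * (g c u - g c l))"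
        by (simp add: G_def algebra_simps sum_subtractf)
      have tnn: "2 * M * B * (g c u - g c l) \<ge> 0" for c using M(1) B(1) gm by simp
      show ?thesis
      proof (cases "\<exists>c\<in>T. l < c \<and> c \<le> u")
        case True
        then obtain c where c: "c \<in> T" "l < c" "c \<le> u" by blast
        have "norm (\<omega> r - \<omega> r') \<le> 2 * B" if "l \<le> r" "r \<le> u" "l \<le> r'" "r' \<le> u" for r r'
          using norm_triangle_ineq4[of "\<omega> r" "\<omega> r'"] B(2) lu that by (smt (verit) atLeastAtMost_iff)
        from bnd[OF this] have "norm (f s *v (\<omega> (Sup k) - \<omega> (Inf k)) - (h (Sup k) - h (Inf k)))
            \<le> M * (2 * B) * (u - l)" .
        \<comment> \<open>A piece containing \<open>c\<close> and shorter than \<open>d\<close>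
          stays within distance \<open>d\<close> of \<open>c\<close>, where \<open>g c\<close> is
          the identity.\<close>
        also have "\<dots> = 2 * M * B * (g c u - g c l)" using c dk by (simp add: g_def)
        also have "\<dots> \<le> (\<Sum>c\<in>T. 2 * M * B * (g c u - g c l))"
          using c T(1) tnn by (intro member_le_sum) auto
        also have "\<dots> \<le> G u - G l" unfolding GG using M(1) e(1) lu by simp
        finally show ?thesis unfolding Sk .
      next
        case False
        have "norm (\<omega> r - \<omega> r') \<le> e" if "l \<le> r" "r \<le> u" "l \<le> r'" "r' \<le> u" for r r'
        proof (cases "r \<le> r'")
          case True then show ?thesis using that lu False by (intro less_imp_le[OF T(2)]) force+
        next
          case 2: False
          then have "norm (\<omega> r' - \<omega> r) \<le> e" using that lu False
            by (intro less_imp_le[OF T(2)]) force+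
          then show ?thesis by (simp add: norm_minus_commute)
        qed
        from bnd[OF this] have "norm (f s *v (\<omega> (Sup k) - \<omega> (Inf k)) - (h (Sup k) - h (Inf k)))
            \<le> M * e * (u - l)" .
        also have "\<dots> \<le> G u - G l" unfolding GG using tnn by (simp add: sum_nonneg)
        finally show ?thesis unfolding Sk .
      qed
    qed
    have "(\<Sum>(s, k)\<in>p. f s *v (\<omega> (Sup k) - \<omega> (Inf k))) - (f b *v \<omega> b - f a *v \<omega> a - (Q b - Q a))
      = (\<Sum>(s, k)\<in>p. f s *v (\<omega> (Sup k) - \<omega> (Inf k))) - (\<Sum>(s, k)\<in>p. h (Sup k) - h (Inf k))"
      unfolding hsum by (simp add: h_def)
    also have "\<dots> = (\<Sum>(s, k)\<in>p. f s *v (\<omega> (Sup k) - \<omega> (Inf k)) - (h (Sup k) - h (Inf k)))"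
      by (simp add: sum_subtractf case_prod_beta)
    also have "norm \<dots> \<le> (\<Sum>(s, k)\<in>p. G (Sup k) - G (Inf k))"
      using piece by (intro sum_norm_le) auto
    also have "\<dots> = M * e * (b - a) + (\<Sum>c\<in>T. 2 * M * B * (g c b - g c a))"
      unfolding Gsum by (simp add: G_def algebra_simps sum_subtractf)
    also have "(\<Sum>c\<in>T. 2 * M * B * (g c b - g c a)) \<le> (\<Sum>c\<in>T. 2 * M * B * (2 * d))"
      using M(1) B(1) d(1) by (intro sum_mono mult_left_mono) (auto simp: g_def)
    also have "(\<Sum>c\<in>T. 2 * M * B * (2 * d)) = 4 * M * B * real (card T) * d" by simp
    finally show "norm ((\<Sum>(s, k)\<in>p. f s *v (\<omega> (Sup k) - \<omega> (Inf k))) -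
        (f b *v \<omega> b - f a *v \<omega> a - (Q b - Q a))) < e0" using e(2) d(2) by linarith
  qed (rule d)
qed

text \<open>Makes the description operator in \<open>rs_integral\<close> meaningful. Two limits can
  be compared because divisions of arbitrarily small mesh exist, as fine divisions for a constant
  gauge.\<close>

lemma has_rs_integral_unique:
  assumes "a \<le> b" "has_rs_integral f \<omega> a b I" "has_rs_integral f \<omega> a b I'"
  shows "I = I'"
proof (rule ccontr)
  assume "I \<noteq> I'"
  define e where "e = norm (I - I') / 2"
  have "e > 0" using \<open>I \<noteq> I'\<close> by (simp add: e_def)
  obtain d1 where d1: "d1 > 0" "\<And>p. p tagged_division_of {a..b} \<and> (\<forall>(s, k)\<in>p. diameter k < d1) \<Longrightarrow>
        norm ((\<Sum>(s, k)\<in>p. f s *v (\<omega> (Sup k) - \<omega> (Inf k))) - I) < e"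
    using assms(2) \<open>e > 0\<close> unfolding has_rs_integral_def by blast
  obtain d2 where d2: "d2 > 0" "\<And>p. p tagged_division_of {a..b} \<and> (\<forall>(s, k)\<in>p. diameter k < d2) \<Longrightarrow>
        norm ((\<Sum>(s, k)\<in>p. f s *v (\<omega> (Sup k) - \<omega> (Inf k))) - I') < e"
    using assms(3) \<open>e > 0\<close> unfolding has_rs_integral_def by blast
  define d where "d = min d1 d2"
  have "d > 0" using d1 d2 by (simp add: d_def)
  \<comment> \<open>Radius \<open>d / 3\<close> gives diameter at most \<open>2 * d / 3\<close>,
    strictly below the required mesh.\<close>
  have "gauge (\<lambda>x::real. ball x (d / 3))" using \<open>d > 0\<close> by (intro gaugeI) auto
  then obtain p where p: "p tagged_division_of {a..b}" "(\<lambda>x. ball x (d / 3)) fine p"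
    using fine_division_exists_real by blast
  have "diameter k < d" if "(s, k) \<in> p" for s k
  proof -
    have "k \<subseteq> ball s (d / 3)" using p(2) that by (auto simp: fine_def)
    then have "diameter k \<le> diameter (ball s (d / 3))" by (rule diameter_subset) simp
    also have "\<dots> \<le> 2 * (d / 3)" using \<open>d > 0\<close> by (simp add: diameter_ball)
    finally show ?thesis using \<open>d > 0\<close> by simp
  qed
  then have "norm ((\<Sum>(s, k)\<in>p. f s *v (\<omega> (Sup k) - \<omega> (Inf k))) - I) < e"
    "norm ((\<Sum>(s, k)\<in>p. f s *v (\<omega> (Sup k) - \<omega> (Inf k))) - I') < e"
    using d1(2)[of p] d2(2)[of p] p(1) by (fastforce simp: d_def)+
  then have "norm (I - I') < e + e"
    using norm_triangle_ineq4[of "(\<Sum>(s, k)\<in>p. f s *v (\<omega> (Sup k) - \<omega> (Inf k))) - I'"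
        "(\<Sum>(s, k)\<in>p. f s *v (\<omega> (Sup k) - \<omega> (Inf k))) - I"] by simp
  then show False by (simp add: e_def)
qed

lemma rs_integral_eqI:
  assumes "a \<le> b" "has_rs_integral f \<omega> a b I" shows "rs_integral f \<omega> a b = I"
  unfolding rs_integral_def using assms has_rs_integral_unique by blast

section \<open>Linear equations with exponentially bounded forcing\<close>

lemma divide_diff_swap: "(C :: real) / (b - a) = - (C / (a - b))"
  by (metis minus_diff_eq minus_divide_right)

text \<open>Variation of constants as an inequality. The semigroup bound is required only at the
  times \<open>c - r\<close> that occur, so \<open>c = t\<close> uses the forward bound of the fast
  part and \<open>c = s\<close> the backward bound of the slow part.\<close>

lemma mexp_forced_increment:
  fixes A :: "real^'n^'n"
  assumes "s \<le> t" and cont: "continuous_on {s..t} u"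
    and u: "\<And>r. s \<le> r \<Longrightarrow> r < t \<Longrightarrow> has_rderiv u (A *v u r + p r) r"
    and p: "\<And>r. s \<le> r \<Longrightarrow> r < t \<Longrightarrow> norm (p r) \<le> C * exp (b * r)"
    and A: "\<And>r x. s \<le> r \<Longrightarrow> r < t \<Longrightarrow> norm (mexp A (c - r) x) \<le> exp (a * (c - r)) * norm x"
    and "a \<noteq> b"
  shows "norm (mexp A (c - t) (u t) - mexp A (c - s) (u s))
    \<le> C / (b - a) * exp (a * (c - t) + b * t) - C / (b - a) * exp (a * (c - s) + b * s)"
proof (rule right_mvt[where q' = "\<lambda>r. mexp A (c - r) (p r)"
    and \<mu>' = "\<lambda>r. C * exp (a * (c - r) + b * r)"])
  show "continuous_on {s..t} (\<lambda>t. mexp A (c - t) (u t))" by (intro continuous_intros cont)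
  show "has_rderiv (\<lambda>t. mexp A (c - t) (u t)) (mexp A (c - r) (p r)) r" if "s \<le> r" "r < t" for r
  proof -
    have "has_rderiv (\<lambda>t. mexp A (c - t) (u t)) (mexp A (c - r) ((-1) *\<^sub>R (A *v u r) + (A *v u r
        + p r))) r"
      by (rule mexp_comp_deriv[OF _ u[OF that]]) (auto intro!: derivative_eq_intros)
    then show ?thesis by simp
  qed
  show "((\<lambda>t. C / (b - a) * exp (a * (c - t) + b * t)) has_real_derivative C * exp (a * (c - r)
      + b * r)) (at r)" for r
  proof -
    have "((\<lambda>t. k * exp (a * (c - t) + b * t)) has_real_derivative k * ((b - a) * exp (a * (c - r)
        + b * r))) (at r)" for k
      by (auto intro!: derivative_eq_intros)
    from this[of "C / (b - a)"] show ?thesis using \<open>a \<noteq> b\<close> by simp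
  qed
  show "norm (mexp A (c - r) (p r)) \<le> C * exp (a * (c - r) + b * r)" if "s \<le> r" "r < t" for r
  proof -
    have "norm (mexp A (c - r) (p r)) \<le> exp (a * (c - r)) * norm (p r)" by (rule A[OF that])
    also have "\<dots> \<le> exp (a * (c - r)) * (C * exp (b * r))" by (intro mult_left_mono p that) auto
    finally show ?thesis by (simp add: exp_add mult_ac)
  qed
qed (use assms in auto)

text \<open>Removes the homogeneous term by sending the starting time to
  \<open>-\<infinity>\<close>; with time reversed it also serves for end times tending to
  \<open>+\<infinity>\<close>.\<close>

lemma exp_at_bot_bound:
  assumes "d > (0::real)" "\<And>s. s \<le> T \<Longrightarrow> x \<le> y + C * exp (d * s)"
  shows "x \<le> y"
proof -
  have "((\<lambda>s. y + C * exp (d * s)) \<longlongrightarrow> y + C * 0) at_bot"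
    by (intro tendsto_intros filterlim_compose[OF exp_at_bot]
        filterlim_tendsto_pos_mult_at_bot[OF tendsto_const]) (use assms in \<open>auto simp:
          filterlim_ident\<close>)
  moreover have "eventually (\<lambda>s. x \<le> y + C * exp (d * s)) at_bot"
    using eventually_le_at_bot[of T] by (rule eventually_mono) (blast intro: assms(2))
  ultimately have "x \<le> y + C * 0"
    by (intro tendsto_lowerbound) auto
  then show ?thesis by simp
qed

lemma fast_forward_bound:
  fixes A :: "real^'n^'n"
  assumes A: "\<And>t x. t \<ge> 0 \<Longrightarrow> norm (mexp A t x) \<le> exp (a * t) * norm x"
    and "a < b" "s \<le> t" "C \<ge> 0" and cont: "continuous_on {s..t} u"
    and u: "\<And>r. s \<le> r \<Longrightarrow> r < t \<Longrightarrow> has_rderiv u (A *v u r + p r) r"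
    and p: "\<And>r. s \<le> r \<Longrightarrow> r < t \<Longrightarrow> norm (p r) \<le> C * exp (b * r)"
  shows "norm (u t) \<le> exp (a * (t - s)) * norm (u s) + C / (b - a) * exp (b * t)"
proof -
  have "norm (mexp A (t - t) (u t) - mexp A (t - s) (u s))
    \<le> C / (b - a) * exp (a * (t - t) + b * t) - C / (b - a) * exp (a * (t - s) + b * s)"
    by (rule mexp_forced_increment[OF \<open>s \<le> t\<close> cont u p A]) (use \<open>a < b\<close> in auto)
  also have "\<dots> \<le> C / (b - a) * exp (b * t)" using \<open>a < b\<close> \<open>C \<ge> 0\<close> by simp
  finally have "norm (u t - mexp A (t - s) (u s)) \<le> C / (b - a) * exp (b * t)" by simp
  moreover have "norm (mexp A (t - s) (u s)) \<le> exp (a * (t - s)) * norm (u s)" using A \<open>s \<le> t\<close>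
    by simp
  moreover have "norm (u t) \<le> norm (u t - mexp A (t - s) (u s)) + norm (mexp A (t - s) (u s))"
    by (metis diff_add_cancel norm_triangle_ineq)
  ultimately show ?thesis by linarith
qed

text \<open>The contribution of the value at \<open>s\<close> is of order
  \<open>exp ((b - a) * s)\<close> and dies as \<open>s\<close> tends to
  \<open>-\<infinity>\<close>. The a priori constant \<open>D\<close> thus leaves the conclusion,
  which is what turns a mere growth bound into a contraction estimate.\<close>

lemma fast_bound:
  fixes A :: "real^'n^'n"
  assumes A: "\<And>t x. t \<ge> 0 \<Longrightarrow> norm (mexp A t x) \<le> exp (a * t) * norm x"
    and "a < b" "t \<le> T" "C \<ge> 0" and cont: "continuous_on {..T} u"
    and u: "\<And>r. r < T \<Longrightarrow> has_rderiv u (A *v u r + p r) r"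
    and p: "\<And>r. r < T \<Longrightarrow> norm (p r) \<le> C * exp (b * r)"
    and bd: "\<And>r. r \<le> T \<Longrightarrow> norm (u r) \<le> D * exp (b * r)"
  shows "norm (u t) \<le> C / (b - a) * exp (b * t)"
proof (rule exp_at_bot_bound[where d = "b - a" and T = t and C = "exp (a * t) * D"])
  fix s assume "s \<le> t"
  have "norm (u t) \<le> exp (a * (t - s)) * norm (u s) + C / (b - a) * exp (b * t)"
    by (rule fast_forward_bound[OF A \<open>a < b\<close> \<open>s \<le> t\<close> \<open>C \<ge> 0\<close> continuous_on_subset[OF cont] u p])
      (use \<open>t \<le> T\<close> in auto)
  also have "exp (a * (t - s)) * norm (u s) \<le> exp (a * (t - s)) * (D * exp (b * s))"
    using \<open>s \<le> t\<close> \<open>t \<le> T\<close> by (intro mult_left_mono bd) auto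
  also have "\<dots> = exp (a * t) * D * exp ((b - a) * s)" by (simp add: exp_add exp_diff algebra_simps)
  finally show "norm (u t) \<le> C / (b - a) * exp (b * t) + exp (a * t) * D * exp ((b - a) * s)"
    by simp
qed (use \<open>a < b\<close> in simp)

lemma slow_finite_bound:
  fixes A :: "real^'n^'n"
  assumes A: "\<And>t x. t \<le> 0 \<Longrightarrow> norm (mexp A t x) \<le> exp (a * t) * norm x"
    and "b < a" "s \<le> t" "C \<ge> 0" and cont: "continuous_on {s..t} u"
    and u: "\<And>r. s \<le> r \<Longrightarrow> r < t \<Longrightarrow> has_rderiv u (A *v u r + p r) r"
    and p: "\<And>r. s \<le> r \<Longrightarrow> r < t \<Longrightarrow> norm (p r) \<le> C * exp (b * r)"
  shows "norm (u s) \<le> exp (a * (s - t)) * norm (u t) + C / (a - b) * exp (b * s)"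
proof -
  have "norm (mexp A (s - t) (u t) - mexp A (s - s) (u s))
    \<le> C / (b - a) * exp (a * (s - t) + b * t) - C / (b - a) * exp (a * (s - s) + b * s)"
    by (rule mexp_forced_increment[OF \<open>s \<le> t\<close> cont u p A]) (use \<open>b < a\<close> in auto)
  also have "\<dots> \<le> C / (a - b) * exp (b * s)" using \<open>b < a\<close> \<open>C \<ge> 0\<close>
    by (simp add: divide_diff_swap[of C b a])
  finally have "norm (mexp A (s - t) (u t) - u s) \<le> C / (a - b) * exp (b * s)" by simp
  moreover have "norm (u s) \<le> norm (mexp A (s - t) (u t) - u s) + norm (mexp A (s - t) (u t))"
    by (metis add.commute diff_add_cancel norm_minus_commute norm_triangle_ineq)
  moreover have "norm (mexp A (s - t) (u t)) \<le> exp (a * (s - t)) * norm (u t)" using A \<open>s \<le> t\<close>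
    by simp
  ultimately show ?thesis by linarith
qed

text \<open>Mirror image of \<open>fast_bound\<close>: the value at a late time \<open>t\<close>
  contributes order \<open>exp ((b - a) * t)\<close>, which vanishes at \<open>+\<infinity>\<close>
  because \<open>b < a\<close>.\<close>

lemma slow_bound:
  fixes A :: "real^'n^'n"
  assumes A: "\<And>t x. t \<le> 0 \<Longrightarrow> norm (mexp A t x) \<le> exp (a * t) * norm x"
    and "b < a" "T \<le> s" "C \<ge> 0" and cont: "continuous_on {T..} u"
    and u: "\<And>r. r \<ge> T \<Longrightarrow> has_rderiv u (A *v u r + p r) r"
    and p: "\<And>r. r \<ge> T \<Longrightarrow> norm (p r) \<le> C * exp (b * r)"
    and bd: "\<And>r. r \<ge> T \<Longrightarrow> norm (u r) \<le> D * exp (b * r)"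
  shows "norm (u s) \<le> C / (a - b) * exp (b * s)"
proof (rule exp_at_bot_bound[where d = "a - b" and T = "- s" and C = "exp (a * s) * D"])
  fix r assume "r \<le> - s"
  define t where "t = - r"
  have t: "s \<le> t" using \<open>r \<le> - s\<close> by (simp add: t_def)
  have "norm (u s) \<le> exp (a * (s - t)) * norm (u t) + C / (a - b) * exp (b * s)"
    by (rule slow_finite_bound[OF A \<open>b < a\<close> t \<open>C \<ge> 0\<close> continuous_on_subset[OF cont] u p]) (use \<open>T \<le>
      s\<close> in auto)
  moreover have "exp (a * (s - t)) * norm (u t) \<le> exp (a * (s - t)) * (D * exp (b * t))"
    using t \<open>T \<le> s\<close> by (intro mult_left_mono bd) auto
  moreover have "exp (a * (s - t)) * exp (b * t) = exp (a * s) * exp ((a - b) * r)"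
    unfolding mult_exp_exp by (simp add: t_def algebra_simps)
  then have "exp (a * (s - t)) * (D * exp (b * t)) = exp (a * s) * D * exp ((a - b) * r)"
    by (simp add: ac_simps)
  ultimately show "norm (u s) \<le> C / (a - b) * exp (b * s) + exp (a * s) * D * exp ((a - b) * r)"
    by linarith
qed (use \<open>b < a\<close> in simp)

lemma Cauchy_exp_increments:
  fixes X :: "nat \<Rightarrow> 'a::banach"
  assumes "d > 0" and X: "\<And>m n. m \<le> n \<Longrightarrow> norm (X m - X n) \<le> C * exp (- (d * real m))"
  obtains l where "X \<longlonglongrightarrow> l"
proof -
  have lim: "(\<lambda>m. C * exp (- (d * real m))) \<longlonglongrightarrow> C * 0"
    by (intro tendsto_intros filterlim_compose[OF exp_at_bot] filterlim_compose[OF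
      filterlim_uminus_at_bot_at_top]
        filterlim_tendsto_pos_mult_at_top[OF tendsto_const \<open>d > 0\<close> filterlim_real_sequentially])
  have "Cauchy X"
  proof (rule CauchyI')
    fix e :: real assume "e > 0"
    then have "eventually (\<lambda>m. C * exp (- (d * real m)) < e) sequentially"
      using order_tendstoD(2)[OF lim] by simp
    then obtain M where M: "\<And>m. m \<ge> M \<Longrightarrow> C * exp (- (d * real m)) < e"
      unfolding eventually_sequentially by blast
    show "\<exists>M. \<forall>m\<ge>M. \<forall>n>m. dist (X m) (X n) < e"
      unfolding dist_norm using M X by (meson le_less_trans less_imp_le)
  qed
  then show thesis using that by (metis Cauchy_convergent convergent_def)
qed

text \<open>Every choice of the constant \<open>l\<close> gives a solution of the forced linear
  equation; existence of a solution with prescribed growth is thereby reduced to picking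
  \<open>l\<close>.\<close>

lemma mexp_forced_primitive:
  fixes A :: "real^'n^'n"
  assumes p: "cadlag p"
  obtains P where "continuous_on UNIV P" "\<And>t. has_rderiv P (mexp A (- t) (p t)) t"
    "\<And>l t. has_rderiv (\<lambda>t. mexp A t (P t - l)) (A *v mexp A t (P t - l) + p t) t"
proof -
  have cad: "cadlag (\<lambda>t. mexp A (- t) (p t))"
    by (rule cadlag_compose2[of "\<lambda>t. t" p "\<lambda>t x. mexp A (- t) x"])
      (auto intro!: continuous_intros cadlag_continuous p simp: case_prod_beta)
  define P where "P t = (LBINT r=ereal 0..ereal t. mexp A (- r) (p r))" for t
  have c: "continuous_on UNIV P" unfolding P_def by (rule cadlag_integral_continuous[OF cad])
  have d: "has_rderiv P (mexp A (- t) (p t)) t" for t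
    unfolding P_def by (rule cadlag_integral_rderiv[OF cad])
  show thesis
  proof (rule that[of P])
    fix l t
    have "has_rderiv (\<lambda>t. mexp A t (P t - l)) (mexp A t (1 *\<^sub>R (A *v (P t - l)) + (mexp A (- t) (p
        t) - 0))) t"
      by (rule mexp_comp_deriv[OF _ has_vector_derivative_diff[OF d]]) (auto intro!:
        derivative_eq_intros)
    then show "has_rderiv (\<lambda>t. mexp A t (P t - l)) (A *v mexp A t (P t - l) + p t) t"
      by (simp add: mexp_add mexp_commute)
  qed (use c d in auto)
qed

text \<open>Here \<open>l\<close> is the limit of the primitive at \<open>-\<infinity>\<close>, so
  \<open>u\<close> is the convolution of the semigroup with the whole past of \<open>p\<close>. The
  bound is stated for every \<open>T\<close> and \<open>C\<close> because a noise path admits a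
  constant only up to each finite time.\<close>

lemma fast_solution_exists:
  fixes A :: "real^'n^'n"
  assumes A: "\<And>t x. t \<ge> 0 \<Longrightarrow> norm (mexp A t x) \<le> exp (a * t) * norm x"
    and "a < b" and cad: "cadlag p"
    and p: "\<And>r. r \<le> T0 \<Longrightarrow> norm (p r) \<le> C0 * exp (b * r)"
  obtains u where "continuous_on UNIV u" "\<And>t. has_rderiv u (A *v u t + p t) t"
    "\<And>T C t. (\<And>r. r \<le> T \<Longrightarrow> norm (p r) \<le> C * exp (b * r)) \<Longrightarrow> t \<le> T \<Longrightarrow> norm (u t) \<le> C / (b - a) * exp (b
        * t)"
proof -
  obtain P where P: "continuous_on UNIV P" "\<And>t. has_rderiv P (mexp A (- t) (p t)) t"
    "\<And>l t. has_rderiv (\<lambda>t. mexp A t (P t - l)) (A *v mexp A t (P t - l) + p t) t"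
    by (rule mexp_forced_primitive[OF cad, of A]) blast
  have inc: "norm (P t - P s) \<le> C / (b - a) * exp ((b - a) * t)"
    if p: "\<And>r. r \<le> T \<Longrightarrow> norm (p r) \<le> C * exp (b * r)" and st: "s \<le> t" "t \<le> min T 0" for s t T C
  proof -
    have "C * exp (b * T) \<ge> 0" using order.trans[OF norm_ge_zero p[of T]] by simp
    then have "C \<ge> 0" by (simp add: zero_le_mult_iff)
    have "norm (P t - P s) \<le> C / (b - a) * exp ((b - a) * t) - C / (b - a) * exp ((b - a) * s)"
    proof (rule right_mvt[OF \<open>s \<le> t\<close> continuous_on_subset[OF P(1)] P(2)])
      fix r assume r: "s \<le> r" "r < t"
      have "norm (mexp A (- r) (p r)) \<le> exp (a * (- r)) * norm (p r)" using r st by (intro A) auto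
      also have "\<dots> \<le> exp (a * (- r)) * (C * exp (b * r))" using r st
        by (intro mult_left_mono p) auto
      finally show "norm (mexp A (- r) (p r)) \<le> C * exp ((b - a) * r)"
        by (simp add: algebra_simps exp_diff exp_minus field_simps)
    qed (use \<open>a < b\<close> in \<open>auto intro!: derivative_eq_intros\<close>)
    also have "\<dots> \<le> C / (b - a) * exp ((b - a) * t)" using \<open>a < b\<close> \<open>C \<ge> 0\<close> by simp
    finally show ?thesis .
  qed
  define t0 where "t0 = min T0 0"
  have "norm (P (t0 - real m) - P (t0 - real n)) \<le> (C0 / (b - a) * exp ((b - a) * t0)) * exp (- ((b
      - a) * real m))"
    if "m \<le> n" for m n
  proof -
    have "norm (P (t0 - real m) - P (t0 - real n)) \<le> C0 / (b - a) * exp ((b - a) * (t0 - real m))"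
      by (rule inc[OF p]) (use that in \<open>auto simp: t0_def\<close>)
    also have "exp ((b - a) * (t0 - real m)) = exp ((b - a) * t0) * exp (- ((b - a) * real m))"
      by (simp add: exp_add[symmetric] algebra_simps)
    finally show ?thesis by (simp add: mult.assoc)
  qed
  then obtain l where l: "(\<lambda>n. P (t0 - real n)) \<longlonglongrightarrow> l"
    using Cauchy_exp_increments[of "b - a" "\<lambda>n. P (t0 - real n)"] \<open>a < b\<close>
      by (metis diff_gt_0_iff_gt)
  define u where "u t = mexp A t (P t - l)" for t
  have uc: "continuous_on UNIV u" unfolding u_def by (intro continuous_intros P)
  have ud: "has_rderiv u (A *v u t + p t) t" for t unfolding u_def by (rule P)
  have Pl: "norm (P t - l) \<le> C / (b - a) * exp ((b - a) * t)"
    if p: "\<And>r. r \<le> T \<Longrightarrow> norm (p r) \<le> C * exp (b * r)" and t: "t \<le> min T 0" for t T C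
  proof (rule tendsto_upperbound)
    show "(\<lambda>n. norm (P t - P (t0 - real n))) \<longlonglongrightarrow> norm (P t - l)" by (intro tendsto_intros l)
    obtain N :: nat where "t0 - t \<le> real N" using real_arch_simple by blast
    then show "eventually (\<lambda>n. norm (P t - P (t0 - real n)) \<le> C / (b - a) * exp ((b - a) * t))
        sequentially"
      unfolding eventually_sequentially by (intro exI[of _ N] allI impI inc[of T C] p t) (use
        of_nat_mono in force)+
  qed simp
  show thesis
  proof (rule that[OF uc ud])
    fix T C t assume p: "\<And>r. r \<le> T \<Longrightarrow> norm (p r) \<le> C * exp (b * r)" and t: "t \<le> T"
    have "C * exp (b * T) \<ge> 0" using order.trans[OF norm_ge_zero p[of T]] by simp
    then have "C \<ge> 0" by (simp add: zero_le_mult_iff)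
    show "norm (u t) \<le> C / (b - a) * exp (b * t)"
    proof -
      obtain B where B: "B > 0" "\<And>x. norm (mexp A t x) \<le> B * norm x"
        using linear_bounded_pos[OF linear_mexp] by blast
      show ?thesis
      \<comment> \<open>The estimate \<open>Pl\<close> reaches only up to \<open>min T 0\<close>. A
        later \<open>t\<close> is compared with a time \<open>s\<close> far in the past; the
        operator bound \<open>B\<close> of the fixed map \<open>mexp A t\<close> is harmless, as it
        multiplies a vanishing term.\<close>
      proof (rule exp_at_bot_bound[where d = "b - a" and T = "min t 0" and C = "B * (C / (b - a))"])
        fix s assume s: "s \<le> min t 0"
        have "norm (mexp A (t - t) (u t) - mexp A (t - s) (u s))
          \<le> C / (b - a) * exp (a * (t - t) + b * t) - C / (b - a) * exp (a * (t - s) + b * s)"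
          by (rule mexp_forced_increment[OF _ continuous_on_subset[OF uc] ud p A]) (use s t \<open>a < b\<close>
            in auto)
        also have "\<dots> \<le> C / (b - a) * exp (b * t)" using \<open>a < b\<close> \<open>C \<ge> 0\<close> by simp
        finally have 1: "norm (u t - mexp A t (P s - l)) \<le> C / (b - a) * exp (b * t)"
          by (simp add: u_def mexp_semigroup)
        have "norm (mexp A t (P s - l)) \<le> B * norm (P s - l)" by (rule B)
        also have "\<dots> \<le> B * (C / (b - a) * exp ((b - a) * s))"
          using s t B(1) by (intro mult_left_mono Pl[of T C] p) auto
        finally have 2: "norm (mexp A t (P s - l)) \<le> B * (C / (b - a)) * exp ((b - a) * s)"
          by (simp add: mult.assoc)
        have "norm (u t) \<le> norm (u t - mexp A t (P s - l)) + norm (mexp A t (P s - l))"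
          by (metis diff_add_cancel norm_triangle_ineq)
        then show "norm (u t) \<le> C / (b - a) * exp (b * t) + B * (C / (b - a)) * exp ((b - a) * s)"
          using 1 2 by linarith
      qed (use \<open>a < b\<close> in simp)
    qed
  qed
qed

text \<open>Now \<open>l\<close> is the limit of the primitive at \<open>+\<infinity>\<close>: the
  solution is minus the convolution with the whole future of \<open>p\<close>.\<close>

lemma slow_solution_exists:
  fixes A :: "real^'n^'n"
  assumes A: "\<And>t x. t \<le> 0 \<Longrightarrow> norm (mexp A t x) \<le> exp (a * t) * norm x"
    and "b < a" and cad: "cadlag p"
    and p: "\<And>r. norm (p r) \<le> C * exp (b * r)"
  obtains u where "continuous_on UNIV u" "\<And>t. has_rderiv u (A *v u t + p t) t"
    "\<And>t. norm (u t) \<le> C / (a - b) * exp (b * t)"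
proof -
  obtain P where P: "continuous_on UNIV P" "\<And>t. has_rderiv P (mexp A (- t) (p t)) t"
    "\<And>l t. has_rderiv (\<lambda>t. mexp A t (P t - l)) (A *v mexp A t (P t - l) + p t) t"
    by (rule mexp_forced_primitive[OF cad, of A]) blast
  have "C \<ge> 0" using order.trans[OF norm_ge_zero p[of 0]] by simp
  have inc: "norm (P t - P s) \<le> C / (a - b) * exp ((b - a) * s)" if st: "0 \<le> s" "s \<le> t" for s t
  proof -
    have "norm (P t - P s) \<le> C / (b - a) * exp ((b - a) * t) - C / (b - a) * exp ((b - a) * s)"
    proof (rule right_mvt[OF \<open>s \<le> t\<close> continuous_on_subset[OF P(1)] P(2)])
      fix r assume r: "s \<le> r" "r < t"
      have "norm (mexp A (- r) (p r)) \<le> exp (a * (- r)) * norm (p r)" using r st by (intro A) auto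
      also have "\<dots> \<le> exp (a * (- r)) * (C * exp (b * r))" using r st
        by (intro mult_left_mono p) auto
      finally show "norm (mexp A (- r) (p r)) \<le> C * exp ((b - a) * r)"
        by (simp add: algebra_simps exp_diff exp_minus field_simps)
    qed (use \<open>b < a\<close> in \<open>auto intro!: derivative_eq_intros\<close>)
    also have "\<dots> \<le> C / (a - b) * exp ((b - a) * s)" using \<open>b < a\<close> \<open>C \<ge> 0\<close>
      by (simp add: divide_diff_swap[of C b a])
    finally show ?thesis .
  qed
  have "norm (P (real m) - P (real n)) \<le> (C / (a - b)) * exp (- ((a - b) * real m))" if "m \<le> n"
    for m n
    using inc[of "real m" "real n"] that by (simp add: norm_minus_commute left_diff_distrib)
  then obtain l where l: "(\<lambda>n. P (real n)) \<longlonglongrightarrow> l"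
    using Cauchy_exp_increments[of "a - b" "\<lambda>n. P (real n)"] \<open>b < a\<close> by (metis diff_gt_0_iff_gt)
  define u where "u t = mexp A t (P t - l)" for t
  have uc: "continuous_on UNIV u" unfolding u_def by (intro continuous_intros P)
  have ud: "has_rderiv u (A *v u t + p t) t" for t unfolding u_def by (rule P)
  have Pl: "norm (P s - l) \<le> C / (a - b) * exp ((b - a) * s)" if s: "s \<ge> 0" for s
  proof (rule tendsto_upperbound)
    show "(\<lambda>n. norm (P s - P (real n))) \<longlonglongrightarrow> norm (P s - l)" by (intro tendsto_intros l)
    have "eventually (\<lambda>n. s \<le> real n) sequentially"
      using filterlim_real_sequentially by (simp add: filterlim_at_top)
    then show "eventually (\<lambda>n. norm (P s - P (real n)) \<le> C / (a - b) * exp ((b - a) * s))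
        sequentially"
      
    proof eventually_elim
      case (elim n)
      then show ?case using inc[OF s, of "real n"] by (simp add: norm_minus_commute)
    qed
  qed simp
  have "norm (u s) \<le> C / (a - b) * exp (b * s)" for s
  proof -
    obtain B where B: "B > 0" "\<And>x. norm (mexp A s x) \<le> B * norm x"
      using linear_bounded_pos[OF linear_mexp] by blast
    show ?thesis
    proof (rule exp_at_bot_bound[where d = "a - b" and T = "- max s 0" and C = "B * (C / (a - b))"])
      fix r assume "r \<le> - max s 0"
      define t where "t = - r"
      have t: "s \<le> t" "0 \<le> t" using \<open>r \<le> - max s 0\<close> by (auto simp: t_def)
      have "norm (mexp A (s - t) (u t) - mexp A (s - s) (u s))
          \<le> C / (b - a) * exp (a * (s - t) + b * t) - C / (b - a) * exp (a * (s - s) + b * s)"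
        by (rule mexp_forced_increment[OF _ continuous_on_subset[OF uc] ud p A]) (use t \<open>b < a\<close> in
          auto)
      also have "\<dots> \<le> C / (a - b) * exp (b * s)" using \<open>b < a\<close> \<open>C \<ge> 0\<close>
        by (simp add: divide_diff_swap[of C b a])
      finally have 1: "norm (mexp A s (P t - l) - u s) \<le> C / (a - b) * exp (b * s)"
        by (simp add: u_def mexp_semigroup)
      have "norm (mexp A s (P t - l)) \<le> B * norm (P t - l)" by (rule B)
      also have "\<dots> \<le> B * (C / (a - b) * exp ((b - a) * t))"
        using t B(1) by (intro mult_left_mono Pl) auto
      finally have 2: "norm (mexp A s (P t - l)) \<le> B * (C / (a - b)) * exp ((a - b) * r)"
        by (simp add: mult.assoc t_def left_diff_distrib)
      have "norm (u s) \<le> norm (mexp A s (P t - l) - u s) + norm (mexp A s (P t - l))"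
        by (metis add.commute diff_add_cancel norm_minus_commute norm_triangle_ineq)
      then show "norm (u s) \<le> C / (a - b) * exp (b * s) + B * (C / (a - b)) * exp ((a - b) * r)"
        using 1 2 by linarith
    qed (use \<open>b < a\<close> in simp)
  qed
  then show thesis using that uc ud by blast
qed

section \<open>Fixed points in weighted spaces\<close>

text \<open>Replaces the computation of a weighted supremum norm. If every admissible constant
  \<open>D\<close> may be improved to \<open>M + k * D\<close>, the improved constants converge to
  the fixed point \<open>M / (1 - k)\<close>. With \<open>M = 0\<close> this proves
  uniqueness.\<close>

lemma affine_iterate:
  fixes k M :: real
  assumes "0 \<le> k" "k < 1" and P0: "P E0" and step: "\<And>D. P D \<Longrightarrow> P (M + k * D)"
    and bd: "\<And>D. P D \<Longrightarrow> x \<le> D * e"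
  shows "x \<le> M / (1 - k) * e"
proof -
  define m where "m = M / (1 - k)"
  have "(1 - k) * m = M" using \<open>k < 1\<close> by (simp add: m_def)
  then have m: "M = m - k * m" by (simp add: left_diff_distrib)
  have P: "P (m + k ^ n * (E0 - m))" for n
  proof (induction n)
    case (Suc n)
    have "M + k * (m + k ^ n * (E0 - m)) = m + k ^ Suc n * (E0 - m)"
      by (subst m) (simp add: algebra_simps)
    then show ?case using step[OF Suc] by simp
  qed (use P0 in simp)
  have "(\<lambda>n. (m + k ^ n * (E0 - m)) * e) \<longlonglongrightarrow> (m + 0 * (E0 - m)) * e"
    using assms by (intro tendsto_intros) auto
  then have "x \<le> (m + 0 * (E0 - m)) * e"
    by (rule tendsto_lowerbound) (use bd[OF P] in auto)
  then show ?thesis by (simp add: m_def)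
qed

text \<open>Banach's theorem without constructing the weighted space. \<open>N\<close> is only
  equivalent to the norm, so that contraction may be measured in a sum of component norms.
  \<open>T_contr\<close> carries growth bounds for both arguments, since \<open>T\<close> need only
  be meaningful on paths of finite weighted norm.\<close>

lemma weighted_fixpoint:
  fixes T :: "(real \<Rightarrow> 'a::banach) \<Rightarrow> (real \<Rightarrow> 'a)" and N :: "'a \<Rightarrow> real"
  assumes N: "\<And>x y. N (x + y) \<le> N x + N y" "\<And>x. N (- x) = N x" "\<And>x. norm x \<le> N x" "\<And>x.
      N x \<le> c * norm x"
    and w: "continuous_on UNIV w" "\<And>t. w t > 0" and k: "0 \<le> k" "k < 1"
    and T_cont: "\<And>v D. continuous_on UNIV v \<Longrightarrow> (\<And>t. N (v t) \<le> D * w t) \<Longrightarrow> continuous_on UNIV (T v)"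
    and T_zero: "\<And>t. N (T (\<lambda>_. 0) t) \<le> E0 * w t"
    and T_contr: "\<And>u v Du Dv D t. continuous_on UNIV u \<Longrightarrow> (\<And>t. N (u t) \<le> Du * w t) \<Longrightarrow>
       continuous_on UNIV v \<Longrightarrow> (\<And>t. N (v t) \<le> Dv * w t) \<Longrightarrow>
       (\<And>t. N (u t - v t) \<le> D * w t) \<Longrightarrow> N (T u t - T v t) \<le> k * D * w t"
  obtains v D where "continuous_on UNIV v" "\<And>t. N (v t) \<le> D * w t" "T v = v"
proof -
  have N0 [simp]: "N 0 = 0" using N(3)[of 0] N(4)[of 0] by simp
  have Nsub: "N (x - y) \<le> N x + N y" for x y using N(1)[of x "- y"] N(2) by simp
  define X where "X n = (T ^^ n) (\<lambda>_. 0)" for n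
  have X0: "X 0 = (\<lambda>_. 0)" and XS: "X (Suc n) = T (X n)" for n by (simp_all add: X_def)
  have E0: "E0 \<ge> 0" using T_zero[of 0] N(3) w(2)[of 0]
    by (smt (verit) norm_ge_zero zero_le_mult_iff)
  have Xn: "continuous_on UNIV (X n) \<and> (\<exists>D. \<forall>t. N (X n t) \<le> D * w t)" for n
  proof (induction n)
    case 0 then show ?case by (auto simp: X0 intro!: exI[of _ 0])
  next
    case (Suc n)
    then obtain D where c: "continuous_on UNIV (X n)" and D: "\<And>t. N (X n t) \<le> D * w t" by blast
    have "N (X (Suc n) t) \<le> (k * D + E0) * w t" for t
    proof -
      have "N (T (X n) t - T (\<lambda>_. 0) t) \<le> k * D * w t"
        by (rule T_contr[OF c D, where Dv = 0]) (use D in auto)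
      then show ?thesis using N(1)[of "T (X n) t - T (\<lambda>_. 0) t" "T (\<lambda>_. 0) t"] T_zero[of t]
        by (simp add: XS algebra_simps)
    qed
    moreover have "continuous_on UNIV (X (Suc n))" unfolding XS using T_cont c D by blast
    ultimately show ?case by blast
  qed
  have Xc: "continuous_on UNIV (X n)" for n using Xn by blast
  have Xinc: "N (X (Suc n) t - X n t) \<le> k ^ n * E0 * w t" for n t
  proof (induction n arbitrary: t)
    case 0 then show ?case using T_zero by (simp add: X0 XS)
  next
    case (Suc n)
    obtain Da Db where "\<And>t. N (X (Suc n) t) \<le> Da * w t" "\<And>t. N (X n t) \<le> Db * w t" using Xn by blast
    from T_contr[OF Xc this(1) Xc this(2) Suc.IH] show ?case by (simp add: XS mult_ac)
  qed
  have Xdiff: "N (X m t - X n t) \<le> k ^ n * (E0 / (1 - k)) * w t" if "n \<le> m" for m n t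
  proof -
    have "N (X (n + j) t - X n t) \<le> k ^ n * (E0 * (\<Sum>i<j. k ^ i)) * w t" for j
    proof (induction j)
      case (Suc j)
      have "N (X (n + Suc j) t - X n t) \<le> N (X (Suc (n + j)) t - X (n + j) t) + N (X (n + j) t
          - X n t)"
        using N(1)[of "X (Suc (n + j)) t - X (n + j) t" "X (n + j) t - X n t"] by simp
      also have "\<dots> \<le> k ^ (n + j) * E0 * w t + k ^ n * (E0 * (\<Sum>i<j. k ^ i)) * w t"
        by (intro add_mono Xinc Suc.IH)
      also have "\<dots> = k ^ n * (E0 * (\<Sum>i<Suc j. k ^ i)) * w t" by (simp add: power_add algebra_simps)
      finally show ?case .
    qed simp
    moreover have "(\<Sum>i<j. k ^ i) \<le> 1 / (1 - k)" for j
      using k by (simp add: sum_gp_strict divide_right_mono)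
    then have "k ^ n * (E0 * (\<Sum>i<j. k ^ i)) * w t \<le> k ^ n * (E0 * (1 / (1 - k))) * w t" for j
      using k E0 w(2)[of t] by (intro mult_right_mono mult_left_mono) auto
    ultimately have "N (X (n + j) t - X n t) \<le> k ^ n * (E0 * (1 / (1 - k))) * w t" for j
      by (rule order.trans)
    from this[of "m - n"] show ?thesis using that by simp
  qed
  \<comment> \<open>After division by the weight, convergence is uniform, so the limit inherits
    continuity.\<close>
  define Y where "Y n t = (1 / w t) *\<^sub>R X n t" for n t
  have "uniformly_convergent_on UNIV Y"
  proof (rule Cauchy_uniformly_convergent, rule uniformly_Cauchy_onI')
    fix e :: real assume "e > 0"
    have "(\<lambda>n. k ^ n * (E0 / (1 - k))) \<longlonglongrightarrow> 0 * (E0 / (1 - k))"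
      using k by (intro tendsto_intros) auto
    then have "eventually (\<lambda>n. k ^ n * (E0 / (1 - k)) < e) sequentially"
      using \<open>e > 0\<close> by (intro order_tendstoD(2)) auto
    then obtain M where M: "\<And>n. n \<ge> M \<Longrightarrow> k ^ n * (E0 / (1 - k)) < e"
      unfolding eventually_sequentially by blast
    have "dist (Y m t) (Y n t) < e" if "m \<ge> M" "n > m" for m n t
    proof -
      have "norm (Y n t - Y m t) = norm (X n t - X m t) / w t"
        using w(2)[of t] by (simp add: Y_def scaleR_right_diff_distrib[symmetric])
      also have "\<dots> \<le> (k ^ m * (E0 / (1 - k)) * w t) / w t"
        using w(2)[of t] that by (intro divide_right_mono order.trans[OF N(3) Xdiff]) auto
      also have "\<dots> < e" using w(2)[of t] M[OF that(1)] by simp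
      finally show ?thesis by (simp add: dist_norm norm_minus_commute)
    qed
    then show "\<exists>M. \<forall>x\<in>UNIV. \<forall>m\<ge>M. \<forall>n>m. dist (Y m x) (Y n x) < e" by blast
  qed
  then obtain y where y: "uniform_limit UNIV Y y sequentially" unfolding uniformly_convergent_on_def
    by blast
  have yc: "continuous_on UNIV y"
    by (rule uniform_limit_theorem[OF always_eventually y])
      (use Xc w in \<open>auto simp: Y_def intro!: continuous_intros simp: less_imp_neq[symmetric]\<close>)
  define v where "v t = w t *\<^sub>R y t" for t
  have vc: "continuous_on UNIV v" unfolding v_def by (intro continuous_intros yc w)
  have Xv: "(\<lambda>n. X n t) \<longlonglongrightarrow> v t" for t
  proof -
    have "(\<lambda>n. w t *\<^sub>R Y n t) \<longlonglongrightarrow> v t"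
      unfolding v_def by (intro tendsto_intros tendsto_uniform_limitI[OF y]) auto
    then show ?thesis using w(2)[of t] by (simp add: Y_def)
  qed
  \<comment> \<open>The limit in \<open>m\<close> is taken through \<open>c * norm\<close>, which
    dominates \<open>N\<close> and is known to be continuous.\<close>
  have vX: "N (v t - X n t) \<le> k ^ n * (E0 / (1 - k)) * w t" for n t
  proof -
    have "(\<lambda>m. c * norm (v t - X m t) + k ^ n * (E0 / (1 - k)) * w t) \<longlonglongrightarrow> c * norm (v t - v t)
        + k ^ n * (E0 / (1 - k)) * w t"
      by (intro tendsto_intros Xv)
    moreover have "N (v t - X n t) \<le> c * norm (v t - X m t) + k ^ n * (E0 / (1 - k)) * w t"
      if "n \<le> m" for m
      using N(1)[of "v t - X m t" "X m t - X n t"] N(4)[of "v t - X m t"] Xdiff[OF that, of t]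
        by simp
    then have "eventually (\<lambda>m. N (v t - X n t) \<le> c * norm (v t - X m t) + k ^ n * (E0 / (1 - k)) * w
        t) sequentially"
      unfolding eventually_sequentially by blast
    ultimately have "N (v t - X n t) \<le> c * norm (v t - v t) + k ^ n * (E0 / (1 - k)) * w t"
      by (rule tendsto_lowerbound) simp
    then show ?thesis by simp
  qed
  have vb: "N (v t) \<le> (E0 / (1 - k)) * w t" for t using vX[of t 0] by (simp add: X0)
  have "T v t = v t" for t
  proof -
    have "norm (T v t - v t) \<le> 2 * (E0 / (1 - k)) * k ^ n * w t" for n
    proof -
      obtain D where D: "\<And>t. N (X n t) \<le> D * w t" using Xn by blast
      have "N (T v t - X (Suc n) t) \<le> k * (k ^ n * (E0 / (1 - k))) * w t"
        unfolding XS by (rule T_contr[OF vc vb Xc D vX])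
      also have "\<dots> \<le> k ^ n * (E0 / (1 - k)) * w t"
        using k E0 w(2)[of t] by (intro mult_right_mono mult_left_le_one_le) auto
      finally have 1: "N (T v t - X (Suc n) t) \<le> k ^ n * (E0 / (1 - k)) * w t" .
      have "N (v t - X (Suc n) t) \<le> k * (k ^ n * (E0 / (1 - k))) * w t" using vX[of t "Suc n"]
        by simp
      also have "\<dots> \<le> k ^ n * (E0 / (1 - k)) * w t"
        using k E0 w(2)[of t] by (intro mult_right_mono mult_left_le_one_le) auto
      finally have 2: "N (v t - X (Suc n) t) \<le> k ^ n * (E0 / (1 - k)) * w t" .
      have "norm (T v t - v t) \<le> N (T v t - X (Suc n) t) + N (v t - X (Suc n) t)"
        using N(3)[of "T v t - v t"] Nsub[of "T v t - X (Suc n) t" "v t - X (Suc n) t"] by simp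
      also have "\<dots> \<le> k ^ n * (E0 / (1 - k)) * w t + k ^ n * (E0 / (1 - k)) * w t"
        by (rule add_mono[OF 1 2])
      also have "\<dots> = 2 * (E0 / (1 - k)) * k ^ n * w t"
        by (simp only: mult_2[symmetric]) (simp add: mult_ac)
      finally show ?thesis .
    qed
    moreover have "(\<lambda>n. 2 * (E0 / (1 - k)) * k ^ n * w t) \<longlonglongrightarrow> 2 * (E0 / (1 - k)) * 0 * w t"
      using k by (intro tendsto_intros) auto
    ultimately have "norm (T v t - v t) \<le> 2 * (E0 / (1 - k)) * 0 * w t"
      by (intro tendsto_lowerbound[of _ _ sequentially]) auto
    then show ?thesis by simp
  qed
  then show thesis using that[OF vc vb] by blast
qed

section \<open>The Lyapunov--Perron equation\<close>

text \<open>The sum norm, not the Euclidean product norm: the Lipschitz hypotheses are stated in it,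
  and with it the slow and fast contributions to the contraction constant simply add.\<close>

definition pair_norm :: "'a::real_normed_vector \<times> 'b::real_normed_vector \<Rightarrow> real" where
  "pair_norm v = norm (fst v) + norm (snd v)"

lemma pair_norm_props:
  "pair_norm (x + y) \<le> pair_norm x + pair_norm y" "pair_norm (- x) = pair_norm x"
  "norm x \<le> pair_norm x" "pair_norm x \<le> 2 * norm x" "pair_norm x \<ge> 0"
  "pair_norm (x - y) = pair_norm (y - x)"
proof -
  show "pair_norm (x + y) \<le> pair_norm x + pair_norm y"
    unfolding pair_norm_def using norm_triangle_ineq[of "fst x" "fst y"] norm_triangle_ineq[of
      "snd x" "snd y"] by simp
  show "norm x \<le> pair_norm x" unfolding pair_norm_def by (metis norm_Pair_le prod.collapse)
  show "pair_norm x \<le> 2 * norm x" unfolding pair_norm_def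
    using norm_fst_le[of "fst x" "snd x"] norm_snd_le[of "snd x" "fst x"] by simp
qed (simp_all add: pair_norm_def norm_minus_commute)

text \<open>Freezing \<open>v\<close> in the nonlinearity decouples the two equations into linear
  ones, each with a solution within the weight. For two frozen inputs the difference of solutions is
  forced by the Lipschitz difference, and \<open>slow_bound\<close> and \<open>fast_bound\<close>
  give the two quotients of the contraction constant.\<close>

lemma lyapunov_perron:
  fixes A1 :: "real^'n1^'n1" and A2 :: "real^'n2^'n2"
    and G1 :: "real \<Rightarrow> (real^'n1) \<times> (real^'n2) \<Rightarrow> real^'n1"
      and G2 :: "real \<Rightarrow> (real^'n1) \<times> (real^'n2) \<Rightarrow> real^'n2"
  assumes A1: "\<And>t x. t \<le> 0 \<Longrightarrow> norm (mexp A1 t x) \<le> exp (a1 * t) * norm x"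
    and A2: "\<And>t x. t \<ge> 0 \<Longrightarrow> norm (mexp A2 t x) \<le> exp (a2 * t) * norm x"
    and gap: "a2 < b" "b < a1" and K: "0 \<le> K1" "0 \<le> K2" "K1 / (a1 - b) + K2 / (b - a2) < 1"
    and L1: "\<And>r v w. norm (G1 r v - G1 r w) \<le> K1 * pair_norm (v - w)"
    and L2: "\<And>r v w. norm (G2 r v - G2 r w) \<le> K2 * pair_norm (v - w)"
    and cad: "\<And>v. continuous_on UNIV v \<Longrightarrow> cadlag (\<lambda>r. G1 r (v r))" "\<And>v. continuous_on UNIV v \<Longrightarrow>
        cadlag (\<lambda>r. G2 r (v r))"
    and zero: "\<And>r. norm (G1 r 0) \<le> C1 * exp (b * r)" "\<And>r. norm (G2 r 0) \<le> C2 * exp (b * r)"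
  obtains v D where "continuous_on UNIV v" "\<And>t. pair_norm (v t) \<le> D * exp (b * t)"
    "\<And>t. has_rderiv (\<lambda>t. fst (v t)) (A1 *v fst (v t) + G1 t (v t)) t"
    "\<And>t. has_rderiv (\<lambda>t. snd (v t)) (A2 *v snd (v t) + G2 t (v t)) t"
proof -
  define sol where "sol v u \<longleftrightarrow> continuous_on UNIV u \<and> (\<exists>D. \<forall>t. pair_norm (u t) \<le> D * exp (b * t)) \<and>
    (\<forall>t. has_rderiv (\<lambda>t. fst (u t)) (A1 *v fst (u t) + G1 t (v t)) t) \<and>
    (\<forall>t. has_rderiv (\<lambda>t. snd (u t)) (A2 *v snd (u t) + G2 t (v t)) t)" for v u
  \<comment> \<open>An arbitrary choice is harmless, since the estimates below apply to any solution
    within the weight.\<close>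
  define T where "T v = (SOME u. sol v u)" for v
  define \<kappa> where "\<kappa> = K1 / (a1 - b) + K2 / (b - a2)"
  have Gb: "norm (G1 r x) \<le> (K1 * D + C1) * exp (b * r)" "norm (G2 r x) \<le> (K2 * D + C2) * exp (b *
      r)"
    if "pair_norm x \<le> D * exp (b * r)" for x D r
  proof -
    have "norm (G1 r x) \<le> norm (G1 r x - G1 r 0) + norm (G1 r 0)"
      by (metis diff_add_cancel norm_triangle_ineq)
    also have "\<dots> \<le> K1 * (D * exp (b * r)) + C1 * exp (b * r)"
      using L1[of r x 0] that K(1) zero(1)[of r] by (intro add_mono) (auto intro: order.trans[OF _
        mult_left_mono])
    finally show "norm (G1 r x) \<le> (K1 * D + C1) * exp (b * r)" by (simp add: algebra_simps)
    have "norm (G2 r x) \<le> norm (G2 r x - G2 r 0) + norm (G2 r 0)"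
      by (metis diff_add_cancel norm_triangle_ineq)
    also have "\<dots> \<le> K2 * (D * exp (b * r)) + C2 * exp (b * r)"
      using L2[of r x 0] that K(2) zero(2)[of r] by (intro add_mono) (auto intro: order.trans[OF _
        mult_left_mono])
    finally show "norm (G2 r x) \<le> (K2 * D + C2) * exp (b * r)" by (simp add: algebra_simps)
  qed
  have solT: "sol v (T v)" if v: "continuous_on UNIV v" "\<And>t. pair_norm (v t) \<le> D * exp (b * t)"
    for v D
    unfolding T_def
  proof (rule someI_ex[of "sol v"])
    obtain u1 where u1: "continuous_on UNIV u1" "\<And>t. has_rderiv u1 (A1 *v u1 t + G1 t (v t)) t"
      "\<And>t. norm (u1 t) \<le> (K1 * D + C1) / (a1 - b) * exp (b * t)"
      by (rule slow_solution_exists[of A1 a1 b "\<lambda>r. G1 r (v r)" "K1 * D + C1", OF A1 gap(2)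
        cad(1)[OF v(1)] Gb(1)[OF v(2)]]) blast+
    obtain u2 where u2: "continuous_on UNIV u2" "\<And>t. has_rderiv u2 (A2 *v u2 t + G2 t (v t)) t"
      "\<And>T C t. (\<And>r. r \<le> T \<Longrightarrow> norm (G2 r (v r)) \<le> C * exp (b * r)) \<Longrightarrow> t \<le> T \<Longrightarrow> norm (u2 t)
          \<le> C / (b - a2) * exp (b * t)"
      by (rule fast_solution_exists[of A2 a2 b "\<lambda>r. G2 r (v r)" 0 "K2 * D + C2", OF A2 gap(1)
        cad(2)[OF v(1)] Gb(2)[OF v(2)]]) blast+
    have "norm (u2 t) \<le> (K2 * D + C2) / (b - a2) * exp (b * t)" for t
      by (rule u2(3)[OF Gb(2)[OF v(2)] order.refl])
    then have "pair_norm (u1 t, u2 t) \<le> ((K1 * D + C1) / (a1 - b) + (K2 * D + C2) / (b - a2)) * exp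
        (b * t)" for t
      using u1(3)[of t] by (simp add: pair_norm_def distrib_right add_mono)
    then show "\<exists>u. sol v u"
      unfolding sol_def using u1(1,2) u2(1,2)
      by (intro exI[of _ "\<lambda>t. (u1 t, u2 t)"]) (auto intro!: continuous_on_Pair)
  qed
  have contr: "pair_norm (T u t - T v t) \<le> \<kappa> * D * exp (b * t)"
    if u: "continuous_on UNIV u" "\<And>t. pair_norm (u t) \<le> Du * exp (b * t)"
      and v: "continuous_on UNIV v" "\<And>t. pair_norm (v t) \<le> Dv * exp (b * t)"
      and D: "\<And>t. pair_norm (u t - v t) \<le> D * exp (b * t)" for u v Du Dv D t
  proof -
    have "D \<ge> 0" using D[of 0] pair_norm_props(5)[of "u 0 - v 0"] by simp
    obtain Du' Dv' where D': "\<And>t. pair_norm (T u t) \<le> Du' * exp (b * t)" "\<And>t. pair_norm (T v t)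
        \<le> Dv' * exp (b * t)"
      using solT[OF u] solT[OF v] unfolding sol_def by blast
    have su: "continuous_on UNIV (T u)" "\<And>t. has_rderiv (\<lambda>t. fst (T u t)) (A1 *v fst (T u t)
        + G1 t (u t)) t"
      "\<And>t. has_rderiv (\<lambda>t. snd (T u t)) (A2 *v snd (T u t) + G2 t (u t)) t" using solT[OF u]
        unfolding sol_def by blast+
    have sv: "continuous_on UNIV (T v)" "\<And>t. has_rderiv (\<lambda>t. fst (T v t)) (A1 *v fst (T v t)
        + G1 t (v t)) t"
      "\<And>t. has_rderiv (\<lambda>t. snd (T v t)) (A2 *v snd (T v t) + G2 t (v t)) t" using solT[OF v]
        unfolding sol_def by blast+
    have bd: "pair_norm (T u t - T v t) \<le> (Du' + Dv') * exp (b * t)" for t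
      using pair_norm_props(1)[of "T u t" "- T v t"] pair_norm_props(2)[of "T v t"] D'(1)[of t]
        D'(2)[of t]
      by (simp add: distrib_right)
    have "norm (fst (T u t) - fst (T v t)) \<le> (K1 * D) / (a1 - b) * exp (b * t)"
    proof (rule slow_bound[OF A1 gap(2), where T = t])
      show "continuous_on {t..} (\<lambda>t. fst (T u t) - fst (T v t))"
        by (intro continuous_intros continuous_on_subset[OF su(1)] continuous_on_subset[OF sv(1)])
          auto
      show "has_rderiv (\<lambda>t. fst (T u t) - fst (T v t)) (A1 *v (fst (T u r) - fst (T v r)) + (G1 r (u
          r) - G1 r (v r))) r" for r
        using has_vector_derivative_diff[OF su(2)[of r] sv(2)[of r]]
          by (simp add: matrix_vector_mult_diff_distrib algebra_simps)
      show "norm (G1 r (u r) - G1 r (v r)) \<le> K1 * D * exp (b * r)" for r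
        using L1[of r "u r" "v r"] mult_left_mono[OF D[of r] K(1)] by (simp add: mult.assoc)
      show "norm (fst (T u r) - fst (T v r)) \<le> (Du' + Dv') * exp (b * r)" for r
        using bd[of r] norm_ge_zero[of "snd (T u r - T v r)"]
          unfolding pair_norm_def fst_diff[symmetric] by linarith
    qed (use K \<open>D \<ge> 0\<close> in auto)
    moreover have "norm (snd (T u t) - snd (T v t)) \<le> (K2 * D) / (b - a2) * exp (b * t)"
    proof (rule fast_bound[OF A2 gap(1), where T = t])
      show "continuous_on {..t} (\<lambda>t. snd (T u t) - snd (T v t))"
        by (intro continuous_intros continuous_on_subset[OF su(1)] continuous_on_subset[OF sv(1)])
          auto
      show "has_rderiv (\<lambda>t. snd (T u t) - snd (T v t)) (A2 *v (snd (T u r) - snd (T v r)) + (G2 r (u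
          r) - G2 r (v r))) r" for r
        using has_vector_derivative_diff[OF su(3)[of r] sv(3)[of r]]
          by (simp add: matrix_vector_mult_diff_distrib algebra_simps)
      show "norm (G2 r (u r) - G2 r (v r)) \<le> K2 * D * exp (b * r)" for r
        using L2[of r "u r" "v r"] mult_left_mono[OF D[of r] K(2)] by (simp add: mult.assoc)
      show "norm (snd (T u r) - snd (T v r)) \<le> (Du' + Dv') * exp (b * r)" for r
        using bd[of r] norm_ge_zero[of "fst (T u r - T v r)"]
          unfolding pair_norm_def snd_diff[symmetric] by linarith
    qed (use K \<open>D \<ge> 0\<close> in auto)
    ultimately show ?thesis unfolding pair_norm_def \<kappa>_def by (simp add: algebra_simps)
  qed
  have T0: "\<exists>E0. \<forall>t. pair_norm (T (\<lambda>_. 0) t) \<le> E0 * exp (b * t)"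
    using solT[of "\<lambda>_. 0" 0] unfolding sol_def by (auto simp: pair_norm_def)
  then obtain E0 where E0: "\<And>t. pair_norm (T (\<lambda>_. 0) t) \<le> E0 * exp (b * t)" by blast
  obtain v D where v: "continuous_on UNIV v" "\<And>t. pair_norm (v t) \<le> D * exp (b * t)" "T v = v"
  proof (rule weighted_fixpoint[of pair_norm 2 "\<lambda>t. exp (b * t)" \<kappa> T E0])
    show "\<kappa> \<ge> 0" using K gap by (auto simp: \<kappa>_def)
    show "continuous_on UNIV (T v)" if "continuous_on UNIV v" "\<And>t. pair_norm (v t)
        \<le> D * exp (b * t)" for v D
      using solT[OF that] unfolding sol_def by blast
    show "pair_norm (T u t - T v t) \<le> \<kappa> * D * exp (b * t)"
      if "continuous_on UNIV u" "\<And>t. pair_norm (u t) \<le> Du * exp (b * t)"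
        "continuous_on UNIV v" "\<And>t. pair_norm (v t) \<le> Dv * exp (b * t)"
        "\<And>t. pair_norm (u t - v t) \<le> D * exp (b * t)" for u v Du Dv D t
      by (rule contr[OF that])
  qed (use pair_norm_props K E0 in \<open>auto intro!: continuous_intros simp: \<kappa>_def\<close>)
  then have "sol v v" using solT[OF v(1,2)] by simp
  then show thesis using that[OF v(1,2)] unfolding sol_def by blast
qed

section \<open>Integral equations with Lipschitz right-hand side\<close>

lemma rderiv_exp_increment:
  fixes d :: "real \<Rightarrow> 'a::real_normed_vector"
  assumes c: "continuous_on UNIV d" and d: "\<And>t. has_rderiv d (d' t) t" and "C \<ge> 0" "\<nu> > 0"
    and d': "\<And>r. 0 \<le> r \<and> r \<le> t \<or> t \<le> r \<and> r \<le> 0 \<Longrightarrow> norm (d' r) \<le> C * exp (\<nu> * \<bar>r\<bar>)"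
  shows "norm (d t - d 0) \<le> C / \<nu> * exp (\<nu> * \<bar>t\<bar>)"
proof (cases "t \<ge> 0")
  case True
  have "norm (d t - d 0) \<le> C / \<nu> * exp (\<nu> * t) - C / \<nu> * exp (\<nu> * 0)"
  proof (rule right_mvt[OF True continuous_on_subset[OF c] d])
    show "norm (d' r) \<le> C * exp (\<nu> * r)" if "0 \<le> r" "r < t" for r using d'[of r] that by simp
    show "((\<lambda>s. C / \<nu> * exp (\<nu> * s)) has_real_derivative C * exp (\<nu> * r)) (at r)" for r
      using \<open>\<nu> > 0\<close> by (auto intro!: derivative_eq_intros)
  qed auto
  then show ?thesis using True \<open>C \<ge> 0\<close> \<open>\<nu> > 0\<close> by (auto intro: order.trans)
next
  case False
  have "norm (d 0 - d t) \<le> - (C / \<nu>) * exp (- \<nu> * 0) - (- (C / \<nu>) * exp (- \<nu> * t))"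
  proof (rule right_mvt[OF _ continuous_on_subset[OF c] d])
    show "norm (d' r) \<le> C * exp (- \<nu> * r)" if "t \<le> r" "r < 0" for r using d'[of r] that by simp
    show "((\<lambda>s. - (C / \<nu>) * exp (- \<nu> * s)) has_real_derivative C * exp (- \<nu> * r)) (at r)" for r
      using \<open>\<nu> > 0\<close> by (auto intro!: derivative_eq_intros)
  qed (use False in auto)
  moreover have "C / \<nu> \<ge> 0" using \<open>C \<ge> 0\<close> \<open>\<nu> > 0\<close> by simp
  ultimately show ?thesis using False by (simp add: norm_minus_commute)
qed

text \<open>Gronwall by iteration: in the weight \<open>exp (\<nu> * \<bar>t\<bar>)\<close> any
  bound for \<open>d\<close> can be halved, hence the bound 0 holds. The argument runs in both time
  directions at once.\<close>

lemma rderiv_gronwall_zero: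
  fixes d :: "real \<Rightarrow> 'a::real_normed_vector"
  assumes c: "continuous_on UNIV d" and d: "\<And>t. has_rderiv d (d' t) t"
    and L: "L \<ge> 0" "\<And>t. norm (d' t) \<le> L * norm (d t)" and "d 0 = 0"
  shows "d t = 0"
proof -
  \<comment> \<open>The factor 2 makes \<open>L / \<nu>\<close> at most 1/2, and the
    \<open>+ 1\<close> keeps \<open>\<nu>\<close> positive when \<open>L = 0\<close>.\<close>
  define \<nu> where "\<nu> = 2 * L + 1"
  have \<nu>: "\<nu> > 0" "L / \<nu> \<le> 1/2" using L(1) by (auto simp: \<nu>_def field_simps)
  define T where "T = \<bar>t\<bar>"
  have "compact (d ` {-T..T})" by (intro compact_continuous_image continuous_on_subset[OF c]) auto
  then obtain M where M: "\<And>s. s \<in> {-T..T} \<Longrightarrow> norm (d s) \<le> M"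
    using compact_imp_bounded bounded_iff by (metis imageI)
  define Q where "Q D \<longleftrightarrow> (\<forall>s\<in>{-T..T}. norm (d s) \<le> D * exp (\<nu> * \<bar>s\<bar>))" for D
  have "norm (d t) \<le> 0 / (1 - 1/2) * exp (\<nu> * \<bar>t\<bar>)"
  proof (rule affine_iterate[of "1/2" Q M])
    have "M \<ge> 0" using order.trans[OF norm_ge_zero M[of 0]] by (simp add: T_def)
    show "Q M" unfolding Q_def
    proof
      fix s assume "s \<in> {-T..T}"
      then have "norm (d s) \<le> M * 1" using M by simp
      also have "\<dots> \<le> M * exp (\<nu> * \<bar>s\<bar>)" using \<open>M \<ge> 0\<close> \<nu>(1) by (intro mult_left_mono) auto
      finally show "norm (d s) \<le> M * exp (\<nu> * \<bar>s\<bar>)" .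
    qed
    show "norm (d t) \<le> D * exp (\<nu> * \<bar>t\<bar>)" if "Q D" for D
    proof -
      have "t \<in> {-T..T}" unfolding T_def by auto
      then show ?thesis using that unfolding Q_def by blast
    qed
    fix D assume Q: "Q D"
    have "D \<ge> 0" using Q[unfolded Q_def, rule_format, of 0] by (simp add: T_def \<open>d 0 = 0\<close>)
    have "norm (d s) \<le> D / 2 * exp (\<nu> * \<bar>s\<bar>)" if s: "s \<in> {-T..T}" for s
    proof -
      have "norm (d s - d 0) \<le> L * D / \<nu> * exp (\<nu> * \<bar>s\<bar>)"
      proof (rule rderiv_exp_increment[OF c d])
        fix r assume "0 \<le> r \<and> r \<le> s \<or> s \<le> r \<and> r \<le> 0"
        then have "norm (d r) \<le> D * exp (\<nu> * \<bar>r\<bar>)" using Q[unfolded Q_def, rule_format, of r] s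
          by auto
        from order.trans[OF L(2) mult_left_mono[OF this L(1)]]
        show "norm (d' r) \<le> L * D * exp (\<nu> * \<bar>r\<bar>)" by (simp add: mult.assoc)
      qed (use L(1) \<nu>(1) \<open>D \<ge> 0\<close> in auto)
      also have "\<dots> = (L / \<nu>) * (D * exp (\<nu> * \<bar>s\<bar>))" by simp
      also have "\<dots> \<le> 1/2 * (D * exp (\<nu> * \<bar>s\<bar>))" using \<open>D \<ge> 0\<close> \<nu>(2) by (intro mult_right_mono) auto
      finally show ?thesis using \<open>d 0 = 0\<close> by simp
    qed
    then show "Q (0 + 1/2 * D)" unfolding Q_def by simp
  qed auto
  then show ?thesis by simp
qed

text \<open>The Lipschitz constant is uniform in time, so in a suitable weight the Picard map is a
  contraction with constant 1/2 on the whole axis; no local solutions have to be continued.\<close>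

lemma picard_global:
  fixes f :: "real \<Rightarrow> 'a::euclidean_space \<Rightarrow> 'a"
  assumes cad: "\<And>u. continuous_on UNIV u \<Longrightarrow> cadlag (\<lambda>t. f t (u t))"
    and L: "L \<ge> 0" "\<And>t x y. norm (f t x - f t y) \<le> L * norm (x - y)"
  obtains z where "z 0 = z0" "continuous_on UNIV z" "\<And>t. has_rderiv z (f t (z t)) t"
proof -
  define \<nu> where "\<nu> = 2 * L + 1"
  have \<nu>: "\<nu> > 0" "L / \<nu> \<le> 1/2" using L(1) by (auto simp: \<nu>_def field_simps)
  define p0 where "p0 r = f r 0" for r
  have p0: "cadlag p0" unfolding p0_def by (rule cad) simp
  have np0: "cadlag (\<lambda>r. norm (p0 r))" by (rule cadlag_compose[OF p0]) (intro continuous_intros)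
  define B where "B t = (LBINT r=ereal 0..ereal t. norm (p0 r))" for t
  have B0: "B 0 = 0" by (simp add: B_def)
  have Binc: "norm ((LBINT r=ereal 0..ereal t. p0 r) - (LBINT r=ereal 0..ereal s. p0 r))
      \<le> B t - B s" if "s \<le> t" for s t
    unfolding B_def cadlag_integral_diff[OF p0] cadlag_integral_diff[OF np0]
      by (rule cadlag_integral_norm_le[OF p0 that])
  then have Bmono: "B s \<le> B t" if "s \<le> t" for s t
    using that norm_ge_zero order.trans by (metis diff_ge_0_iff_ge)
  have Bc: "continuous_on UNIV B" unfolding B_def by (rule cadlag_integral_continuous[OF np0])
  \<comment> \<open>the weight has to absorb the possibly fast growth of the free term, of which nothing is known
    for large times\<close>
  define w where "w t = exp (\<nu> * \<bar>t\<bar>) * (1 + \<bar>B t\<bar>)" for t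
  have wc: "continuous_on UNIV w" unfolding w_def by (intro continuous_intros Bc)
  have wp: "w t > 0" for t by (simp add: w_def add_pos_nonneg)
  define T where "T u t = z0 + (LBINT r=ereal 0..ereal t. f r (u r))" for u t
  have Tc: "continuous_on UNIV (T u)" if "continuous_on UNIV u" for u
    unfolding T_def by (intro continuous_intros cadlag_integral_continuous cad that)
  have Td: "has_rderiv (T u) (f t (u t)) t" if "continuous_on UNIV u" for u t
    unfolding T_def
    using has_vector_derivative_add[OF has_vector_derivative_const cadlag_integral_rderiv[OF cad[OF
      that]]] by auto
  have T0: "norm (T (\<lambda>_. 0) t) \<le> (norm z0 + 1) * w t" for t
  proof -
    have "norm (LBINT r=ereal 0..ereal t. p0 r) \<le> \<bar>B t\<bar>"
      using Binc[of 0 t] Binc[of t 0] B0 by (cases "0 \<le> t") auto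
    then have "norm (T (\<lambda>_. 0) t) \<le> norm z0 + \<bar>B t\<bar>"
      unfolding T_def p0_def using norm_triangle_ineq order.trans
        by (metis (no_types, lifting) add_left_mono)
    also have "\<dots> \<le> (norm z0 + 1) * (1 + \<bar>B t\<bar>)" by (simp add: algebra_simps)
    also have "\<dots> \<le> (norm z0 + 1) * w t"
      unfolding w_def using \<nu>(1) by (intro mult_left_mono) (auto simp: mult_le_cancel_right1)
    finally show ?thesis .
  qed
  obtain z D where z: "continuous_on UNIV z" "\<And>t. norm (z t) \<le> D * w t" "T z = z"
  proof (rule weighted_fixpoint[of norm 1 w "1/2" T "norm z0 + 1"])
    show "norm (T u t - T v t) \<le> 1/2 * D * w t"
      if u: "continuous_on UNIV u" "\<And>t. norm (u t) \<le> Du * w t"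
        and v: "continuous_on UNIV v" "\<And>t. norm (v t) \<le> Dv * w t"
        and D: "\<And>t. norm (u t - v t) \<le> D * w t" for u v Du Dv D t
    proof -
      have "D \<ge> 0" using order.trans[OF norm_ge_zero D[of 0]] wp[of 0]
        by (simp add: zero_le_mult_iff)
      have dc: "continuous_on UNIV (\<lambda>s. T u s - T v s)" by (intro continuous_intros Tc u v)
      have dd: "has_rderiv (\<lambda>s. T u s - T v s) (f r (u r) - f r (v r)) r" for r
        by (intro has_vector_derivative_diff Td u v)
      have d0: "T u 0 - T v 0 = 0" by (simp add: T_def)
      \<comment> \<open>Between 0 and \<open>t\<close> the monotone \<open>B\<close> is largest in
        absolute value at \<open>t\<close>, so this part of the weight can be frozen and only the
        exponential is integrated.\<close>
      define E where "E = D * (1 + \<bar>B t\<bar>)"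
      have "E \<ge> 0" using \<open>D \<ge> 0\<close> by (simp add: E_def)
      have fb: "norm (f r (u r) - f r (v r)) \<le> L * E * exp (\<nu> * \<bar>r\<bar>)"
        if "0 \<le> r \<and> r \<le> t \<or> t \<le> r \<and> r \<le> 0" for r
      proof -
        have "\<bar>B r\<bar> \<le> \<bar>B t\<bar>" using that Bmono[of 0 r] Bmono[of r t] Bmono[of t r] Bmono[of r 0] B0
          by auto
        then have "D * w r \<le> E * exp (\<nu> * \<bar>r\<bar>)" unfolding w_def E_def using \<open>D \<ge> 0\<close>
          by (simp add: mult_ac mult_left_mono)
        then have "norm (u r - v r) \<le> E * exp (\<nu> * \<bar>r\<bar>)" using D[of r] by linarith
        then show ?thesis using L(2)[of r "u r" "v r"] mult_left_mono[OF _ L(1)]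
          by (fastforce simp: mult.assoc)
      qed
      have "norm ((T u t - T v t) - (T u 0 - T v 0)) \<le> L * E / \<nu> * exp (\<nu> * \<bar>t\<bar>)"
        by (rule rderiv_exp_increment[OF dc dd _ \<nu>(1) fb]) (use L(1) \<open>E \<ge> 0\<close> in auto)
      then have "norm (T u t - T v t) \<le> L / \<nu> * (E * exp (\<nu> * \<bar>t\<bar>))" using d0 by simp
      also have "\<dots> \<le> 1/2 * (E * exp (\<nu> * \<bar>t\<bar>))" using \<open>E \<ge> 0\<close> \<nu>(2) by (intro mult_right_mono) auto
      also have "\<dots> = 1/2 * D * w t" by (simp add: E_def w_def mult_ac)
      finally show ?thesis .
    qed
    show "norm (T (\<lambda>_. 0) t) \<le> (norm z0 + 1) * w t" for t by (rule T0)
    show "continuous_on UNIV (T u)" if "continuous_on UNIV u" for u by (rule Tc[OF that])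
  qed (use wc wp in \<open>auto simp: norm_triangle_ineq\<close>)
  have "has_rderiv z (f t (z t)) t" for t using Td[OF z(1), of t] z(3) by simp
  moreover have "z 0 = z0" using fun_cong[OF z(3), of 0] by (simp add: T_def)
  ultimately show thesis using that z(1) by blast
qed

text \<open>Regularity is bootstrapped: integrability makes \<open>z - M\<close> continuous, hence
  \<open>z\<close> cadlag, hence the integrand cadlag, and then the criterion with right derivatives
  applies.\<close>

lemma solves_iff:
  assumes cad: "\<And>z. cadlag z \<Longrightarrow> cadlag (\<lambda>t. f t (z t))" and M: "cadlag M"
  shows "solves f M z0 z \<longleftrightarrow> z 0 - M 0 = z0 \<and> continuous_on UNIV (\<lambda>t. z t - M t) \<and>
    (\<forall>t. has_rderiv (\<lambda>t. z t - M t) (f t (z t)) t)"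
proof
  assume s: "solves f M z0 z"
  have eq: "z t - M t = z0 + (LBINT s=ereal 0..ereal t. f s (z s))" for t
  proof -
    have "z t = z0 + (LBINT s=ereal 0..ereal t. f s (z s)) + M t" using s unfolding solves_def
      by blast
    then show ?thesis by (metis add_diff_cancel_right')
  qed
  have ii: "interval_lebesgue_integrable lborel (ereal 0) (ereal t) (\<lambda>s. f s (z s))" for t
    using s unfolding solves_def by blast
  have "continuous_on UNIV (\<lambda>t. z t - M t)"
    unfolding eq by (intro continuous_intros interval_integral_continuous ii)
  then have "cadlag (\<lambda>t. (z t - M t) + M t)" by (intro cadlag_add cadlag_continuous M)
  then have "cadlag (\<lambda>t. f t (z t))" by (intro cad) simp
  from integral_eq_iff_rderiv[OF this, of "\<lambda>t. z t - M t" z0] eq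
  show "z 0 - M 0 = z0 \<and> continuous_on UNIV (\<lambda>t. z t - M t) \<and>
    (\<forall>t. has_rderiv (\<lambda>t. z t - M t) (f t (z t)) t)" by blast
next
  assume *: "z 0 - M 0 = z0 \<and> continuous_on UNIV (\<lambda>t. z t - M t) \<and>
    (\<forall>t. has_rderiv (\<lambda>t. z t - M t) (f t (z t)) t)"
  then have "cadlag (\<lambda>t. (z t - M t) + M t)" by (intro cadlag_add cadlag_continuous M) auto
  then have c: "cadlag (\<lambda>t. f t (z t))" by (intro cad) simp
  have "\<forall>t. z t - M t = z0 + (LBINT s=ereal 0..ereal t. f s (z s))"
    using integral_eq_iff_rderiv[OF c, of "\<lambda>t. z t - M t" z0] * by blast
  then have "z t = z0 + (LBINT s=ereal 0..ereal t. f s (z s)) + M t" for t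
    by (metis diff_add_cancel)
  then show "solves f M z0 z" unfolding solves_def using cadlag_interval_integrable[OF c] by blast
qed

section \<open>The stationary process along a path\<close>

lemma exp_tendsto_zero_at_bot: "d > (0::real) \<Longrightarrow> ((\<lambda>s. exp (d * s)) \<longlongrightarrow> 0) at_bot"
  by (intro filterlim_compose[OF exp_at_bot] filterlim_tendsto_pos_mult_at_bot[OF tendsto_const])
    (auto simp: filterlim_ident)

lemma has_rderiv_shift:
  assumes "has_rderiv z D (t + s)" shows "has_rderiv (\<lambda>t. z (t + s)) D t"
  unfolding has_rderiv_iff
proof (intro allI impI)
  fix e :: real assume "e > 0"
  then obtain d where d: "d > 0" "\<forall>r. t + s \<le> r \<and> r < t + s + d \<longrightarrow> norm (z r - z (t + s) - (r - (t
      + s)) *\<^sub>R D) \<le> e * (r - (t + s))"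
    using assms unfolding has_rderiv_iff by blast
  show "\<exists>d>0. \<forall>r. t \<le> r \<and> r < t + d \<longrightarrow> norm (z (r + s) - z (t + s) - (r - t) *\<^sub>R D) \<le> e * (r - t)"
  proof (intro exI[of _ d] conjI allI impI)
    fix r assume "t \<le> r \<and> r < t + d"
    then show "norm (z (r + s) - z (t + s) - (r - t) *\<^sub>R D) \<le> e * (r - t)"
      using d(2)[rule_format, of "r + s"] by simp
  qed (rule d)
qed

text \<open>Agreement to the right of \<open>t\<close> is enough, so a path glued at time 0 can be
  treated at 0 itself like its right-hand piece.\<close>

lemma has_rderiv_cong:
  assumes "has_rderiv f D t" "t < u" "\<And>s. t \<le> s \<Longrightarrow> s < u \<Longrightarrow> g s = f s"
  shows "has_rderiv g D t"
  unfolding has_rderiv_iff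
proof (intro allI impI)
  fix e :: real assume "e > 0"
  then obtain d where d: "d > 0" "\<forall>s. t \<le> s \<and> s < t + d \<longrightarrow> norm (f s - f t - (s - t) *\<^sub>R D)
      \<le> e * (s - t)"
    using assms(1) unfolding has_rderiv_iff by blast
  show "\<exists>d>0. \<forall>s. t \<le> s \<and> s < t + d \<longrightarrow> norm (g s - g t - (s - t) *\<^sub>R D) \<le> e * (s - t)"
    by (intro exI[of _ "min d (u - t)"]) (use d assms(2,3) in auto)
qed

lemma has_rderiv_fst: "has_rderiv z D t \<Longrightarrow> has_rderiv (\<lambda>t. fst (z t)) (fst D) t"
  by (rule bounded_linear.has_vector_derivative[OF bounded_linear_fst])

lemma has_rderiv_snd: "has_rderiv z D t \<Longrightarrow> has_rderiv (\<lambda>t. snd (z t)) (snd D) t"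
  by (rule bounded_linear.has_vector_derivative[OF bounded_linear_snd])

lemma path_shift_path_shift: "path_shift s (path_shift t \<omega>) = path_shift (s + t) \<omega>"
  by (simp add: path_shift_def add.assoc)

text \<open>Together with \<open>fast_coefficient\<close> this rewrites the quotients produced by
  the weight exponent \<open>- (\<gamma> / \<epsilon>)\<close> into the constants of the tracking
  estimate.\<close>

lemma slow_coefficient:
  fixes \<epsilon> :: real
  assumes "\<epsilon> > 0" "\<gamma> > 0" "\<gamma>s > 0"
  shows "K / (\<gamma>s - - (\<gamma> / \<epsilon>)) = \<epsilon> * K / (\<gamma> + \<epsilon> * \<gamma>s)"
proof -
  have "\<gamma>s - - (\<gamma> / \<epsilon>) = (\<gamma> + \<epsilon> * \<gamma>s) / \<epsilon>" using assms by (simp add: field_simps)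
  then show ?thesis by simp
qed

lemma fast_coefficient:
  fixes \<epsilon> :: real
  assumes "\<epsilon> > 0"
  shows "(K / \<epsilon>) / (- (\<gamma> / \<epsilon>) - \<gamma>f / \<epsilon>) = - (K / (\<gamma> + \<gamma>f))"
proof -
  have "- (\<gamma> / \<epsilon>) - \<gamma>f / \<epsilon> = - ((\<gamma> + \<gamma>f) / \<epsilon>)" by (simp add: add_divide_distrib)
  then show ?thesis using assms by simp
qed

locale slow_fast_system =
  fixes S :: "real^'n1^'n1" and F :: "real^'n2^'n2"
    and g1 :: "(real^'n1) \<times> (real^'n2) \<Rightarrow> real^'n1" and g2 :: "(real^'n1) \<times> (real^'n2) \<Rightarrow> real^'n2"
    and \<sigma> \<alpha> \<epsilon> \<gamma>s \<gamma>f K \<gamma> :: real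
  assumes pos: "\<epsilon> > 0" "\<gamma> > 0" "\<gamma>s > 0" "K > 0" and gap: "\<gamma> + \<gamma>f < 0"
    and S_bound: "\<And>t x. t \<le> 0 \<Longrightarrow> norm (mexp S t x) \<le> exp (\<gamma>s * t) * norm x"
    and F_bound: "\<And>t y. t \<ge> 0 \<Longrightarrow> norm (mexp F t y) \<le> exp (\<gamma>f * t) * norm y"
    and g1_lip: "\<And>v w. norm (g1 v - g1 w) \<le> K * pair_norm (v - w)"
    and g2_lip: "\<And>v w. norm (g2 v - g2 w) \<le> K * pair_norm (v - w)"
    and g_zero: "g1 0 = 0" "g2 0 = 0"
    and small: "\<epsilon> * K / (\<gamma> + \<epsilon> * \<gamma>s) - K / (\<gamma> + \<gamma>f) < 1"
begin

text \<open>\<open>b\<close> is the weight exponent. Dividing the fast equation by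
  \<open>\<epsilon>\<close> turns its matrix, decay rate and Lipschitz constant into
  \<open>A2\<close>, \<open>a2\<close>, \<open>K2\<close>; \<open>nc\<close> is the noise
  coefficient.\<close>

definition b :: real where "b = - (\<gamma> / \<epsilon>)"
definition A2 :: "real^'n2^'n2" where "A2 = (1 / \<epsilon>) *\<^sub>R F"
definition a2 :: real where "a2 = \<gamma>f / \<epsilon>"
definition K2 :: real where "K2 = K / \<epsilon>"
definition nc :: real where "nc = \<epsilon> powr (- 1/\<alpha>)"

lemma rates: "b < 0" "a2 < b" "b < \<gamma>s" "0 \<le> K2"
proof -
  show "b < 0" using pos by (simp add: b_def)
  then show "b < \<gamma>s" using pos by linarith
  have "\<gamma>f / \<epsilon> < (- \<gamma>) / \<epsilon>" using pos gap by (intro divide_strict_right_mono) auto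
  then show "a2 < b" by (simp add: a2_def b_def)
  show "0 \<le> K2" using pos by (simp add: K2_def)
qed

lemma A2_bound: "t \<ge> 0 \<Longrightarrow> norm (mexp A2 t y) \<le> exp (a2 * t) * norm y"
  using F_bound[of "t / \<epsilon>" y] pos by (simp add: mexp_matrix_scaleR A2_def a2_def)

lemma nc_nonneg [simp]: "0 \<le> nc"
  by (simp add: nc_def)

lemma contraction_constant:
  "K / (\<gamma>s - b) + K2 / (b - a2) = \<epsilon> * K / (\<gamma> + \<epsilon> * \<gamma>s) - K / (\<gamma> + \<gamma>f)"
  unfolding b_def a2_def K2_def
  using slow_coefficient[of \<epsilon> \<gamma> \<gamma>s K] fast_coefficient[of \<epsilon> K \<gamma> \<gamma>f] pos by simp

text \<open>All that is asked of a noise path apart from its value at 0. As \<open>b < 0\<close>,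
  the weight grows towards \<open>-\<infinity>\<close> but decays towards
  \<open>+\<infinity>\<close>, so the constant has to depend on the end time
  \<open>T\<close>.\<close>

definition tame :: "(real \<Rightarrow> real^'n2) \<Rightarrow> bool" where
  "tame \<omega> \<longleftrightarrow> cadlag \<omega> \<and> (\<forall>T. \<exists>C. \<forall>r\<le>T. norm (\<omega> r) \<le> C * exp (b * r))"

text \<open>Makes the boundary terms of the integration by parts vanish: the semigroup decays at
  rate \<open>a2\<close>, and \<open>a2 < b\<close> beats the growth of the path.\<close>

lemma A2_decay_at_bot:
  assumes "\<And>r. r \<le> t \<Longrightarrow> norm (h r) \<le> C * exp (b * r)"
  shows "((\<lambda>a. mexp A2 (- a) (h (a + t))) \<longlongrightarrow> 0) at_bot"
proof (rule Lim_null_comparison)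
  show "eventually (\<lambda>a. norm (mexp A2 (- a) (h (a + t))) \<le> C * exp (b * t) * exp ((b - a2) * a))
      at_bot"
    using eventually_le_at_bot[of 0]
  proof eventually_elim
    case (elim a)
    have "norm (mexp A2 (- a) (h (a + t))) \<le> exp (a2 * (- a)) * norm (h (a + t))" using elim
      by (intro A2_bound) simp
    also have "\<dots> \<le> exp (a2 * (- a)) * (C * exp (b * (a + t)))" using elim
      by (intro mult_left_mono assms) auto
    also have "\<dots> = C * (exp (a2 * (- a)) * exp (b * (a + t)))" by (simp only: mult_ac)
    also have "exp (a2 * (- a)) * exp (b * (a + t)) = exp (b * t) * exp ((b - a2) * a)"
      unfolding mult_exp_exp by (simp add: algebra_simps add_divide_distrib)
    finally show ?case by (simp only: mult.assoc)
  qed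
  have "((\<lambda>a. C * exp (b * t) * exp ((b - a2) * a)) \<longlongrightarrow> C * exp (b * t) * 0) at_bot"
    using rates by (intro tendsto_intros exp_tendsto_zero_at_bot) simp
  then show "((\<lambda>a. C * exp (b * t) * exp ((b - a2) * a)) \<longlongrightarrow> 0) at_bot" by simp
qed

definition \<eta> :: "(real \<Rightarrow> real^'n2) \<Rightarrow> real \<Rightarrow> real^'n2" where
  "\<eta> \<omega> t = eta F \<alpha> \<epsilon> (path_shift t \<omega>)"

text \<open>\<open>V\<close> is the convolution of the fast semigroup with the past of the path.
  Integrating the Stieltjes integral by parts leaves the value of the path and \<open>A2\<close>
  applied to \<open>V\<close>. Regularity, growth and the equation of the stationary process are all
  read off from this formula.\<close>

lemma eta_representation:
  assumes "tame \<omega>"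
  obtains V where "continuous_on UNIV V" "\<And>t. has_rderiv V (A2 *v V t + \<omega> t) t"
    "\<And>T. \<exists>C. \<forall>r\<le>T. norm (V r) \<le> C * exp (b * r)"
    "\<And>t. \<eta> \<omega> t = nc *\<^sub>R (\<omega> t + A2 *v V t)"
proof -
  have cad: "cadlag \<omega>" and bd: "\<And>T. \<exists>C. \<forall>r\<le>T. norm (\<omega> r) \<le> C * exp (b * r)"
    using assms unfolding tame_def by blast+
  obtain C0 where C0: "\<And>r. r \<le> 0 \<Longrightarrow> norm (\<omega> r) \<le> C0 * exp (b * r)" using bd[of 0] by blast
  obtain V where V: "continuous_on UNIV V" "\<And>t. has_rderiv V (A2 *v V t + \<omega> t) t"
    "\<And>T C t. (\<And>r. r \<le> T \<Longrightarrow> norm (\<omega> r) \<le> C * exp (b * r)) \<Longrightarrow> t \<le> T \<Longrightarrow> norm (V t) \<le> C / (b - a2) * exp (b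
        * t)"
    by (rule fast_solution_exists[of A2 a2 b \<omega> 0 C0, OF A2_bound rates(2) cad C0]) blast+
  have Vb: "\<exists>C. \<forall>r\<le>T. norm (V r) \<le> C * exp (b * r)" for T
    using bd[of T] V(3)[of T] by blast
  have eta: "\<eta> \<omega> t = nc *\<^sub>R (\<omega> t + A2 *v V t)" for t
  proof -
    define f where "f s = matrix_exp ((- s / \<epsilon>) *\<^sub>R F)" for s
    have f_eq: "f s = matrix_exp (- s *\<^sub>R A2)" for s by (simp add: f_def A2_def)
    have fm: "f s *v x = mexp A2 (- s) x" for s x by (simp add: f_eq mexp_def)
    define f' where "f' s = (- 1) *\<^sub>R (A2 ** f s)" for s
    have f'm: "f' s *v x = - (A2 *v mexp A2 (- s) x)" for s x
      by (simp add: f'_def fm[symmetric] matrix_vector_mul_assoc bounded_bilinear.minus_left[OF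
        bounded_bilinear_matrix_vector])
    have fd: "(f has_vector_derivative f' r) (at r)" for r
    proof -
      have "((\<lambda>s. - s) has_vector_derivative (- 1)) (at r)" by (auto intro!: derivative_eq_intros)
      from vector_diff_chain_at[OF this matrix_exp_has_vector_derivative[of A2]]
      show ?thesis by (simp add: o_def f_eq[abs_def] f'_def)
    qed
    have f'c: "continuous_on UNIV f'"
    proof -
      have "continuous_on UNIV f" using has_vector_derivative_continuous[OF fd]
        by (auto intro: continuous_at_imp_continuous_on)
      then have "continuous_on UNIV (\<lambda>s. (- 1) *\<^sub>R (A2 ** f s))"
        unfolding matrix_matrix_mult_def by (intro continuous_intros)
      then show ?thesis unfolding f'_def .
    qed
    \<comment> \<open>A primitive of \<open>f' r *v path_shift t \<omega> r\<close>: the first term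
      accounts for \<open>\<omega> (r + t)\<close>, because the linear part of the equation of
      \<open>V\<close> cancels, and the second for the subtracted constant
      \<open>\<omega> t\<close>.\<close>
    define Q where "Q r = - (A2 *v mexp A2 (- r) (V (r + t))) - f r *v \<omega> t" for r
    have lin: "bounded_linear ((*v) A2)" by (rule matrix_vector_mul_bounded_linear)
    have Vs: "continuous_on UNIV (\<lambda>r. V (r + t))"
      by (rule continuous_on_compose2[OF V(1)]) (auto intro!: continuous_intros)
    have Qc: "continuous_on UNIV Q" unfolding Q_def fm
      by (intro continuous_intros bounded_linear.continuous_on[OF lin] Vs)
    have Qd: "has_rderiv Q (f' r *v path_shift t \<omega> r) r" for r
    proof -
      have m: "((\<lambda>s::real. - s) has_vector_derivative (- 1)) (at r within {r..})"
        by (auto intro!: derivative_eq_intros)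
      have 1: "has_rderiv (\<lambda>r. mexp A2 (- r) (V (r + t))) (mexp A2 (- r) ((-1) *\<^sub>R (A2 *v V (r + t))
          + (A2 *v V (r + t) + \<omega> (r + t)))) r"
        by (rule mexp_comp_deriv[OF m has_rderiv_shift[OF V(2)]])
      have 2: "has_rderiv (\<lambda>r. mexp A2 (- r) (\<omega> t)) (mexp A2 (- r) ((-1) *\<^sub>R (A2 *v \<omega> t) + 0)) r"
        by (rule mexp_comp_deriv[OF m has_vector_derivative_const])
      have "has_rderiv Q (- (A2 *v (mexp A2 (- r) ((-1) *\<^sub>R (A2 *v V (r + t)) + (A2 *v V (r + t)
          + \<omega> (r + t))))) - mexp A2 (- r) ((-1) *\<^sub>R (A2 *v \<omega> t) + 0)) r"
        unfolding Q_def fm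
        by (intro has_vector_derivative_diff has_vector_derivative_minus
          bounded_linear.has_vector_derivative[OF lin] 1 2)
      moreover have "- (A2 *v (mexp A2 (- r) ((-1) *\<^sub>R (A2 *v V (r + t)) + (A2 *v V (r + t) + \<omega> (r
          + t))))) - mexp A2 (- r) ((-1) *\<^sub>R (A2 *v \<omega> t) + 0)
          = f' r *v path_shift t \<omega> r"
        unfolding f'm path_shift_def mexp_commute by (simp add: mexp_minus mexp_diff linear_diff
          matrix_vector_mult_diff_distrib)
      ultimately show ?thesis by simp
    qed
    have cads: "cadlag (path_shift t \<omega>)" unfolding path_shift_def
      by (rule cadlag_diff[OF cadlag_shift[OF cad] cadlag_const])
    have rs: "rs_integral f (path_shift t \<omega>) a 0 =
       \<omega> t + A2 *v V t - mexp A2 (- a) (\<omega> (a + t)) - A2 *v mexp A2 (- a) (V (a + t))" if "a \<le>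
         0" for a
    proof -
      have "rs_integral f (path_shift t \<omega>) a 0 = f 0 *v path_shift t \<omega> 0 - f a *v path_shift t \<omega> a
          - (Q 0 - Q a)"
        by (rule rs_integral_eqI[OF that has_rs_integral_by_parts[OF that cads fd f'c Qc Qd]])
      then show ?thesis unfolding Q_def fm path_shift_def by (simp add: mexp_diff)
    qed
    have "((\<lambda>a. \<omega> t + A2 *v V t - mexp A2 (- a) (\<omega> (a + t)) - A2 *v mexp A2 (- a) (V (a + t))) \<longlongrightarrow> \<omega> t
        + A2 *v V t - 0 - A2 *v 0) at_bot"
    proof (intro tendsto_intros bounded_linear.tendsto[OF lin])
      obtain C where "\<And>r. r \<le> t \<Longrightarrow> norm (\<omega> r) \<le> C * exp (b * r)" using bd by blast
      then show "((\<lambda>a. mexp A2 (- a) (\<omega> (a + t))) \<longlongrightarrow> 0) at_bot" by (rule A2_decay_at_bot)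
      obtain C where "\<And>r. r \<le> t \<Longrightarrow> norm (V r) \<le> C * exp (b * r)" using Vb by blast
      then show "((\<lambda>a. mexp A2 (- a) (V (a + t))) \<longlongrightarrow> 0) at_bot" by (rule A2_decay_at_bot)
    qed
    moreover have "eventually (\<lambda>a. \<omega> t + A2 *v V t - mexp A2 (- a) (\<omega> (a + t)) - A2 *v mexp A2 (- a)
        (V (a + t))
        = rs_integral f (path_shift t \<omega>) a 0) at_bot"
      using eventually_le_at_bot[of 0] by eventually_elim (simp add: rs)
    ultimately have "((\<lambda>a. rs_integral f (path_shift t \<omega>) a 0) \<longlongrightarrow> \<omega> t + A2 *v V t - 0 - A2 *v 0)
        at_bot"
      by (rule Lim_transform_eventually)
    then have "((\<lambda>a. rs_integral f (path_shift t \<omega>) a 0) \<longlongrightarrow> \<omega> t + A2 *v V t) at_bot" by simp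
    then have "Lim at_bot (\<lambda>a. rs_integral f (path_shift t \<omega>) a 0) = \<omega> t + A2 *v V t"
      by (intro tendsto_Lim) auto
    then show ?thesis unfolding \<eta>_def eta_def f_def nc_def by simp
  qed
  show thesis by (rule that[OF V(1,2) Vb eta])
qed

lemma eta_cadlag: assumes "tame \<omega>" shows "cadlag (\<eta> \<omega>)"
proof -
  obtain V where V: "continuous_on UNIV V" "\<And>t. \<eta> \<omega> t = nc *\<^sub>R (\<omega> t + A2 *v V t)"
    using eta_representation[OF assms] by metis
  have "cadlag \<omega>" using assms by (simp add: tame_def)
  then have "cadlag (\<lambda>t. nc *\<^sub>R (\<omega> t + A2 *v V t))"
    by (rule cadlag_compose2[OF _ cadlag_continuous[OF V(1)], of \<omega> "\<lambda>x v. nc *\<^sub>R (x + A2 *v v)"])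
      (auto intro!: continuous_intros bounded_linear.continuous_on[OF
        matrix_vector_mul_bounded_linear] simp: case_prod_beta)
  moreover have "\<eta> \<omega> = (\<lambda>t. nc *\<^sub>R (\<omega> t + A2 *v V t))" by (rule ext) (rule V(2))
  ultimately show ?thesis by (simp only:)
qed

lemma eta_bound: assumes "tame \<omega>" shows "\<exists>C\<ge>0. \<forall>r\<le>T. norm (\<eta> \<omega> r) \<le> C * exp (b * r)"
proof -
  obtain V where V: "\<And>T. \<exists>C. \<forall>r\<le>T. norm (V r) \<le> C * exp (b * r)" "\<And>t. \<eta> \<omega> t = nc *\<^sub>R (\<omega> t + A2 *v V
      t)"
    using eta_representation[OF assms] by metis
  obtain B where B: "B > 0" "\<And>x. norm (A2 *v x) \<le> norm x * B"
    using bounded_linear.pos_bounded[OF matrix_vector_mul_bounded_linear[of A2]] by blast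
  obtain C1 where C1: "\<forall>r\<le>T. norm (V r) \<le> C1 * exp (b * r)" using V(1) by blast
  obtain C2 where C2: "\<forall>r\<le>T. norm (\<omega> r) \<le> C2 * exp (b * r)" using assms unfolding tame_def by blast
  have *: "norm (\<eta> \<omega> r) \<le> nc * (C2 + C1 * B) * exp (b * r)" if "r \<le> T" for r
  proof -
    have "norm (\<omega> r + A2 *v V r) \<le> norm (\<omega> r) + norm (A2 *v V r)" by (rule norm_triangle_ineq)
    also have "\<dots> \<le> C2 * exp (b * r) + (C1 * exp (b * r)) * B"
      using that C1 C2 B(1) by (intro add_mono order.trans[OF B(2)] mult_right_mono) auto
    also have "\<dots> = (C2 + C1 * B) * exp (b * r)" by (simp add: algebra_simps)
    finally have "nc * norm (\<omega> r + A2 *v V r) \<le> nc * ((C2 + C1 * B) * exp (b * r))"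
      by (intro mult_left_mono) auto
    then show ?thesis unfolding V(2) by (simp add: mult.assoc)
  qed
  have "nc * (C2 + C1 * B) \<ge> 0"
    using order.trans[OF norm_ge_zero *[of T]] by (simp add: zero_le_mult_iff)
  then show ?thesis using * by blast
qed

text \<open>Says that the process solves the linear equation driven by the noise. All jumps sit in
  \<open>nc *\<^sub>R \<omega> t\<close>; what remains is a multiple of \<open>A2 *v V t\<close>,
  and differentiating \<open>V\<close> reproduces \<open>\<eta>\<close>.\<close>

lemma eta_noise:
  assumes "tame \<omega>"
  shows "continuous_on UNIV (\<lambda>t. \<eta> \<omega> t - nc *\<^sub>R \<omega> t)" "has_rderiv (\<lambda>t. \<eta> \<omega> t - nc *\<^sub>R \<omega> t) (A2 *v \<eta>
      \<omega> t) t"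
proof -
  obtain V where V: "continuous_on UNIV V" "\<And>t. has_rderiv V (A2 *v V t + \<omega> t) t" "\<And>t. \<eta> \<omega> t
      = nc *\<^sub>R (\<omega> t + A2 *v V t)"
    using eta_representation[OF assms] by metis
  have lin: "bounded_linear ((*v) A2)" by (rule matrix_vector_mul_bounded_linear)
  have eq: "\<eta> \<omega> t - nc *\<^sub>R \<omega> t = nc *\<^sub>R (A2 *v V t)" for t by (simp add: V(3) scaleR_right_distrib)
  show "continuous_on UNIV (\<lambda>t. \<eta> \<omega> t - nc *\<^sub>R \<omega> t)" unfolding eq
    by (intro continuous_intros bounded_linear.continuous_on[OF lin] V)
  have "has_rderiv (\<lambda>t. nc *\<^sub>R (A2 *v V t)) (nc *\<^sub>R (A2 *v (A2 *v V t + \<omega> t))) t"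
    by (intro bounded_linear.has_vector_derivative[OF bounded_linear_scaleR_right]
        bounded_linear.has_vector_derivative[OF lin] V)
  moreover have "nc *\<^sub>R (A2 *v (A2 *v V t + \<omega> t)) = A2 *v \<eta> \<omega> t"
    by (simp add: V(3) matrix_vector_mult_scaleR add.commute)
  ultimately show "has_rderiv (\<lambda>t. \<eta> \<omega> t - nc *\<^sub>R \<omega> t) (A2 *v \<eta> \<omega> t) t" unfolding eq by simp
qed

lemma eta_shift: "\<eta> (path_shift t \<omega>) s = \<eta> \<omega> (s + t)"
  by (simp add: \<eta>_def path_shift_path_shift)

lemma tame_shift: assumes "tame \<omega>" shows "tame (path_shift t \<omega>)"
  unfolding tame_def
proof (intro conjI allI)
  have cad: "cadlag \<omega>" and bd: "\<And>T. \<exists>C. \<forall>r\<le>T. norm (\<omega> r) \<le> C * exp (b * r)"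
    using assms unfolding tame_def by blast+
  show "cadlag (path_shift t \<omega>)" unfolding path_shift_def
    by (rule cadlag_diff[OF cadlag_shift[OF cad] cadlag_const])
  fix T
  obtain C where C: "\<forall>r\<le>T + t. norm (\<omega> r) \<le> C * exp (b * r)" using bd by blast
  \<comment> \<open>The subtracted constant \<open>\<omega> t\<close> is absorbed because
    \<open>exp (b * r) / exp (b * T)\<close> is at least 1 for \<open>r \<le> T\<close>, as
    \<open>b < 0\<close>.\<close>
  have "norm (path_shift t \<omega> r) \<le> (C * exp (b * t) + norm (\<omega> t) / exp (b * T)) * exp (b * r)"
    if "r \<le> T" for r
  proof -
    have "exp (b * T) \<le> exp (b * r)" using that rates(1) by (simp add: mult_left_mono_neg)
    then have "1 \<le> exp (b * r) / exp (b * T)" by (simp add: field_simps)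
    then have "norm (\<omega> t) * 1 \<le> norm (\<omega> t) * (exp (b * r) / exp (b * T))"
      by (intro mult_left_mono) auto
    moreover have "norm (\<omega> (r + t)) \<le> C * exp (b * (r + t))" using C that by simp
    moreover have "exp (b * (r + t)) = exp (b * r) * exp (b * t)" unfolding mult_exp_exp
      by (simp add: algebra_simps)
    moreover have "norm (path_shift t \<omega> r) \<le> norm (\<omega> (r + t)) + norm (\<omega> t)"
      unfolding path_shift_def by (rule norm_triangle_ineq4)
    ultimately have "norm (path_shift t \<omega> r) \<le> C * (exp (b * r) * exp (b * t)) + norm (\<omega> t) * (exp
        (b * r) / exp (b * T))"
      by simp
    then show ?thesis by (simp add: distrib_right distrib_left mult_ac)
  qed
  then show "\<exists>C. \<forall>r\<le>T. norm (path_shift t \<omega> r) \<le> C * exp (b * r)" by blast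
qed


section \<open>The random differential equation and its slow manifold\<close>

definition G1 :: "(real \<Rightarrow> real^'n2) \<Rightarrow> real \<Rightarrow> (real^'n1) \<times> (real^'n2) \<Rightarrow> real^'n1" where
  "G1 \<omega> t v = g1 (fst v, snd v + \<sigma> *\<^sub>R \<eta> \<omega> t)"

definition G2 :: "(real \<Rightarrow> real^'n2) \<Rightarrow> real \<Rightarrow> (real^'n1) \<times> (real^'n2) \<Rightarrow> real^'n2" where
  "G2 \<omega> t v = (1 / \<epsilon>) *\<^sub>R g2 (fst v, snd v + \<sigma> *\<^sub>R \<eta> \<omega> t)"

definition vfield :: "(real \<Rightarrow> real^'n2) \<Rightarrow> real \<Rightarrow> (real^'n1) \<times> (real^'n2) \<Rightarrow> (real^'n1) \<times> (real^'n2)"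
    where
  "vfield \<omega> t v = (S *v fst v + G1 \<omega> t v, A2 *v snd v + G2 \<omega> t v)"

lemma G_lip: "norm (G1 \<omega> t v - G1 \<omega> t w) \<le> K * pair_norm (v - w)" "norm (G2 \<omega> t v - G2 \<omega> t w)
    \<le> K2 * pair_norm (v - w)"
proof -
  show "norm (G1 \<omega> t v - G1 \<omega> t w) \<le> K * pair_norm (v - w)"
    using g1_lip[of "(fst v, snd v + \<sigma> *\<^sub>R \<eta> \<omega> t)" "(fst w, snd w + \<sigma> *\<^sub>R \<eta> \<omega> t)"]
      by (simp add: G1_def pair_norm_def)
  have "norm (G2 \<omega> t v - G2 \<omega> t w) = norm (g2 (fst v, snd v + \<sigma> *\<^sub>R \<eta> \<omega> t) - g2 (fst w, snd w
      + \<sigma> *\<^sub>R \<eta> \<omega> t)) / \<epsilon>"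
    unfolding G2_def using pos by (simp add: scaleR_right_diff_distrib[symmetric])
  also have "\<dots> \<le> K * pair_norm (v - w) / \<epsilon>"
    using g2_lip[of "(fst v, snd v + \<sigma> *\<^sub>R \<eta> \<omega> t)" "(fst w, snd w + \<sigma> *\<^sub>R \<eta> \<omega> t)"] pos
    by (intro divide_right_mono) (auto simp: pair_norm_def)
  finally show "norm (G2 \<omega> t v - G2 \<omega> t w) \<le> K2 * pair_norm (v - w)" by (simp add: K2_def)
qed

lemma pair_norm_lipschitz_continuous:
  fixes g :: "'a::real_normed_vector \<times> 'b::real_normed_vector \<Rightarrow> 'c::real_normed_vector"
  assumes "C \<ge> 0" "\<And>v w. norm (g v - g w) \<le> C * pair_norm (v - w)"
  shows "continuous_on UNIV g"
proof -
  have "(C * 2)-lipschitz_on UNIV g"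
  proof (rule lipschitz_onI)
    fix v w show "dist (g v) (g w) \<le> C * 2 * dist v w"
      using assms(2)[of v w] mult_left_mono[OF pair_norm_props(4)[of "v - w"] assms(1)]
        by (simp add: dist_norm)
  qed (use assms in simp)
  then show ?thesis by (rule lipschitz_on_continuous_on)
qed

lemma g_continuous: "continuous_on UNIV g1" "continuous_on UNIV g2"
  using pair_norm_lipschitz_continuous[OF _ g1_lip] pair_norm_lipschitz_continuous[OF _ g2_lip] pos
    by auto

lemma G_cadlag:
  assumes "tame \<omega>" "cadlag v" shows "cadlag (\<lambda>t. G1 \<omega> t (v t))" "cadlag (\<lambda>t. G2 \<omega> t (v t))"
proof -
  note e = eta_cadlag[OF assms(1)]
  show "cadlag (\<lambda>t. G1 \<omega> t (v t))" unfolding G1_def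
    by (rule cadlag_compose2[OF assms(2) e, of "\<lambda>v e. g1 (fst v, snd v + \<sigma> *\<^sub>R e)"])
      (auto simp: case_prod_beta intro!: continuous_intros continuous_on_compose2[OF
        g_continuous(1)])
  show "cadlag (\<lambda>t. G2 \<omega> t (v t))" unfolding G2_def
    by (rule cadlag_compose2[OF assms(2) e, of "\<lambda>v e. (1/\<epsilon>) *\<^sub>R g2 (fst v, snd v + \<sigma> *\<^sub>R e)"])
      (auto simp: case_prod_beta intro!: continuous_intros continuous_on_compose2[OF
        g_continuous(2)])
qed

lemma vfield_cadlag:
  assumes "tame \<omega>" "cadlag v" shows "cadlag (\<lambda>t. vfield \<omega> t (v t))"
  unfolding vfield_def
proof (intro cadlag_Pair cadlag_add G_cadlag assms)
  show "cadlag (\<lambda>t. S *v fst (v t))"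
    by (rule cadlag_compose[OF assms(2)])
      (intro continuous_intros bounded_linear.continuous_on[OF matrix_vector_mul_bounded_linear])
  show "cadlag (\<lambda>t. A2 *v snd (v t))"
    by (rule cadlag_compose[OF assms(2)])
      (intro continuous_intros bounded_linear.continuous_on[OF matrix_vector_mul_bounded_linear])
qed

lemma vfield_lipschitz: obtains L where "L \<ge> 0" "\<And>\<omega> t v w. norm (vfield \<omega> t v - vfield \<omega> t w)
    \<le> L * norm (v - w)"
proof -
  obtain B1 where B1: "B1 > 0" "\<And>x. norm (S *v x) \<le> norm x * B1"
    using bounded_linear.pos_bounded[OF matrix_vector_mul_bounded_linear[of S]] by blast
  obtain B2 where B2: "B2 > 0" "\<And>x. norm (A2 *v x) \<le> norm x * B2"
    using bounded_linear.pos_bounded[OF matrix_vector_mul_bounded_linear[of A2]] by blast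
  have "norm (vfield \<omega> t v - vfield \<omega> t w) \<le> ((B1 + K) * 2 + (B2 + K2) * 2) * norm (v - w)"
    for \<omega> t v w
  proof -
    have f: "norm (fst v - fst w) \<le> pair_norm (v - w)" "norm (snd v - snd w) \<le> pair_norm (v - w)"
      by (auto simp: pair_norm_def)
    have "norm (S *v (fst v - fst w) + (G1 \<omega> t v - G1 \<omega> t w)) \<le> pair_norm (v - w) * B1
        + K * pair_norm (v - w)"
      using B1 f by (intro order.trans[OF norm_triangle_ineq] add_mono G_lip order.trans[OF B1(2)]
        mult_right_mono) auto
    moreover have "norm (A2 *v (snd v - snd w) + (G2 \<omega> t v - G2 \<omega> t w)) \<le> pair_norm (v - w) * B2
        + K2 * pair_norm (v - w)"
      using B2 f by (intro order.trans[OF norm_triangle_ineq] add_mono G_lip order.trans[OF B2(2)]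
        mult_right_mono) auto
    moreover have "vfield \<omega> t v - vfield \<omega> t w = (S *v (fst v - fst w) + (G1 \<omega> t v - G1 \<omega> t w), A2
        *v (snd v - snd w) + (G2 \<omega> t v - G2 \<omega> t w))"
      by (simp add: vfield_def matrix_vector_mult_diff_distrib algebra_simps)
    ultimately have "norm (vfield \<omega> t v - vfield \<omega> t w) \<le> (B1 + K + (B2 + K2)) * pair_norm (v - w)"
      using norm_Pair_le[of "S *v (fst v - fst w) + (G1 \<omega> t v - G1 \<omega> t w)" "A2 *v (snd v - snd w)
          + (G2 \<omega> t v - G2 \<omega> t w)"]
      by (simp add: algebra_simps)
    also have "\<dots> \<le> (B1 + K + (B2 + K2)) * (2 * norm (v - w))"
      using B1 B2 pos rates by (intro mult_left_mono pair_norm_props) auto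
    finally show ?thesis by (simp add: algebra_simps)
  qed
  moreover have "(B1 + K) * 2 + (B2 + K2) * 2 \<ge> 0" using B1 B2 pos rates by auto
  ultimately show thesis using that by blast
qed

section \<open>Existence, uniqueness and shifts of solutions of the random equation\<close>

definition hat_solution :: "(real \<Rightarrow> real^'n2) \<Rightarrow> (real \<Rightarrow> (real^'n1) \<times> (real^'n2)) \<Rightarrow> bool" where
  "hat_solution \<omega> z \<longleftrightarrow> continuous_on UNIV z \<and> (\<forall>t. has_rderiv z (vfield \<omega> t (z t)) t)"

lemma hat_solution_iff_solves:
  assumes "tame \<omega>"
  shows "solves (vfield \<omega>) (\<lambda>_. 0) z0 z \<longleftrightarrow> z 0 = z0 \<and> hat_solution \<omega> z"
  using solves_iff[of "vfield \<omega>" "\<lambda>_. 0" z0 z] vfield_cadlag[OF assms]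
    by (simp add: hat_solution_def)

lemma hat_solution_components:
  assumes "hat_solution \<omega> z"
  shows "continuous_on UNIV (\<lambda>t. fst (z t))" "continuous_on UNIV (\<lambda>t. snd (z t))"
    "has_rderiv (\<lambda>t. fst (z t)) (S *v fst (z t) + G1 \<omega> t (z t)) t"
    "has_rderiv (\<lambda>t. snd (z t)) (A2 *v snd (z t) + G2 \<omega> t (z t)) t"
  using assms has_rderiv_fst[of z "vfield \<omega> t (z t)" t] has_rderiv_snd[of z "vfield \<omega> t (z t)" t]
  by (auto simp: hat_solution_def vfield_def intro!: continuous_intros)

lemma hat_solutionI:
  assumes "continuous_on UNIV x" "continuous_on UNIV y"
    and "\<And>t. has_rderiv x (S *v x t + G1 \<omega> t (x t, y t)) t" "\<And>t. has_rderiv y (A2 *v y t + G2 \<omega> t (x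
        t, y t)) t"
  shows "hat_solution \<omega> (\<lambda>t. (x t, y t))"
  unfolding hat_solution_def vfield_def
  using assms by (auto intro!: continuous_intros has_vector_derivative_Pair)

text \<open>Meant for a path that solves the equation only at negative times. Freezing the
  difference at its value 0 from time 0 on extends it to the whole axis, where the Gronwall argument
  applies.\<close>

lemma hat_solution_unique_backward:
  assumes u: "continuous_on {..0} u" "\<And>t. t < 0 \<Longrightarrow> has_rderiv u (vfield \<omega> t (u t)) t"
    and z: "hat_solution \<omega> z" and "u 0 = z 0" "t \<le> 0"
  shows "u t = z t"
proof -
  obtain L where L: "L \<ge> 0" "\<And>\<omega> t v w. norm (vfield \<omega> t v - vfield \<omega> t w) \<le> L * norm (v - w)"
    by (rule vfield_lipschitz) blast
  define d where "d t = u (min t 0) - z (min t 0)" for t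
  have zc: "continuous_on UNIV z" using z by (simp add: hat_solution_def)
  have "d t = 0"
  proof (rule rderiv_gronwall_zero[where d' = "\<lambda>t. if t < 0 then vfield \<omega> t (u t) - vfield \<omega> t (z t)
      else 0" and L = L])
    show "continuous_on UNIV d" unfolding d_def
      by (intro continuous_intros continuous_on_compose2[OF u(1)] continuous_on_compose2[OF zc])
        auto
    fix t :: real
    show "has_rderiv d (if t < 0 then vfield \<omega> t (u t) - vfield \<omega> t (z t) else 0) t"
    proof (cases "t < 0")
      case True
      have "has_rderiv (\<lambda>t. u t - z t) (vfield \<omega> t (u t) - vfield \<omega> t (z t)) t"
        using u(2)[OF True] z by (intro has_vector_derivative_diff) (auto simp: hat_solution_def)
      then have "has_rderiv d (vfield \<omega> t (u t) - vfield \<omega> t (z t)) t"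
        by (rule has_rderiv_cong[OF _ True]) (auto simp: d_def)
      then show ?thesis using True by simp
    next
      case False
      have "has_rderiv (\<lambda>_. 0) 0 t" by (rule has_vector_derivative_const)
      then have "has_rderiv d 0 t"
      proof (rule has_rderiv_cong[where u = "t + 1"])
        fix s assume "t \<le> s"
        then have "min s 0 = 0" using False by auto
        then show "d s = 0" using \<open>u 0 = z 0\<close> by (simp add: d_def)
      qed simp
      then show ?thesis using False by simp
    qed
    show "norm (if t < 0 then vfield \<omega> t (u t) - vfield \<omega> t (z t) else 0) \<le> L * norm (d t)"
      using L by (auto simp: d_def)
  qed (use L \<open>u 0 = z 0\<close> in \<open>auto simp: d_def\<close>)
  then show ?thesis using \<open>t \<le> 0\<close> by (simp add: d_def)
qed

lemma hat_solution_unique: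
  assumes "hat_solution \<omega> u" "hat_solution \<omega> z" "u 0 = z 0"
  shows "u = z"
proof
  fix t
  obtain L where L: "L \<ge> 0" "\<And>\<omega> t v w. norm (vfield \<omega> t v - vfield \<omega> t w) \<le> L * norm (v - w)"
    by (rule vfield_lipschitz) blast
  have "u t - z t = 0"
    by (rule rderiv_gronwall_zero[where d' = "\<lambda>t. vfield \<omega> t (u t) - vfield \<omega> t (z t)" and L = L])
      (use L assms in \<open>auto simp: hat_solution_def intro!: continuous_intros
        has_vector_derivative_diff\<close>)
  then show "u t = z t" by simp
qed

abbreviation "hat \<equiv> hat_flow S F g1 g2 \<sigma> \<alpha> \<epsilon>"

lemma hat_flow_eq: "hat \<omega> z0 = (THE z. solves (vfield \<omega>) (\<lambda>_. 0) z0 z)"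
proof -
  have "vfield \<omega> = (\<lambda>t (x, y).
          (S *v x + g1 (x, y + \<sigma> *\<^sub>R eta F \<alpha> \<epsilon> (path_shift t \<omega>)),
           (1/\<epsilon>) *\<^sub>R (F *v y) + (1/\<epsilon>) *\<^sub>R g2 (x, y + \<sigma> *\<^sub>R eta F \<alpha> \<epsilon> (path_shift t \<omega>))))"
    by (auto simp: fun_eq_iff vfield_def G1_def G2_def \<eta>_def A2_def scaleR_matrix_vector_assoc)
  then show ?thesis by (simp add: hat_flow_def)
qed

text \<open>Justifies the description operator in \<open>hat_flow\<close>, by global existence and
  by uniqueness.\<close>

lemma hat_flow_solution:
  assumes "tame \<omega>" shows "hat_solution \<omega> (hat \<omega> z0)" "hat \<omega> z0 0 = z0"
proof -
  obtain L where L: "L \<ge> 0" "\<And>\<omega> t v w. norm (vfield \<omega> t v - vfield \<omega> t w) \<le> L * norm (v - w)"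
    by (rule vfield_lipschitz) blast
  have "\<exists>z. z 0 = z0 \<and> continuous_on UNIV z \<and> (\<forall>t. has_rderiv z (vfield \<omega> t (z t)) t)"
    by (rule picard_global[of "vfield \<omega>" L z0, OF vfield_cadlag[OF assms cadlag_continuous] L(1)
      L(2)[of \<omega>]]) blast+
  then obtain z where z: "z 0 = z0" "continuous_on UNIV z" "\<And>t. has_rderiv z (vfield \<omega> t (z t)) t"
    by blast
  have "hat \<omega> z0 = z" unfolding hat_flow_eq
  proof (rule the_equality)
    show "solves (vfield \<omega>) (\<lambda>_. 0) z0 z" unfolding hat_solution_iff_solves[OF assms] using z
      by (simp add: hat_solution_def)
    show "y = z" if "solves (vfield \<omega>) (\<lambda>_. 0) z0 y" for y
      using that z unfolding hat_solution_iff_solves[OF assms]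
        by (intro hat_solution_unique[of \<omega>]) (auto simp: hat_solution_def)
  qed
  then show "hat_solution \<omega> (hat \<omega> z0)" "hat \<omega> z0 0 = z0" using z by (auto simp: hat_solution_def)
qed

lemma hat_flow_eqI: "tame \<omega> \<Longrightarrow> hat_solution \<omega> z \<Longrightarrow> hat \<omega> (z 0) = z"
  using hat_solution_unique hat_flow_solution by blast

text \<open>The cocycle property: time enters the equation only through the stationary process, and
  shifting the path shifts that process.\<close>

lemma hat_solution_shift:
  assumes "hat_solution \<omega> z" shows "hat_solution (path_shift s \<omega>) (\<lambda>t. z (t + s))"
proof -
  have "vfield (path_shift s \<omega>) t = vfield \<omega> (t + s)" for t
    by (simp add: fun_eq_iff vfield_def G1_def G2_def eta_shift)
  then show ?thesis
    using assms unfolding hat_solution_def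
    by (auto intro!: has_rderiv_shift continuous_on_compose2[of UNIV z] continuous_intros)
qed

section \<open>The slow manifold: bounds, uniqueness, existence and invariance\<close>

lemma C_minus_iff: "\<phi> \<in> C_minus (- \<gamma> / \<epsilon>) \<longleftrightarrow> continuous_on {..0} \<phi> \<and> (\<exists>D. \<forall>t\<le>0. pair_norm (\<phi> t)
    \<le> D * exp (b * t))"
proof -
  have e: "norm (exp (- (- \<gamma> / \<epsilon>) * t) *\<^sub>R x) \<le> M \<longleftrightarrow> norm x \<le> M * exp (b * t)" for t M
    and x :: "'z::real_normed_vector"
    using pos by (simp add: b_def exp_minus field_simps)
  show ?thesis
  proof
    assume "\<phi> \<in> C_minus (- \<gamma> / \<epsilon>)"
    then obtain M1 M2 where c: "continuous_on {..0} \<phi>"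
      and M: "\<And>t. t \<le> 0 \<Longrightarrow> norm (fst (\<phi> t)) \<le> M1 * exp (b * t)" "\<And>t. t \<le> 0 \<Longrightarrow> norm (snd (\<phi> t))
          \<le> M2 * exp (b * t)"
      unfolding C_minus_def bdd_above_def e[symmetric] by auto
    have "pair_norm (\<phi> t) \<le> (M1 + M2) * exp (b * t)" if "t \<le> 0" for t
      using M[OF that] by (simp add: pair_norm_def distrib_right)
    with c show "continuous_on {..0} \<phi> \<and> (\<exists>D. \<forall>t\<le>0. pair_norm (\<phi> t) \<le> D * exp (b * t))" by blast
  next
    assume "continuous_on {..0} \<phi> \<and> (\<exists>D. \<forall>t\<le>0. pair_norm (\<phi> t) \<le> D * exp (b * t))"
    then obtain D where c: "continuous_on {..0} \<phi>"
      and D: "\<And>t. t \<le> 0 \<Longrightarrow> pair_norm (\<phi> t) \<le> D * exp (b * t)" by blast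
    have M: "norm (fst (\<phi> t)) \<le> D * exp (b * t)" "norm (snd (\<phi> t)) \<le> D * exp (b * t)" if "t \<le> 0"
      for t
      using D[OF that] norm_ge_zero[of "fst (\<phi> t)"] norm_ge_zero[of "snd (\<phi> t)"]
        unfolding pair_norm_def by linarith+
    show "\<phi> \<in> C_minus (- \<gamma> / \<epsilon>)"
      unfolding C_minus_def using c M by (auto intro!: bdd_aboveI2[where M = D] simp: e[symmetric]
        simp del: norm_scaleR)
  qed
qed

text \<open>Since \<open>g1\<close> and \<open>g2\<close> vanish at the origin, the forcing along a
  path within the weight is itself within the weight. The noise is absorbed into \<open>C\<close>,
  which is possible only up to a finite time, here 0.\<close>

lemma forcing_bound:
  assumes "tame \<omega>"
  obtains C where "C \<ge> 0" "\<And>r v. r \<le> 0 \<Longrightarrow> pair_norm v \<le> M * exp (b * r) \<Longrightarrow>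
    norm (G1 \<omega> r v) \<le> K * ((M + C) * exp (b * r)) \<and> norm (G2 \<omega> r v) \<le> K2 * ((M + C) * exp (b * r))"
proof -
  obtain C where C: "C \<ge> 0" "\<forall>r\<le>0. norm (\<eta> \<omega> r) \<le> C * exp (b * r)" using eta_bound[OF assms, of 0]
    by blast
  show thesis
  proof (rule that[of "\<bar>\<sigma>\<bar> * C"])
    show "\<bar>\<sigma>\<bar> * C \<ge> 0" using C by simp
    fix r and v :: "(real^'n1) \<times> (real^'n2)" assume r: "r \<le> 0"
      and v: "pair_norm v \<le> M * exp (b * r)"
    have "pair_norm (fst v, snd v + \<sigma> *\<^sub>R \<eta> \<omega> r) \<le> pair_norm v + \<bar>\<sigma>\<bar> * norm (\<eta> \<omega> r)"
      unfolding pair_norm_def using norm_triangle_ineq[of "snd v" "\<sigma> *\<^sub>R \<eta> \<omega> r"] by simp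
    also have "\<dots> \<le> M * exp (b * r) + \<bar>\<sigma>\<bar> * (C * exp (b * r))"
      using C r v by (intro add_mono mult_left_mono) auto
    finally have *: "pair_norm (fst v, snd v + \<sigma> *\<^sub>R \<eta> \<omega> r) \<le> (M + \<bar>\<sigma>\<bar> * C) * exp (b * r)"
      by (simp add: algebra_simps)
    have 1: "norm (G1 \<omega> r v) \<le> K * pair_norm (fst v, snd v + \<sigma> *\<^sub>R \<eta> \<omega> r)"
      unfolding G1_def using g1_lip[of "(fst v, snd v + \<sigma> *\<^sub>R \<eta> \<omega> r)" 0] g_zero by simp
    have "norm (g2 (fst v, snd v + \<sigma> *\<^sub>R \<eta> \<omega> r)) \<le> K * pair_norm (fst v, snd v + \<sigma> *\<^sub>R \<eta> \<omega> r)"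
      using g2_lip[of "(fst v, snd v + \<sigma> *\<^sub>R \<eta> \<omega> r)" 0] g_zero by simp
    then have 2: "norm (G2 \<omega> r v) \<le> K2 * pair_norm (fst v, snd v + \<sigma> *\<^sub>R \<eta> \<omega> r)"
      unfolding G2_def using pos by (simp add: K2_def divide_right_mono)
    show "norm (G1 \<omega> r v) \<le> K * ((M + \<bar>\<sigma>\<bar> * C) * exp (b * r)) \<and> norm (G2 \<omega> r v)
        \<le> K2 * ((M + \<bar>\<sigma>\<bar> * C) * exp (b * r))"
      using order.trans[OF 1 mult_left_mono[OF *]] order.trans[OF 2 mult_left_mono[OF *]] pos rates
        by simp
  qed
qed

lemma slow_linear_backward:
  assumes "t \<le> 0" shows "norm (mexp S t x) \<le> norm x * exp (b * t)"
proof -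
  have "norm (mexp S t x) \<le> exp (\<gamma>s * t) * norm x" by (rule S_bound[OF assms])
  also have "\<dots> \<le> exp (b * t) * norm x"
    using assms rates pos by (intro mult_right_mono) (auto intro: mult_right_mono_neg)
  finally show ?thesis by (simp add: mult.commute)
qed

lemma mexp_rderiv: "has_rderiv (\<lambda>t. mexp A t x) (A *v mexp A t x) t"
  using mexp_has_vector_derivative[OF has_vector_derivative_const, of A x t "{t..}"]
    by (simp add: mexp_commute)

lemma contraction_bounds: "0 \<le> K / (\<gamma>s - b) + K2 / (b - a2)" "K / (\<gamma>s - b) + K2 / (b - a2) < 1"
proof -
  show "0 \<le> K / (\<gamma>s - b) + K2 / (b - a2)"
    using pos rates by (intro add_nonneg_nonneg divide_nonneg_pos) auto
  show "K / (\<gamma>s - b) + K2 / (b - a2) < 1" unfolding contraction_constant by (rule small)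
qed

lemma hat_solution_difference:
  assumes "hat_solution \<omega> u" "hat_solution \<omega> z"
  shows "has_rderiv (\<lambda>t. fst (u t - z t)) (S *v fst (u t - z t) + (G1 \<omega> t (u t) - G1 \<omega> t (z t))) t"
    "has_rderiv (\<lambda>t. snd (u t - z t)) (A2 *v snd (u t - z t) + (G2 \<omega> t (u t) - G2 \<omega> t (z t))) t"
    "continuous_on X (\<lambda>t. fst (u t - z t))" "continuous_on X (\<lambda>t. snd (u t - z t))"
proof -
  note cu = hat_solution_components[OF assms(1)] and cz = hat_solution_components[OF assms(2)]
  show "has_rderiv (\<lambda>t. fst (u t - z t)) (S *v fst (u t - z t) + (G1 \<omega> t (u t) - G1 \<omega> t (z t))) t"
    "has_rderiv (\<lambda>t. snd (u t - z t)) (A2 *v snd (u t - z t) + (G2 \<omega> t (u t) - G2 \<omega> t (z t))) t"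
    using has_vector_derivative_diff[OF cu(3)[of t] cz(3)[of t]] has_vector_derivative_diff[OF
      cu(4)[of t] cz(4)[of t]]
    by (simp_all add: matrix_vector_mult_diff_distrib algebra_simps)
  show "continuous_on X (\<lambda>t. fst (u t - z t))" "continuous_on X (\<lambda>t. snd (u t - z t))"
    unfolding fst_diff snd_diff
    by (intro continuous_intros continuous_on_subset[OF cu(1)] continuous_on_subset[OF cz(1)]
        continuous_on_subset[OF cu(2)] continuous_on_subset[OF cz(2)] subset_UNIV)+
qed

lemma G_difference_bound:
  assumes "pair_norm (u - z) \<le> D * x"
  shows "norm (G1 \<omega> r u - G1 \<omega> r z) \<le> K * D * x" "norm (G2 \<omega> r u - G2 \<omega> r z) \<le> K2 * D * x"
  using order.trans[OF G_lip(1) mult_left_mono[OF assms]] order.trans[OF G_lip(2) mult_left_mono[OF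
    assms]] pos rates
  by (simp_all add: mult.assoc)

text \<open>The slow difference vanishes at time 0, so solving it backwards from there leaves no
  boundary term; the fast difference is controlled from \<open>-\<infinity>\<close>. Each bound
  \<open>D\<close> then improves to \<open>\<kappa> * D\<close>.\<close>

lemma manifold_unique:
  assumes u: "hat_solution \<omega> u" "\<And>t. t \<le> 0 \<Longrightarrow> pair_norm (u t) \<le> Du * exp (b * t)"
    and z: "hat_solution \<omega> z" "\<And>t. t \<le> 0 \<Longrightarrow> pair_norm (z t) \<le> Dz * exp (b * t)"
    and x: "fst (u 0) = fst (z 0)"
  shows "u 0 = z 0"
proof -
  define d where "d t = u t - z t" for t
  define \<kappa> where "\<kappa> = K / (\<gamma>s - b) + K2 / (b - a2)"
  define Q where "Q D \<longleftrightarrow> D \<ge> 0 \<and> (\<forall>t\<le>0. pair_norm (d t) \<le> D * exp (b * t))" for D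
  note d1 = hat_solution_difference(1)[OF u(1) z(1), folded d_def]
    and d2 = hat_solution_difference(2)[OF u(1) z(1), folded d_def]
    and dc = hat_solution_difference(3,4)[OF u(1) z(1), folded d_def]
  have "Q (Du + Dz)"
    unfolding Q_def
  proof (intro conjI allI impI)
    show "pair_norm (d t) \<le> (Du + Dz) * exp (b * t)" if "t \<le> 0" for t
      using pair_norm_props(1)[of "u t" "- z t"] pair_norm_props(2)[of "z t"] u(2)[OF that] z(2)[OF
        that]
      by (simp add: d_def distrib_right)
    from this[of 0] show "Du + Dz \<ge> 0" using order.trans[OF pair_norm_props(5)] by fastforce
  qed
  moreover have "Q (0 + \<kappa> * D)" if "Q D" for D
  proof -
    have D: "D \<ge> 0" "\<And>t. t \<le> 0 \<Longrightarrow> pair_norm (d t) \<le> D * exp (b * t)" using that by (auto simp: Q_def)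
    have "pair_norm (d t) \<le> \<kappa> * D * exp (b * t)" if t: "t \<le> 0" for t
    proof -
      have "norm (fst (d t)) \<le> exp (\<gamma>s * (t - 0)) * norm (fst (d 0)) + (K * D) / (\<gamma>s - b) * exp (b *
          t)"
      proof (rule slow_finite_bound[OF S_bound rates(3) t _ dc(1) d1])
        show "norm (G1 \<omega> r (u r) - G1 \<omega> r (z r)) \<le> K * D * exp (b * r)" if "t \<le> r" "r < 0" for r
          using G_difference_bound(1)[OF D(2)[of r, unfolded d_def]] that by simp
      qed (use pos D in auto)
      moreover have "norm (snd (d t)) \<le> (K2 * D) / (b - a2) * exp (b * t)"
      proof (rule fast_bound[OF A2_bound rates(2) t _ dc(2) d2])
        show "norm (G2 \<omega> r (u r) - G2 \<omega> r (z r)) \<le> K2 * D * exp (b * r)" if "r < 0" for r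
          using G_difference_bound(2)[OF D(2)[of r, unfolded d_def]] that by simp
        show "norm (snd (d r)) \<le> D * exp (b * r)" if "r \<le> 0" for r
          using D(2)[OF that] norm_ge_zero[of "fst (d r)"] unfolding pair_norm_def by linarith
      qed (use rates D in auto)
      ultimately show ?thesis using x by (simp add: pair_norm_def \<kappa>_def d_def algebra_simps)
    qed
    moreover have "\<kappa> \<ge> 0" using pos rates by (auto simp: \<kappa>_def)
    ultimately show ?thesis using D by (simp add: Q_def)
  qed
  moreover have "0 \<le> \<kappa>" "\<kappa> < 1" unfolding \<kappa>_def by (rule contraction_bounds)+
  ultimately have "pair_norm (d 0) \<le> 0 / (1 - \<kappa>) * 1"
    by (intro affine_iterate[of \<kappa> Q "Du + Dz"]) (auto simp: Q_def)
  then have "pair_norm (d 0) \<le> 0" by simp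
  then have "norm (d 0) \<le> 0" using pair_norm_props(3)[of "d 0"] by linarith
  then show ?thesis by (simp add: d_def)
qed

text \<open>The free slow motion \<open>zs\<close> carries the prescribed initial value, and the
  correction \<open>v\<close> is a fixed point on the whole axis. Only its part at negative times
  has to solve the true equation.\<close>

lemma manifold_exists:
  assumes "tame \<omega>"
  obtains y0 D where "\<And>t. t \<le> 0 \<Longrightarrow> pair_norm (hat \<omega> (x0, y0) t) \<le> D * exp (b * t)"
proof -
  define zs :: "real \<Rightarrow> (real^'n1) \<times> (real^'n2)" where "zs t = (mexp S t x0, 0)" for t
  \<comment> \<open>cutting the forcing off at time \<open>0\<close> makes the slow component of the fixed point vanish from
    then on, so that it starts at \<open>x0\<close>\<close>
  define H1 where "H1 r v = (if r < 0 then G1 \<omega> r (zs r + v) else 0)" for r v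
  define H2 where "H2 r v = (if r < 0 then G2 \<omega> r (zs r + v) else 0)" for r v
  have zsc: "continuous_on UNIV zs" unfolding zs_def by (intro continuous_intros)
  have zsb: "pair_norm (zs t) \<le> norm x0 * exp (b * t)" if "t \<le> 0" for t
    using slow_linear_backward[OF that] by (simp add: zs_def pair_norm_def)
  obtain C where C: "C \<ge> 0" "\<And>r v. r \<le> 0 \<Longrightarrow> pair_norm v \<le> norm x0 * exp (b * r) \<Longrightarrow>
    norm (G1 \<omega> r v) \<le> K * ((norm x0 + C) * exp (b * r)) \<and> norm (G2 \<omega> r v) \<le> K2 * ((norm x0 + C) *
      exp (b * r))"
    by (rule forcing_bound[OF assms, of "norm x0"]) blast
  obtain v D where v: "continuous_on UNIV v" "\<And>t. pair_norm (v t) \<le> D * exp (b * t)"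
    "\<And>t. has_rderiv (\<lambda>t. fst (v t)) (S *v fst (v t) + H1 t (v t)) t"
    "\<And>t. has_rderiv (\<lambda>t. snd (v t)) (A2 *v snd (v t) + H2 t (v t)) t"
  proof (rule lyapunov_perron[of S \<gamma>s A2 a2 b K K2 H1 H2 "K * (norm x0 + C)" "K2 * (norm x0 + C)"])
    show "norm (H1 r v - H1 r w) \<le> K * pair_norm (v - w)" for r v w
      using G_lip(1)[of \<omega> r "zs r + v" "zs r + w"] pos pair_norm_props(5)[of "v - w"]
        by (simp add: H1_def)
    show "norm (H2 r v - H2 r w) \<le> K2 * pair_norm (v - w)" for r v w
      using G_lip(2)[of \<omega> r "zs r + v" "zs r + w"] rates pair_norm_props(5)[of "v - w"]
        by (simp add: H2_def)
    show "cadlag (\<lambda>r. H1 r (v r))" "cadlag (\<lambda>r. H2 r (v r))" if "continuous_on UNIV v" for v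
      unfolding H1_def H2_def
      by (intro cadlag_split G_cadlag assms cadlag_continuous[of "\<lambda>r. zs r + v r"] continuous_intros
        zsc that cadlag_const)+
    show "norm (H1 r 0) \<le> K * (norm x0 + C) * exp (b * r)" "norm (H2 r 0) \<le> K2 * (norm x0 + C) * exp
        (b * r)" for r
      using C(2)[OF _ zsb, of r] C(1) pos rates by (auto simp: H1_def H2_def mult.assoc)
  qed (use S_bound A2_bound rates pos small contraction_constant in auto)
  \<comment> \<open>From time 0 on the slow part solves the unforced equation and stays within the
    weight; since \<open>b < \<gamma>s\<close>, only the zero solution does.\<close>
  have v0: "fst (v 0) = 0"
  proof -
    have "norm (fst (v 0)) \<le> 0 / (\<gamma>s - b) * exp (b * 0)"
    proof (rule slow_bound[OF S_bound rates(3), where T = 0 and p = "\<lambda>_. 0"])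
      show "has_rderiv (\<lambda>t. fst (v t)) (S *v fst (v r) + 0) r" if "r \<ge> 0" for r
        using v(3)[of r] that by (simp add: H1_def)
      show "norm (fst (v r)) \<le> D * exp (b * r)" for r
        using v(2)[of r] norm_ge_zero[of "snd (v r)"] unfolding pair_norm_def by linarith
    qed (use v(1) in \<open>auto intro!: continuous_intros continuous_on_subset[OF v(1)]\<close>)
    then show ?thesis by simp
  qed
  define u where "u t = zs t + v t" for t
  have "hat \<omega> (u 0) t = u t" if "t \<le> 0" for t
  proof (rule hat_solution_unique_backward[symmetric, OF _ _ hat_flow_solution(1)[OF assms] _ that])
    show "continuous_on {..0} u" unfolding u_def
      by (rule continuous_on_subset[OF _ subset_UNIV]) (intro continuous_intros zsc v(1))
    show "u 0 = hat \<omega> (u 0) 0" using hat_flow_solution(2)[OF assms] by simp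
    fix t :: real assume "t < 0"
    have "has_rderiv (\<lambda>t. (mexp S t x0 + fst (v t), snd (v t)))
        (S *v mexp S t x0 + (S *v fst (v t) + H1 t (v t)), A2 *v snd (v t) + H2 t (v t)) t"
      by (intro has_vector_derivative_Pair has_vector_derivative_add mexp_rderiv v)
    moreover have "(\<lambda>t. (mexp S t x0 + fst (v t), snd (v t))) = u"
      by (auto simp: u_def zs_def prod_eq_iff)
    moreover have "(S *v mexp S t x0 + (S *v fst (v t) + H1 t (v t)), A2 *v snd (v t) + H2 t (v t))
        = vfield \<omega> t (u t)"
      using \<open>t < 0\<close> by (simp add: vfield_def u_def H1_def H2_def zs_def matrix_vector_right_distrib
        add.assoc)
    ultimately show "has_rderiv u (vfield \<omega> t (u t)) t" by simp
  qed
  moreover have "u 0 = (x0, snd (v 0))" using v0 by (simp add: u_def zs_def prod_eq_iff)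
  moreover have "pair_norm (u t) \<le> (norm x0 + D) * exp (b * t)" if "t \<le> 0" for t
    unfolding u_def using pair_norm_props(1)[of "zs t" "v t"] zsb[OF that] v(2)[of t]
      by (simp add: distrib_right)
  ultimately show thesis using that by metis
qed

abbreviation "hhat \<equiv> h_hat S F g1 g2 \<sigma> \<alpha> \<gamma> \<epsilon>"
abbreviation "hat_M \<equiv> hat_manifold S F g1 g2 \<sigma> \<alpha> \<gamma> \<epsilon>"

lemma hat_manifold_iff:
  assumes "tame \<omega>"
  shows "z0 \<in> hat_M \<omega> \<longleftrightarrow> (\<exists>D. \<forall>t\<le>0. pair_norm (hat \<omega> z0 t) \<le> D * exp (b * t))"
proof -
  have "continuous_on {..0} (hat \<omega> z0)"
    using hat_flow_solution(1)[OF assms, of z0] unfolding hat_solution_def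
      by (blast intro: continuous_on_subset)
  then show ?thesis unfolding hat_manifold_def mem_Collect_eq C_minus_iff by simp
qed

text \<open>Existence and uniqueness of the fast coordinate over each slow one make the manifold a
  graph, and thereby give the description operator in \<open>h_hat\<close> its meaning.\<close>

lemma mem_hat_manifold:
  assumes "tame \<omega>" shows "(x, y) \<in> hat_M \<omega> \<longleftrightarrow> y = hhat \<omega> x"
proof -
  have ex: "\<exists>y. (x, y) \<in> hat_M \<omega>" for x
    unfolding hat_manifold_iff[OF assms] using manifold_exists[OF assms, of x] by metis
  have un: "y = y'" if "(x, y) \<in> hat_M \<omega>" "(x, y') \<in> hat_M \<omega>" for x y y'
  proof -
    obtain D D' where "\<And>t. t \<le> 0 \<Longrightarrow> pair_norm (hat \<omega> (x, y) t) \<le> D * exp (b * t)"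
      "\<And>t. t \<le> 0 \<Longrightarrow> pair_norm (hat \<omega> (x, y') t) \<le> D' * exp (b * t)"
      using \<open>(x, y) \<in> hat_M \<omega>\<close> \<open>(x, y') \<in> hat_M \<omega>\<close> unfolding hat_manifold_iff[OF assms] by blast
    then have "hat \<omega> (x, y) 0 = hat \<omega> (x, y') 0"
      by (intro manifold_unique[OF hat_flow_solution(1)[OF assms] _ hat_flow_solution(1)[OF assms]])
        (auto simp: hat_flow_solution(2)[OF assms])
    then show ?thesis using hat_flow_solution(2)[OF assms] by simp
  qed
  obtain h where h: "\<And>x. (x, h x) \<in> hat_M \<omega>" using ex by metis
  have "hhat \<omega> = h" unfolding h_hat_def
  proof (rule the_equality)
    show "hat_M \<omega> = range (\<lambda>x. (x, h x))"
    proof (rule set_eqI)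
      fix p :: "(real^'n1) \<times> (real^'n2)"
      obtain x y where p: "p = (x, y)" using surj_pair[of p] by blast
      show "p \<in> hat_M \<omega> \<longleftrightarrow> p \<in> range (\<lambda>x. (x, h x))"
        unfolding p using h[of x] un[of x y "h x"] by auto
    qed
    show "h' = h" if "hat_M \<omega> = range (\<lambda>x. (x, h' x))" for h'
    proof
      fix x have "(x, h' x) \<in> hat_M \<omega>" using that by simp
      then show "h' x = h x" using un h by blast
    qed
  qed
  then show ?thesis using h un by blast
qed

text \<open>Invariance of the manifold. A shift into the future adds only a compact time interval to
  the past, where a constant bound suffices because \<open>exp (b * t)\<close> is at least 1 for
  \<open>t \<le> 0\<close>.\<close>

lemma mem_hat_manifold_shift:
  assumes "tame \<omega>" and z: "hat_solution \<omega> z" "\<And>t. t \<le> 0 \<Longrightarrow> pair_norm (z t) \<le> D * exp (b * t)"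
  shows "snd (z s) = hhat (path_shift s \<omega>) (fst (z s))"
proof -
  note ts = tame_shift[OF assms(1), of s]
  have eq: "hat (path_shift s \<omega>) (z s) = (\<lambda>t. z (t + s))"
    using hat_flow_eqI[OF ts hat_solution_shift[OF z(1)]] by simp
  have "\<exists>E. \<forall>t\<le>0. pair_norm (z (t + s)) \<le> E * exp (b * t)"
  proof -
    have "compact (z ` {0..max s 0})"
      using z(1) by (intro compact_continuous_image) (auto simp: hat_solution_def intro:
        continuous_on_subset)
    then obtain M where M: "\<And>t. t \<in> {0..max s 0} \<Longrightarrow> norm (z t) \<le> M"
      using compact_imp_bounded bounded_iff by (metis imageI)
    have "M \<ge> 0" using order.trans[OF norm_ge_zero M[of 0]] by simp
    have "D \<ge> 0" using order.trans[OF pair_norm_props(5) z(2)[of 0]] by simp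
    have "pair_norm (z (t + s)) \<le> (2 * M + D * exp (b * s)) * exp (b * t)" if "t \<le> 0" for t
    proof (cases "t + s \<le> 0")
      case True
      have "pair_norm (z (t + s)) \<le> D * exp (b * (t + s))" by (rule z(2)[OF True])
      also have "exp (b * (t + s)) = exp (b * s) * exp (b * t)" unfolding mult_exp_exp
        by (simp add: algebra_simps)
      also have "D * (exp (b * s) * exp (b * t)) \<le> (2 * M + D * exp (b * s)) * exp (b * t)"
        using \<open>M \<ge> 0\<close> by (simp add: algebra_simps)
      finally show ?thesis .
    next
      case False
      have "pair_norm (z (t + s)) \<le> 2 * M * 1"
        using pair_norm_props(4)[of "z (t + s)"] M[of "t + s"] False that by simp
      also have "\<dots> \<le> 2 * M * exp (b * t)"
        using \<open>M \<ge> 0\<close> rates that by (intro mult_left_mono) (auto simp: mult_nonpos_nonpos)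
      also have "\<dots> \<le> (2 * M + D * exp (b * s)) * exp (b * t)" using \<open>D \<ge> 0\<close> by simp
      finally show ?thesis .
    qed
    then show ?thesis by blast
  qed
  then have "z s \<in> hat_M (path_shift s \<omega>)" unfolding hat_manifold_iff[OF ts] eq .
  then show ?thesis using mem_hat_manifold[OF ts, of "fst (z s)" "snd (z s)"] by simp
qed

section \<open>Exponential tracking\<close>

text \<open>A single correction within the weight has to yield both conclusions. It does if the
  reference path is itself within the weight for \<open>t \<le> 0\<close> and differs from
  \<open>z\<close> by a term within the weight for \<open>t \<ge> 0\<close>.\<close>

lemma tracking_solution:
  assumes "tame \<omega>" and z: "hat_solution \<omega> z"
  obtains u D E where "hat_solution \<omega> u" "\<And>t. t \<le> 0 \<Longrightarrow> pair_norm (u t) \<le> D * exp (b * t)"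
    "\<And>t. t \<ge> 0 \<Longrightarrow> pair_norm (u t - z t) \<le> E * exp (b * t)"
proof -
  define x0 y0 where "x0 = fst (z 0)" and "y0 = snd (z 0)"
  note cz = hat_solution_components[OF z]
  \<comment> \<open>reference path: for \<open>t \<ge> 0\<close> the given solution without the free fast motion of its
    initial value, for \<open>t \<le> 0\<close> the free slow motion; it solves the linear equation with forcing
      \<open>r1\<close>, \<open>r2\<close>\<close>
  define xs where "xs t = fst (z (max t 0)) + mexp S (min t 0) x0 - x0" for t
  define ys where "ys t = snd (z (max t 0)) - mexp A2 (max t 0) y0" for t
  define r1 where "r1 t = (if t < 0 then 0 else G1 \<omega> t (z t))" for t
  define r2 where "r2 t = (if t < 0 then 0 else G2 \<omega> t (z t))" for t
  define H1 where "H1 r v = G1 \<omega> r ((xs r, ys r) + v) - r1 r" for r v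
  define H2 where "H2 r v = G2 \<omega> r ((xs r, ys r) + v) - r2 r" for r v
  have zc: "continuous_on UNIV z" using z by (simp add: hat_solution_def)
  have xsc: "continuous_on UNIV xs" unfolding xs_def
    by (intro continuous_intros continuous_on_compose2[OF cz(1)]) auto
  have ysc: "continuous_on UNIV ys" unfolding ys_def
    by (intro continuous_intros continuous_on_compose2[OF cz(2)]) auto
  have neg: "xs t = mexp S t x0" "ys t = 0" if "t \<le> 0" for t
    using that by (simp_all add: xs_def ys_def x0_def y0_def)
  have nonneg: "xs t = fst (z t)" "ys t = snd (z t) - mexp A2 t y0" if "t \<ge> 0" for t
    using that by (simp_all add: xs_def ys_def max_def min_def)
  have xsd: "has_rderiv xs (S *v xs t + r1 t) t" for t
  proof (cases "t < 0")
    case True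
    have "has_rderiv xs (S *v mexp S t x0) t"
      by (rule has_rderiv_cong[OF mexp_rderiv True]) (use neg in auto)
    then show ?thesis using True neg by (simp add: r1_def)
  next
    case False
    have "has_rderiv xs (S *v fst (z t) + G1 \<omega> t (z t)) t"
      by (rule has_rderiv_cong[OF cz(3), of _ "t + 1"]) (use nonneg False in auto)
    then show ?thesis using False nonneg by (simp add: r1_def)
  qed
  have ysd: "has_rderiv ys (A2 *v ys t + r2 t) t" for t
  proof (cases "t < 0")
    case True
    have "has_rderiv ys 0 t"
      by (rule has_rderiv_cong[OF has_vector_derivative_const True]) (use neg in auto)
    then show ?thesis using True neg by (simp add: r2_def)
  next
    case False
    have "has_rderiv ys (A2 *v snd (z t) + G2 \<omega> t (z t) - A2 *v mexp A2 t y0) t"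
      by (rule has_rderiv_cong[OF has_vector_derivative_diff[OF cz(4) mexp_rderiv], of _ "t + 1"])
        (use nonneg False in auto)
    moreover have "A2 *v ys t + r2 t = A2 *v snd (z t) + G2 \<omega> t (z t) - A2 *v mexp A2 t y0"
    proof -
      have "0 \<le> t" using False by simp
      show ?thesis unfolding nonneg(2)[OF \<open>0 \<le> t\<close>]
        using False by (simp add: r2_def matrix_vector_mult_diff_distrib)
    qed
    ultimately show ?thesis by (simp only:)
  qed
  have ysb: "norm (mexp A2 t y0) \<le> norm y0 * exp (b * t)" if "t \<ge> 0" for t
  proof -
    have "norm (mexp A2 t y0) \<le> exp (a2 * t) * norm y0" by (rule A2_bound[OF that])
    also have "\<dots> \<le> exp (b * t) * norm y0" using rates that
      by (intro mult_right_mono) (auto intro: mult_right_mono)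
    finally show ?thesis by (simp add: mult.commute)
  qed
  obtain C where C: "C \<ge> 0" "\<And>r v. r \<le> 0 \<Longrightarrow> pair_norm v \<le> norm x0 * exp (b * r) \<Longrightarrow>
    norm (G1 \<omega> r v) \<le> K * ((norm x0 + C) * exp (b * r)) \<and> norm (G2 \<omega> r v) \<le> K2 * ((norm x0 + C) *
      exp (b * r))"
    by (rule forcing_bound[OF assms(1), of "norm x0"]) blast
  \<comment> \<open>Before time 0 this is the forcing along the free slow motion. Afterwards the
    forcing of \<open>z\<close> is subtracted, and the reference path differs from \<open>z\<close>
    only by the decaying free fast motion of \<open>y0\<close>.\<close>
  have Hzero: "norm (H1 r 0) \<le> K * (norm x0 + C + norm y0) * exp (b * r) \<and> norm (H2 r 0)
      \<le> K2 * (norm x0 + C + norm y0) * exp (b * r)" for r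
  proof (cases "r < 0")
    case True
    then have "pair_norm (xs r, ys r) \<le> norm x0 * exp (b * r)"
      using slow_linear_backward[of r x0] neg by (simp add: pair_norm_def)
    from C(2)[OF _ this] True
    have "norm (H1 r 0) \<le> K * ((norm x0 + C) * exp (b * r))" "norm (H2 r 0) \<le> K2 * ((norm x0
        + C) * exp (b * r))"
      by (auto simp: H1_def H2_def r1_def r2_def)
    moreover have "(norm x0 + C) * exp (b * r) \<le> (norm x0 + C + norm y0) * exp (b * r)" by simp
    ultimately show ?thesis
      using pos rates by (auto simp: mult.assoc intro: order.trans[OF _ mult_left_mono])
  next
    case False
    then have "pair_norm ((xs r, ys r) - z r) \<le> norm y0 * exp (b * r)"
      using ysb[of r] nonneg by (simp add: pair_norm_def)
    also have "\<dots> \<le> (norm x0 + C + norm y0) * exp (b * r)" using C by simp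
    finally have *: "pair_norm ((xs r, ys r) - z r) \<le> (norm x0 + C + norm y0) * exp (b * r)" .
    have H: "norm (H1 r 0) \<le> K * pair_norm ((xs r, ys r) - z r)" "norm (H2 r 0)
        \<le> K2 * pair_norm ((xs r, ys r) - z r)"
      using False G_lip[of \<omega> r "(xs r, ys r)" "z r"] by (simp_all add: H1_def H2_def r1_def r2_def)
    show ?thesis using order.trans[OF H(1) mult_left_mono[OF *]] order.trans[OF H(2)
      mult_left_mono[OF *]] pos rates
      by (simp add: mult.assoc)
  qed
  have r12: "cadlag r1" "cadlag r2" unfolding r1_def r2_def
    by (intro cadlag_split cadlag_const G_cadlag assms cadlag_continuous[OF zc])+
  obtain v D where v: "continuous_on UNIV v" "\<And>t. pair_norm (v t) \<le> D * exp (b * t)"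
    "\<And>t. has_rderiv (\<lambda>t. fst (v t)) (S *v fst (v t) + H1 t (v t)) t"
    "\<And>t. has_rderiv (\<lambda>t. snd (v t)) (A2 *v snd (v t) + H2 t (v t)) t"
  proof (rule lyapunov_perron[of S \<gamma>s A2 a2 b K K2 H1 H2 "K * (norm x0 + C + norm y0)"
    "K2 * (norm x0 + C + norm y0)"])
    show "norm (H1 r v - H1 r w) \<le> K * pair_norm (v - w)" for r v w
      using G_lip(1)[of \<omega> r "(xs r, ys r) + v" "(xs r, ys r) + w"] by (simp add: H1_def)
    show "norm (H2 r v - H2 r w) \<le> K2 * pair_norm (v - w)" for r v w
      using G_lip(2)[of \<omega> r "(xs r, ys r) + v" "(xs r, ys r) + w"] by (simp add: H2_def)
    show "cadlag (\<lambda>r. H1 r (v r))" "cadlag (\<lambda>r. H2 r (v r))" if "continuous_on UNIV v" for v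
      unfolding H1_def H2_def
      by (intro cadlag_diff r12 G_cadlag assms cadlag_continuous[of "\<lambda>r. (xs r, ys r) + v r"]
        continuous_intros xsc ysc that)+
  qed (use S_bound A2_bound rates pos small contraction_constant Hzero in auto)
  define u where "u t = (xs t + fst (v t), ys t + snd (v t))" for t
  have u: "hat_solution \<omega> u" unfolding u_def
  proof (rule hat_solutionI)
    fix t
    have e: "(xs t + fst (v t), ys t + snd (v t)) = (xs t, ys t) + v t" by (simp add: prod_eq_iff)
    show "has_rderiv (\<lambda>t. xs t + fst (v t)) (S *v (xs t + fst (v t)) + G1 \<omega> t (xs t + fst (v t), ys
        t + snd (v t))) t"
      using has_vector_derivative_add[OF xsd[of t] v(3)[of t]]
      unfolding e H1_def by (simp add: matrix_vector_right_distrib algebra_simps)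
    show "has_rderiv (\<lambda>t. ys t + snd (v t)) (A2 *v (ys t + snd (v t)) + G2 \<omega> t (xs t + fst (v t), ys
        t + snd (v t))) t"
      using has_vector_derivative_add[OF ysd[of t] v(4)[of t]]
      unfolding e H2_def by (simp add: matrix_vector_right_distrib algebra_simps)
  qed (use xsc ysc v(1) in \<open>auto intro!: continuous_intros\<close>)
  show thesis
  proof (rule that[OF u])
    fix t :: real
    assume "t \<le> 0"
    then have "pair_norm (u t) \<le> norm (mexp S t x0) + pair_norm (v t)"
      using neg[of t] norm_triangle_ineq[of "mexp S t x0" "fst (v t)"]
        by (simp add: u_def pair_norm_def)
    then show "pair_norm (u t) \<le> (norm x0 + D) * exp (b * t)"
      using slow_linear_backward[OF \<open>t \<le> 0\<close>, of x0] v(2)[of t] by (simp add: distrib_right)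
  next
    fix t :: real
    assume "t \<ge> 0"
    have "u t - z t = (fst (v t), snd (v t) - mexp A2 t y0)"
      unfolding u_def nonneg[OF \<open>t \<ge> 0\<close>] by (simp add: prod_eq_iff)
    then have "pair_norm (u t - z t) \<le> norm (mexp A2 t y0) + pair_norm (v t)"
      using norm_triangle_ineq4[of "snd (v t)" "mexp A2 t y0"] by (simp add: pair_norm_def)
    then show "pair_norm (u t - z t) \<le> (norm y0 + D) * exp (b * t)"
      using ysb[OF \<open>t \<ge> 0\<close>] v(2)[of t] by (simp add: distrib_right)
  qed
qed

text \<open>The constant \<open>E\<close> is merely some finite bound; iteration replaces it by an
  explicit one. The slow difference is solved from \<open>+\<infinity>\<close> and brings no initial
  term, while the fast one contributes its initial value with decay \<open>a2 < b\<close>.\<close>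

lemma tracking_estimate:
  assumes u: "hat_solution \<omega> u" and z: "hat_solution \<omega> z"
    and E: "\<And>t. t \<ge> 0 \<Longrightarrow> pair_norm (u t - z t) \<le> E * exp (b * t)" and "t \<ge> 0"
  shows "pair_norm (u t - z t) \<le>
    norm (snd (u 0 - z 0)) / (1 - (\<epsilon> * K / (\<gamma> + \<epsilon> * \<gamma>s) - K / (\<gamma> + \<gamma>f))) * exp (b * t)"
proof -
  define d where "d t = u t - z t" for t
  define \<kappa> where "\<kappa> = K / (\<gamma>s - b) + K2 / (b - a2)"
  define Q where "Q D \<longleftrightarrow> D \<ge> 0 \<and> (\<forall>t\<ge>0. pair_norm (d t) \<le> D * exp (b * t))" for D
  note d1 = hat_solution_difference(1)[OF u z, folded d_def]
    and d2 = hat_solution_difference(2)[OF u z, folded d_def]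
    and dc = hat_solution_difference(3,4)[OF u z, folded d_def]
  have \<kappa>: "0 \<le> \<kappa>" "\<kappa> < 1" unfolding \<kappa>_def by (rule contraction_bounds)+
  have "pair_norm (d t) \<le> norm (snd (d 0)) / (1 - \<kappa>) * exp (b * t)"
  proof (rule affine_iterate[OF \<kappa>, of Q E])
    have "E \<ge> 0" using order.trans[OF pair_norm_props(5) E[of 0]] by simp
    then show "Q E" using E by (simp add: Q_def d_def)
    show "pair_norm (d t) \<le> D * exp (b * t)" if "Q D" for D using that \<open>t \<ge> 0\<close> by (simp add: Q_def)
    fix D assume "Q D"
    then have D: "D \<ge> 0" "\<And>t. t \<ge> 0 \<Longrightarrow> pair_norm (d t) \<le> D * exp (b * t)" by (auto simp: Q_def)
    have "pair_norm (d t) \<le> (norm (snd (d 0)) + \<kappa> * D) * exp (b * t)" if t: "t \<ge> 0" for t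
    proof -
      have "norm (fst (d t)) \<le> (K * D) / (\<gamma>s - b) * exp (b * t)"
      proof (rule slow_bound[OF S_bound rates(3) t _ dc(1) d1])
        show "norm (G1 \<omega> r (u r) - G1 \<omega> r (z r)) \<le> K * D * exp (b * r)" if "r \<ge> 0" for r
          using G_difference_bound(1)[OF D(2)[of r, unfolded d_def]] that by simp
        show "norm (fst (d r)) \<le> D * exp (b * r)" if "r \<ge> 0" for r
          using D(2)[OF that] norm_ge_zero[of "snd (d r)"] unfolding pair_norm_def by linarith
      qed (use pos D in auto)
      moreover have "norm (snd (d t)) \<le> exp (a2 * (t - 0)) * norm (snd (d 0)) + (K2 * D) / (b
          - a2) * exp (b * t)"
      proof (rule fast_forward_bound[OF A2_bound rates(2) t _ dc(2) d2])
        show "norm (G2 \<omega> r (u r) - G2 \<omega> r (z r)) \<le> K2 * D * exp (b * r)" if "0 \<le> r" "r < t" for r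
          using G_difference_bound(2)[OF D(2)[of r, unfolded d_def]] that by simp
      qed (use rates D in auto)
      moreover have "exp (a2 * (t - 0)) * norm (snd (d 0)) \<le> exp (b * t) * norm (snd (d 0))"
        using rates t by (intro mult_right_mono) (auto intro: mult_right_mono)
      ultimately show ?thesis by (simp add: pair_norm_def \<kappa>_def algebra_simps)
    qed
    then show "Q (norm (snd (d 0)) + \<kappa> * D)" using \<kappa> D by (simp add: Q_def)
  qed
  then show ?thesis unfolding d_def \<kappa>_def contraction_constant .
qed


text \<open>Removing the noise \<open>M\<close> and removing the stationary process differ by
  \<open>e\<close>, which is continuous and has a right derivative by \<open>eta_noise\<close>. The
  linear term in \<open>\<eta>\<close> that this produces is exactly the difference of the two
  right-hand sides.\<close>

lemma slow_fast_solution_iff: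
  assumes "tame \<omega>" "\<omega> 0 = 0"
  shows "slow_fast_solution S F g1 g2 \<sigma> \<alpha> \<epsilon> \<omega> z0 \<phi> \<longleftrightarrow>
    \<phi> 0 = z0 \<and> hat_solution \<omega> (\<lambda>t. \<phi> t - (0, \<sigma> *\<^sub>R \<eta> \<omega> t))"
proof -
  define f where "f v = (S *v fst v + g1 v, A2 *v snd v + (1/\<epsilon>) *\<^sub>R g2 v)" for v
  define M :: "real \<Rightarrow> (real^'n1) \<times> (real^'n2)" where "M t = (0, (\<sigma> * nc) *\<^sub>R \<omega> t)" for t
  define e :: "real \<Rightarrow> (real^'n1) \<times> (real^'n2)" where "e t = (0, \<sigma> *\<^sub>R (\<eta> \<omega> t - nc *\<^sub>R \<omega> t))" for t
  define z where "z t = \<phi> t - (0, \<sigma> *\<^sub>R \<eta> \<omega> t)" for t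
  have ze: "z = (\<lambda>t. (\<phi> t - M t) - e t)"
    by (auto simp: z_def M_def e_def prod_eq_iff fun_eq_iff scaleR_right_diff_distrib)
  have ec: "continuous_on UNIV e" unfolding e_def
    by (intro continuous_intros eta_noise(1)[OF assms(1)])
  have ed: "has_rderiv e (0, \<sigma> *\<^sub>R (A2 *v \<eta> \<omega> t)) t" for t unfolding e_def
    by (intro has_vector_derivative_Pair has_vector_derivative_const
        bounded_linear.has_vector_derivative[OF bounded_linear_scaleR_right] eta_noise(2)[OF
          assms(1)])
  have fz: "vfield \<omega> t (z t) = f (\<phi> t) - (0, \<sigma> *\<^sub>R (A2 *v \<eta> \<omega> t))" for t
    by (simp add: vfield_def G1_def G2_def f_def z_def matrix_vector_mult_diff_distrib
      matrix_vector_mult_scaleR)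
  have fcont: "continuous_on UNIV f" unfolding f_def
    by (intro continuous_intros g_continuous bounded_linear.continuous_on[OF
      matrix_vector_mul_bounded_linear])
  have cadM: "cadlag M" unfolding M_def
    using assms(1) by (auto simp: tame_def intro!: cadlag_Pair cadlag_compose[of \<omega>]
      continuous_intros)
  have "slow_fast_solution S F g1 g2 \<sigma> \<alpha> \<epsilon> \<omega> z0 \<phi> \<longleftrightarrow> solves (\<lambda>t. f) M z0 \<phi>"
  proof -
    have "(\<lambda>(x, y). (S *v x + g1 (x, y), (1/\<epsilon>) *\<^sub>R (F *v y) + (1/\<epsilon>) *\<^sub>R g2 (x, y))) = f"
      by (auto simp: f_def fun_eq_iff A2_def scaleR_matrix_vector_assoc)
    then show ?thesis unfolding slow_fast_solution_def M_def nc_def by simp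
  qed
  also have "\<dots> \<longleftrightarrow> \<phi> 0 = z0 \<and> continuous_on UNIV (\<lambda>t. \<phi> t - M t) \<and> (\<forall>t. has_rderiv (\<lambda>t.
      \<phi> t - M t) (f (\<phi> t)) t)"
    using solves_iff[of "\<lambda>t. f" M z0 \<phi>] cadlag_compose[OF _ fcont] cadM assms(2)
      by (simp add: M_def zero_prod_def[symmetric])
  also have "\<dots> \<longleftrightarrow> \<phi> 0 = z0 \<and> hat_solution \<omega> z"
  proof (rule conj_cong[OF refl])
    show "continuous_on UNIV (\<lambda>t. \<phi> t - M t) \<and> (\<forall>t. has_rderiv (\<lambda>t. \<phi> t - M t) (f (\<phi> t)) t)
        \<longleftrightarrow> hat_solution \<omega> z"
    proof
      assume *: "continuous_on UNIV (\<lambda>t. \<phi> t - M t) \<and> (\<forall>t. has_rderiv (\<lambda>t. \<phi> t - M t) (f (\<phi> t)) t)"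
      show "hat_solution \<omega> z" unfolding hat_solution_def fz unfolding ze
        using * ec ed by (auto intro!: continuous_intros has_vector_derivative_diff)
    next
      assume h: "hat_solution \<omega> z"
      have eq: "(\<lambda>t. \<phi> t - M t) = (\<lambda>t. z t + e t)" by (simp add: ze)
      have "has_rderiv (\<lambda>t. z t + e t) (f (\<phi> t)) t" for t
        using has_vector_derivative_add[OF _ ed, of z "vfield \<omega> t (z t)" t] h
          unfolding hat_solution_def fz by simp
      moreover have "continuous_on UNIV (\<lambda>t. z t + e t)"
        using h ec by (auto simp: hat_solution_def intro!: continuous_intros)
      ultimately show "continuous_on UNIV (\<lambda>t. \<phi> t - M t) \<and> (\<forall>t. has_rderiv (\<lambda>t.
          \<phi> t - M t) (f (\<phi> t)) t)"
        unfolding eq by blast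
    qed
  qed
  finally show ?thesis unfolding z_def .
qed

theorem pathwise_tracking:
  assumes "tame \<omega>" "\<omega> 0 = 0" and \<phi>: "slow_fast_solution S F g1 g2 \<sigma> \<alpha> \<epsilon> \<omega> z0 \<phi>"
  shows "\<exists>z1 \<psi>. z1 \<in> slow_manifold S F g1 g2 \<sigma> \<alpha> \<gamma> \<epsilon> \<omega> \<and>
    slow_fast_solution S F g1 g2 \<sigma> \<alpha> \<epsilon> \<omega> z1 \<psi> \<and>
    reduced_solution S F g1 g2 \<sigma> \<alpha> \<gamma> \<epsilon> \<omega> (fst z1) \<psi> \<and>
    (\<forall>t\<ge>0. norm (\<phi> t - \<psi> t) \<le>
      exp (- (\<gamma> / \<epsilon>) * t) / (1 - (\<epsilon> * K / (\<gamma> + \<epsilon> * \<gamma>s) - K / (\<gamma> + \<gamma>f))) * norm (z0 - z1))"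
proof -
  define c where "c = 1 - (\<epsilon> * K / (\<gamma> + \<epsilon> * \<gamma>s) - K / (\<gamma> + \<gamma>f))"
  have "c > 0" using small by (simp add: c_def)
  define z where "z t = \<phi> t - (0, \<sigma> *\<^sub>R \<eta> \<omega> t)" for t
  have z: "hat_solution \<omega> z" and \<phi>0: "\<phi> 0 = z0"
    using \<phi> unfolding slow_fast_solution_iff[OF assms(1,2)] z_def by auto
  obtain u D E where u: "hat_solution \<omega> u" "\<And>t. t \<le> 0 \<Longrightarrow> pair_norm (u t) \<le> D * exp (b * t)"
    "\<And>t. t \<ge> 0 \<Longrightarrow> pair_norm (u t - z t) \<le> E * exp (b * t)"
    by (rule tracking_solution[OF assms(1) z]) blast
  define \<psi> where "\<psi> t = u t + (0, \<sigma> *\<^sub>R \<eta> \<omega> t)" for t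
  have graph: "snd (\<psi> t) = h_slow S F g1 g2 \<sigma> \<alpha> \<gamma> \<epsilon> (path_shift t \<omega>) (fst (\<psi> t))" for t
    using mem_hat_manifold_shift[OF assms(1) u(1,2), of t] by (simp add: \<psi>_def h_slow_def \<eta>_def)
  \<comment> \<open>The shift by 0 subtracts \<open>\<omega> 0\<close>, so normalisation of the path
    is used here.\<close>
  have ps0: "path_shift 0 \<omega> = \<omega>" using assms(2) by (simp add: path_shift_def)
  have "\<psi> 0 \<in> slow_manifold S F g1 g2 \<sigma> \<alpha> \<gamma> \<epsilon> \<omega>"
    unfolding slow_manifold_def using graph[of 0] ps0 by (intro image_eqI[of _ _ "fst (\<psi> 0)"]) (auto
      simp: prod_eq_iff)
  moreover have "slow_fast_solution S F g1 g2 \<sigma> \<alpha> \<epsilon> \<omega> (\<psi> 0) \<psi>"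
    unfolding slow_fast_solution_iff[OF assms(1,2)] using u(1) by (simp add: \<psi>_def)
  moreover have "reduced_solution S F g1 g2 \<sigma> \<alpha> \<gamma> \<epsilon> \<omega> (fst (\<psi> 0)) \<psi>"
    unfolding reduced_solution_def
  proof (intro conjI allI graph)
    have uc: "continuous_on UNIV u" using u(1) by (simp add: hat_solution_def)
    let ?p = "\<lambda>t. S *v fst (\<psi> t) + g1 (fst (\<psi> t), h_slow S F g1 g2 \<sigma> \<alpha> \<gamma> \<epsilon> (path_shift t \<omega>) (fst (\<psi>
        t)))"
    have p: "?p = (\<lambda>t. S *v fst (u t) + G1 \<omega> t (u t))"
      unfolding graph[symmetric] by (simp add: \<psi>_def G1_def)
    have cad: "cadlag ?p" unfolding p
      by (intro cadlag_add G_cadlag assms cadlag_continuous[OF uc] cadlag_compose[OF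
        cadlag_continuous[OF uc]]
          continuous_intros bounded_linear.continuous_on[OF matrix_vector_mul_bounded_linear])
    have "has_rderiv (\<lambda>t. fst (\<psi> t)) (?p t) t" for t
      unfolding fun_cong[OF p, of t] using hat_solution_components(3)[OF u(1), of t]
        by (simp add: \<psi>_def)
    moreover have "continuous_on UNIV (\<lambda>t. fst (\<psi> t))"
      using hat_solution_components(1)[OF u(1)] by (simp add: \<psi>_def)
    ultimately have "\<forall>t. fst (\<psi> t) = fst (\<psi> 0) + (LBINT s=ereal 0..ereal t. ?p s)"
      using integral_eq_iff_rderiv[OF cad, of "\<lambda>t. fst (\<psi> t)" "fst (\<psi> 0)"] by blast
    then show "solves (\<lambda>t x. S *v x + g1 (x, h_slow S F g1 g2 \<sigma> \<alpha> \<gamma> \<epsilon> (path_shift t \<omega>) x)) (\<lambda>t.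
        0) (fst (\<psi> 0)) (\<lambda>t. fst (\<psi> t))"
      unfolding solves_def add_0_right using cadlag_interval_integrable[OF cad] by blast
  qed
  moreover have "norm (\<phi> t - \<psi> t) \<le> exp (- (\<gamma> / \<epsilon>) * t) / c * norm (z0 - \<psi> 0)" if "t \<ge> 0" for t
  proof -
    have d: "\<phi> t - \<psi> t = - (u t - z t)" for t by (simp add: \<psi>_def z_def)
    \<comment> \<open>Passage from the sum norm back to the Euclidean one costs nothing: on the
      right only the fast component occurs, which the Euclidean norm dominates, and on the left the
      sum norm is the larger one.\<close>
    have "norm (snd (u 0 - z 0)) \<le> norm (z0 - \<psi> 0)"
      unfolding \<phi>0[symmetric] d norm_minus_cancel
        using norm_snd_le[of "snd (u 0 - z 0)" "fst (u 0 - z 0)"] by (simp only: prod.collapse)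
    then have "norm (snd (u 0 - z 0)) / c * exp (b * t) \<le> norm (z0 - \<psi> 0) / c * exp (b * t)"
      using \<open>c > 0\<close> by (intro mult_right_mono divide_right_mono) auto
    moreover have "norm (\<phi> t - \<psi> t) \<le> pair_norm (u t - z t)"
      unfolding d norm_minus_cancel by (rule pair_norm_props)
    moreover have "pair_norm (u t - z t) \<le> norm (snd (u 0 - z 0)) / c * exp (b * t)"
      unfolding c_def by (rule tracking_estimate[OF u(1) z u(3) that])
    ultimately show ?thesis by (simp add: b_def mult.commute)
  qed
  ultimately show ?thesis unfolding c_def by blast
qed

end

section \<open>Maximal inequality and tails of stable Levy processes\<close>

text \<open>\<open>D k\<close> is the event that \<open>k\<close> is the first index where the
  partial sum exceeds \<open>u + v\<close>, and \<open>B k\<close> says that the remaining sum is at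
  most \<open>v\<close>. They are independent, their intersections are disjoint in \<open>k\<close>,
  and on each the full sum exceeds \<open>u\<close>.\<close>

lemma (in prob_space) ottaviani:
  fixes Y :: "nat \<Rightarrow> 'a \<Rightarrow> 'b::euclidean_space"
  assumes ind: "indep_vars (\<lambda>_. borel) Y {..<m}"
    and q: "\<And>k. k \<le> m \<Longrightarrow> q \<le> prob {\<omega>\<in>space M. norm (\<Sum>i\<in>{k..<m}. Y i \<omega>) \<le> v}" "q \<ge> 0"
  shows "q * prob {\<omega>\<in>space M. \<exists>k\<le>m. norm (\<Sum>i<k. Y i \<omega>) > u + v} \<le> prob {\<omega>\<in>space M. norm (\<Sum>i<m.
      Y i \<omega>) > u}"
proof -
  have Ym: "Y i \<in> borel_measurable M" if "i < m" for i using ind that by (auto simp: indep_vars_def)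
  have Sm: "(\<lambda>\<omega>. \<Sum>i<k. Y i \<omega>) \<in> borel_measurable M" if "k \<le> m" for k
    using that by (intro borel_measurable_sum Ym) auto
  have Tm: "(\<lambda>\<omega>. \<Sum>i\<in>{k..<m}. Y i \<omega>) \<in> borel_measurable M" for k
    by (intro borel_measurable_sum Ym) auto
  define D where "D k = {\<omega>\<in>space M. norm (\<Sum>i<k. Y i \<omega>) > u + v \<and> (\<forall>j<k. norm (\<Sum>i<j. Y i \<omega>)
      \<le> u + v)}" for k
  define B where "B k = {\<omega>\<in>space M. norm (\<Sum>i\<in>{k..<m}. Y i \<omega>) \<le> v}" for k
  have Dm: "D k \<in> sets M" if "k \<le> m" for k
  proof -
    have [measurable]: "(\<lambda>\<omega>. \<Sum>i<j. Y i \<omega>) \<in> borel_measurable M" if "j \<le> k" for j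
      using that \<open>k \<le> m\<close> by (intro Sm) simp
    have "{\<omega>\<in>space M. norm (\<Sum>i<k. Y i \<omega>) > u + v} \<in> sets M" by measurable
    moreover have "{\<omega>\<in>space M. \<forall>j\<in>{..<k}. norm (\<Sum>i<j. Y i \<omega>) \<le> u + v} \<in> sets M"
      by (intro sets.sets_Collect_finite_All) (auto intro!: borel_measurable_le
        borel_measurable_norm Sm that)
    ultimately have "{\<omega>\<in>space M. norm (\<Sum>i<k. Y i \<omega>) > u + v} \<inter> {\<omega>\<in>space M. \<forall>j\<in>{..<k}. norm (\<Sum>i<j.
        Y i \<omega>) \<le> u + v} \<in> sets M"
      by (rule sets.Int)
    moreover have "D k = {\<omega>\<in>space M. norm (\<Sum>i<k. Y i \<omega>) > u + v} \<inter> {\<omega>\<in>space M. \<forall>j\<in>{..<k}.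
        norm (\<Sum>i<j. Y i \<omega>) \<le> u + v}"
      by (auto simp: D_def)
    ultimately show ?thesis by (simp only:)
  qed
  have Bm: "B k \<in> sets M" for k unfolding B_def using Tm[of k] by measurable
  have indep: "prob (D k \<inter> B k) = prob (D k) * prob (B k)" if "k \<le> m" for k
  proof -
    let ?P = "PiM {..<k} (\<lambda>_. borel :: 'b measure)" and ?Q = "PiM {k..<m} (\<lambda>_. borel :: 'b measure)"
    let ?A = "{f\<in>space ?P. norm (\<Sum>i<k. f i) > u + v \<and> (\<forall>j\<in>{..<k}. norm (\<Sum>i<j. f i) \<le> u + v)}"
    let ?C = "{f\<in>space ?Q. norm (\<Sum>i\<in>{k..<m}. f i) \<le> v}"
    \<comment> \<open>\<open>D k\<close> depends on the variables below \<open>k\<close> only and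
      \<open>B k\<close> on those from \<open>k\<close> on, so grouping the family into two blocks
      gives the independence.\<close>
    have iv: "indep_var ?P (\<lambda>\<omega>. restrict (\<lambda>i. Y i \<omega>) {..<k}) ?Q (\<lambda>\<omega>. restrict (\<lambda>i. Y i \<omega>) {k..<m})"
      by (rule indep_var_restrict[OF ind]) (use that in auto)
    have sm: "(\<lambda>f. \<Sum>i<j. f i) \<in> borel_measurable ?P" if "j \<le> k" for j
      using that by (intro borel_measurable_sum measurable_component_singleton) auto
    have A: "?A \<in> sets ?P"
    proof -
      have "{f\<in>space ?P. norm (\<Sum>i<k. f i) > u + v} \<in> sets ?P" using sm[of k] by measurable
      moreover have "{f\<in>space ?P. \<forall>j\<in>{..<k}. norm (\<Sum>i<j. f i) \<le> u + v} \<in> sets ?P"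
        by (intro sets.sets_Collect_finite_All) (auto intro!: borel_measurable_le
          borel_measurable_norm sm)
      ultimately have "{f\<in>space ?P. norm (\<Sum>i<k. f i) > u + v} \<inter> {f\<in>space ?P. \<forall>j\<in>{..<k}. norm (\<Sum>i<j.
          f i) \<le> u + v} \<in> sets ?P"
        by (rule sets.Int)
      moreover have "?A = {f\<in>space ?P. norm (\<Sum>i<k. f i) > u + v} \<inter> {f\<in>space ?P. \<forall>j\<in>{..<k}.
          norm (\<Sum>i<j. f i) \<le> u + v}"
        by auto
      ultimately show ?thesis by (simp only:)
    qed
    have sq: "(\<lambda>f. \<Sum>i\<in>{k..<m}. f i) \<in> borel_measurable ?Q"
      by (intro borel_measurable_sum measurable_component_singleton)
    have C: "?C \<in> sets ?Q" using sq by measurable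
    have "D k = (\<lambda>\<omega>. restrict (\<lambda>i. Y i \<omega>) {..<k}) -` ?A \<inter> space M"
      by (auto simp: D_def space_PiM)
    moreover have "B k = (\<lambda>\<omega>. restrict (\<lambda>i. Y i \<omega>) {k..<m}) -` ?C \<inter> space M"
      by (auto simp: B_def space_PiM)
    moreover have "D k \<inter> B k = (\<lambda>\<omega>. (restrict (\<lambda>i. Y i \<omega>) {..<k}, restrict (\<lambda>i.
        Y i \<omega>) {k..<m})) -` (?A \<times> ?C) \<inter> space M"
      unfolding calculation by auto
    ultimately show ?thesis using indep_varD[OF iv A C] by simp
  qed
  have disj: "disjoint_family_on D {..m}" unfolding disjoint_family_on_def D_def
    by (auto simp: not_le[symmetric]) (metis linorder_neqE_nat not_le)
  have split: "(\<Sum>i<m. Y i \<omega>) = (\<Sum>i<k. Y i \<omega>) + (\<Sum>i\<in>{k..<m}. Y i \<omega>)" if "k \<le> m" for k \<omega>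
    using sum.union_disjoint[of "{..<k}" "{k..<m}" "\<lambda>i. Y i \<omega>"] that
      by (simp add: ivl_disj_un_one ivl_disj_int_one)
  have ev: "{\<omega>\<in>space M. \<exists>k\<le>m. norm (\<Sum>i<k. Y i \<omega>) > u + v} = (\<Union>k\<in>{..m}. D k)"
  proof (intro set_eqI iffI)
    fix \<omega> assume "\<omega> \<in> {\<omega>\<in>space M. \<exists>k\<le>m. norm (\<Sum>i<k. Y i \<omega>) > u + v}"
    then obtain k where k: "\<omega> \<in> space M" "k \<le> m" "norm (\<Sum>i<k. Y i \<omega>) > u + v" by blast
    define l where "l = (LEAST k. norm (\<Sum>i<k. Y i \<omega>) > u + v)"
    have "norm (\<Sum>i<l. Y i \<omega>) > u + v" unfolding l_def using k(3) by (rule LeastI)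
    moreover have "l \<le> m" using Least_le[of "\<lambda>k. norm (\<Sum>i<k. Y i \<omega>) > u + v" k] k
      by (simp add: l_def)
    moreover have "\<forall>j<l. norm (\<Sum>i<j. Y i \<omega>) \<le> u + v" unfolding l_def using not_less_Least
      by (meson not_le)
    ultimately show "\<omega> \<in> (\<Union>k\<in>{..m}. D k)" using k(1) by (auto simp: D_def)
  qed (auto simp: D_def)
  have "q * prob (\<Union>k\<in>{..m}. D k) = (\<Sum>k\<le>m. q * prob (D k))"
    using Dm disj by (subst finite_measure_finite_Union) (auto simp: sum_distrib_left)
  also have "\<dots> \<le> (\<Sum>k\<le>m. prob (D k \<inter> B k))"
  proof (rule sum_mono)
    fix k assume "k \<in> {..m}"
    then show "q * prob (D k) \<le> prob (D k \<inter> B k)"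
      using mult_right_mono[OF q(1)[of k], of "prob (D k)"] indep[of k]
        by (simp add: B_def mult.commute)
  qed
  also have "\<dots> = prob (\<Union>k\<in>{..m}. D k \<inter> B k)"
  proof (rule finite_measure_finite_Union[symmetric])
    show "disjoint_family_on (\<lambda>k. D k \<inter> B k) {..m}" using disj unfolding disjoint_family_on_def
      by blast
  qed (use Dm Bm in auto)
  also have "\<dots> \<le> prob {\<omega>\<in>space M. norm (\<Sum>i<m. Y i \<omega>) > u}"
  proof (rule finite_measure_mono)
    show "(\<Union>k\<in>{..m}. D k \<inter> B k) \<subseteq> {\<omega>\<in>space M. norm (\<Sum>i<m. Y i \<omega>) > u}"
    proof
      fix \<omega> assume "\<omega> \<in> (\<Union>k\<in>{..m}. D k \<inter> B k)"
      then obtain k where k: "k \<le> m" "\<omega> \<in> space M" "norm (\<Sum>i<k. Y i \<omega>) > u + v" "norm (\<Sum>i\<in>{k..<m}.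
          Y i \<omega>) \<le> v"
        by (auto simp: D_def B_def)
      have "norm (\<Sum>i<k. Y i \<omega>) \<le> norm (\<Sum>i<m. Y i \<omega>) + norm (\<Sum>i\<in>{k..<m}. Y i \<omega>)"
        using norm_triangle_ineq4[of "\<Sum>i<m. Y i \<omega>" "\<Sum>i\<in>{k..<m}. Y i \<omega>"] split[OF k(1), of \<omega>] by simp
      then show "\<omega> \<in> {\<omega>\<in>space M. norm (\<Sum>i<m. Y i \<omega>) > u}" using k by auto
    qed
    show "{\<omega>\<in>space M. norm (\<Sum>i<m. Y i \<omega>) > u} \<in> sets M" using Sm[of m] by measurable
  qed
  finally show ?thesis unfolding ev .
qed

section \<open>Tightness and maximal inequalities for Levy increments\<close>

locale levy_process = prob_space M for M :: "'w measure"
    and X :: "real \<Rightarrow> 'w \<Rightarrow> 'b::euclidean_space" +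
  assumes levy: "two_sided_levy_process M X"
begin

lemma X_measurable [measurable]: "X t \<in> borel_measurable M"
  using levy by (simp add: two_sided_levy_process_def)

lemma X_zero: "AE \<omega> in M. X 0 \<omega> = 0"
  using levy by (simp add: two_sided_levy_process_def)

lemma X_indep: "strict_mono_on {..k} \<tau> \<Longrightarrow> indep_vars (\<lambda>_. borel) (\<lambda>i \<omega>. X (\<tau> (Suc i)) \<omega> - X (\<tau> i) \<omega>)
    {..<k::nat}"
  using levy unfolding two_sided_levy_process_def by blast

lemma law_eq:
  assumes "distr M borel Y = distr M borel Z"
    and [measurable]: "Y \<in> borel_measurable M" "Z \<in> borel_measurable M"
    and [measurable]: "Measurable.pred borel Q"
  shows "prob {\<omega>\<in>space M. Q (Y \<omega> :: 'b)} = prob {\<omega>\<in>space M. Q (Z \<omega>)}"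
proof -
  have A: "{x\<in>space borel. Q x} \<in> sets borel" by measurable
  have "measure (distr M borel Y) {x\<in>space borel. Q x} = measure (distr M borel Z) {x\<in>space borel.
      Q x}"
    using assms(1) by simp
  then show ?thesis
    using A by (simp add: measure_distr vimage_def Int_def conj_commute)
qed

lemma increment_law:
  assumes "s < t" and "Measurable.pred borel Q"
  shows "prob {\<omega>\<in>space M. Q (X t \<omega> - X s \<omega>)} = prob {\<omega>\<in>space M. Q (X (t - s) \<omega>)}"
proof (rule law_eq)
  show "distr M borel (\<lambda>\<omega>. X t \<omega> - X s \<omega>) = distr M borel (X (t - s))"
    using levy \<open>s < t\<close> unfolding two_sided_levy_process_def by blast
qed (use assms in measurable)

lemma prob_tight:
  assumes [measurable]: "Y \<in> borel_measurable M" and "e > 0"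
  obtains a where "a \<ge> a0" "prob {\<omega>\<in>space M. norm (Y \<omega> :: 'b) > a} < e"
proof -
  have "(\<lambda>n. prob {\<omega>\<in>space M. norm (Y \<omega>) > real n}) \<longlonglongrightarrow> prob (\<Inter>n. {\<omega>\<in>space M. norm (Y \<omega>) > real n})"
    by (rule finite_Lim_measure_decseq) (auto simp: decseq_def)
  moreover have "(\<Inter>n. {\<omega>\<in>space M. norm (Y \<omega>) > real n}) = {}"
  proof -
    have "\<exists>n. norm (Y \<omega>) \<le> real n" for \<omega> by (rule real_arch_simple)
    then show ?thesis by (auto simp: set_eq_iff not_less)
  qed
  ultimately have "(\<lambda>n. prob {\<omega>\<in>space M. norm (Y \<omega>) > real n}) \<longlonglongrightarrow> 0" by simp
  then have "eventually (\<lambda>n. prob {\<omega>\<in>space M. norm (Y \<omega>) > real n} < e) sequentially"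
    using \<open>e > 0\<close> by (intro order_tendstoD(2)) auto
  moreover have "eventually (\<lambda>n. real n \<ge> a0) sequentially"
    using filterlim_real_sequentially by (simp add: filterlim_at_top)
  ultimately have "eventually (\<lambda>n. prob {\<omega>\<in>space M. norm (Y \<omega>) > real n} < e
      \<and> real n \<ge> a0) sequentially"
    by (rule eventually_conj)
  then obtain n where "prob {\<omega>\<in>space M. norm (Y \<omega>) > real n} < e" "real n \<ge> a0"
    unfolding eventually_sequentially by blast
  then show thesis using that by blast
qed

text \<open>By continuity in probability a tail bound at one time extends, with the level raised by
  1, to a neighbourhood of that time; compactness of the unit interval does the rest.\<close>

lemma unit_interval_tight:
  obtains v where "v \<ge> 0" "\<And>s. s \<in> {0..1} \<Longrightarrow> prob {\<omega>\<in>space M. norm (X s \<omega>) > v} \<le> 1/2"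
proof -
  have "\<exists>d>0. \<exists>v. \<forall>t\<in>ball s d. prob {\<omega>\<in>space M. norm (X t \<omega>) > v} \<le> 1/2" for s
  proof -
    have "((\<lambda>t. prob {\<omega>\<in>space M. norm (X t \<omega> - X s \<omega>) > 1}) \<longlongrightarrow> 0) (at s)"
      using levy unfolding two_sided_levy_process_def by (meson zero_less_one)
    then have "eventually (\<lambda>t. prob {\<omega>\<in>space M. norm (X t \<omega> - X s \<omega>) > 1} < 1/4) (at s)"
      by (rule order_tendstoD) simp
    then obtain d where d: "d > 0" "\<And>t. t \<noteq> s \<Longrightarrow> dist t s < d \<Longrightarrow> prob {\<omega>\<in>space M.
        norm (X t \<omega> - X s \<omega>) > 1} < 1/4"
      unfolding eventually_at by blast
    obtain a where a: "prob {\<omega>\<in>space M. norm (X s \<omega>) > a} < 1/4"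
      using prob_tight[OF X_measurable[of s], of "1/4" 0] by auto
    show ?thesis
    proof (rule exI[of _ d], intro conjI exI[of _ "a + 1"] ballI)
      fix t assume t: "t \<in> ball s d"
      have "{\<omega>\<in>space M. norm (X t \<omega>) > a + 1} \<subseteq> {\<omega>\<in>space M. norm (X t \<omega> - X s \<omega>) > 1} \<union> {\<omega>\<in>space M.
          norm (X s \<omega>) > a}"
      proof
        fix \<omega> assume "\<omega> \<in> {\<omega>\<in>space M. norm (X t \<omega>) > a + 1}"
        then show "\<omega> \<in> {\<omega>\<in>space M. norm (X t \<omega> - X s \<omega>) > 1} \<union> {\<omega>\<in>space M. norm (X s \<omega>) > a}"
          using norm_triangle_ineq[of "X t \<omega> - X s \<omega>" "X s \<omega>"] by auto
      qed
      then have "prob {\<omega>\<in>space M. norm (X t \<omega>) > a + 1}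
        \<le> prob ({\<omega>\<in>space M. norm (X t \<omega> - X s \<omega>) > 1} \<union> {\<omega>\<in>space M. norm (X s \<omega>) > a})"
        by (intro finite_measure_mono) measurable
      also have "\<dots> \<le> prob {\<omega>\<in>space M. norm (X t \<omega> - X s \<omega>) > 1} + prob {\<omega>\<in>space M.
          norm (X s \<omega>) > a}"
        by (intro measure_Un_le) measurable
      also have "\<dots> \<le> 1/4 + 1/4"
        using a d(2)[of t] t by (cases "t = s") (auto simp: dist_commute)
      finally show "prob {\<omega>\<in>space M. norm (X t \<omega>) > a + 1} \<le> 1/2" by simp
    qed (rule d)
  qed
  then obtain d v where d: "\<And>s. d s > 0" and v: "\<And>s t. t \<in> ball s (d s) \<Longrightarrow> prob {\<omega>\<in>space M.
      norm (X t \<omega>) > v s} \<le> 1/2"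
    by metis
  have "{0..1} \<subseteq> (\<Union>t\<in>{0..1}. ball t (d t))" using d by (meson UN_I centre_in_ball subsetI)
  from compactE_image[OF compact_Icc _ this]
  obtain T where T: "finite T" "{0..1} \<subseteq> (\<Union>t\<in>T. ball t (d t))" by (metis open_ball)
  show thesis
  proof (rule that[of "\<Sum>t\<in>T. \<bar>v t\<bar>"])
    fix s :: real assume "s \<in> {0..1}"
    then obtain t where t: "t \<in> T" "s \<in> ball t (d t)" using T by blast
    have "v t \<le> (\<Sum>t\<in>T. \<bar>v t\<bar>)" 
      using member_le_sum[of t T "\<lambda>t. \<bar>v t\<bar>"] t T(1) abs_ge_self[of "v t"] by simp
    then have "prob {\<omega>\<in>space M. norm (X s \<omega>) > (\<Sum>t\<in>T. \<bar>v t\<bar>)} \<le> prob {\<omega>\<in>space M.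
        norm (X s \<omega>) > v t}"
      by (intro finite_measure_mono) auto
    then show "prob {\<omega>\<in>space M. norm (X s \<omega>) > (\<Sum>t\<in>T. \<bar>v t\<bar>)} \<le> 1/2" using v[OF t(2)] by linarith
  qed (simp add: sum_nonneg)
qed

lemma telescope_increments: "(\<Sum>i\<in>{k..<m}. X (\<tau> (Suc i)) \<omega> - X (\<tau> i) \<omega>) = X (\<tau> m) \<omega> - X (\<tau> k) \<omega>"
    if "k \<le> m"
  using that by (rule sum_Suc_diff')

text \<open>On a fixed dyadic grid the maximal inequality applies with \<open>q = 1/2\<close>,
  whence the factor 2. The bound does not depend on the grid and the events increase under
  refinement, so it passes to their union.\<close>

lemma dyadic_maximal:
  assumes v: "v \<ge> 0" "\<And>s. s \<in> {0..1} \<Longrightarrow> prob {\<omega>\<in>space M. norm (X s \<omega>) > v} \<le> 1/2"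
  shows "prob {\<omega>\<in>space M. \<exists>N k. k \<le> (2::nat) ^ N \<and> norm (X (a + real k / 2 ^ N) \<omega> - X a \<omega>) > u + v}
    \<le> 2 * prob {\<omega>\<in>space M. norm (X 1 \<omega>) > u}"
proof -
  define E where "E N = {\<omega>\<in>space M. \<exists>k\<in>{..2 ^ N}. norm (X (a + real k / 2 ^ N) \<omega> - X a \<omega>) > u + v}"
    for N :: nat
  have Em: "E N \<in> sets M" for N unfolding E_def by measurable
  have bound: "prob (E N) \<le> 2 * prob {\<omega>\<in>space M. norm (X 1 \<omega>) > u}" for N
  proof -
    define m :: nat where "m = 2 ^ N"
    define \<tau> where "\<tau> k = a + real k / 2 ^ N" for k :: nat
    have m: "\<tau> m = a + 1" "\<tau> 0 = a" by (simp_all add: \<tau>_def m_def)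
    have sm: "strict_mono_on {..m} \<tau>"
      by (auto simp: strict_mono_on_def \<tau>_def divide_strict_right_mono)
    have q: "1/2 \<le> prob {\<omega>\<in>space M. norm (\<Sum>i\<in>{k..<m}. X (\<tau> (Suc i)) \<omega> - X (\<tau> i) \<omega>) \<le> v}" if "k \<le> m"
      for k
    proof (cases "k = m")
      case True
      then show ?thesis using v(1) prob_space by (simp add: telescope_increments)
    next
      case False
      then have "k < m" using that by simp
      have lt: "\<tau> k < \<tau> m" using \<open>k < m\<close> by (simp add: \<tau>_def divide_strict_right_mono)
      have k1: "\<tau> m - \<tau> k \<in> {0..1}" using \<open>k < m\<close> lt by (auto simp: \<tau>_def m_def field_simps)
      have "prob {\<omega>\<in>space M. norm (X (\<tau> m) \<omega> - X (\<tau> k) \<omega>) \<le> v} = prob {\<omega>\<in>space M.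
          norm (X (\<tau> m - \<tau> k) \<omega>) \<le> v}"
        using lt by (rule increment_law) measurable
      also have "\<dots> = 1 - prob {\<omega>\<in>space M. norm (X (\<tau> m - \<tau> k) \<omega>) > v}"
        by (subst prob_compl[symmetric]) (auto intro!: arg_cong[where f = prob])
      also have "\<dots> \<ge> 1/2" using v(2)[OF k1] by simp
      finally show ?thesis using that by (simp add: telescope_increments)
    qed
    have "1/2 * prob {\<omega>\<in>space M. \<exists>k\<le>m. norm (\<Sum>i<k. X (\<tau> (Suc i)) \<omega> - X (\<tau> i) \<omega>) > u + v}
      \<le> prob {\<omega>\<in>space M. norm (\<Sum>i<m. X (\<tau> (Suc i)) \<omega> - X (\<tau> i) \<omega>) > u}"
      by (rule ottaviani[OF X_indep[OF sm] q]) auto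
    moreover have "(\<Sum>i<k. X (\<tau> (Suc i)) \<omega> - X (\<tau> i) \<omega>) = X (\<tau> k) \<omega> - X a \<omega>" for k \<omega>
      using telescope_increments[of 0 k \<tau> \<omega>] m by (simp add: atLeast0LessThan)
    moreover have "E N = {\<omega>\<in>space M. \<exists>k\<le>m. norm (X (\<tau> k) \<omega> - X a \<omega>) > u + v}"
      by (auto simp: E_def \<tau>_def m_def)
    ultimately have "1/2 * prob (E N) \<le> prob {\<omega>\<in>space M. norm (X (a + 1) \<omega> - X a \<omega>) > u}"
      using m(1) by (simp only:)
    also have "\<dots> = prob {\<omega>\<in>space M. norm (X (a + 1 - a) \<omega>) > u}" by (rule increment_law) auto
    finally show ?thesis by simp
  qed
  have "incseq E"
  proof (rule incseq_SucI, rule subsetI)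
    fix N \<omega> assume "\<omega> \<in> E N"
    then obtain k where k: "\<omega> \<in> space M" "k \<le> 2 ^ N" "norm (X (a + real k / 2 ^ N) \<omega> - X a \<omega>) > u
        + v"
      by (auto simp: E_def)
    have "real (2 * k) / 2 ^ Suc N = real k / 2 ^ N" by simp
    then show "\<omega> \<in> E (Suc N)" unfolding E_def using k by (auto intro!: bexI[of _ "2 * k"])
  qed
  then have "(\<lambda>N. prob (E N)) \<longlonglongrightarrow> prob (\<Union>N. E N)" using Em by (intro finite_Lim_measure_incseq) auto
  then have "prob (\<Union>N. E N) \<le> 2 * prob {\<omega>\<in>space M. norm (X 1 \<omega>) > u}"
    by (rule tendsto_upperbound) (use bound in auto)
  moreover have "(\<Union>N. E N) = {\<omega>\<in>space M. \<exists>N k. k \<le> (2::nat) ^ N \<and> norm (X (a + real k / 2 ^ N) \<omega>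
      - X a \<omega>) > u + v}"
    by (auto simp: E_def)
  ultimately show ?thesis by simp
qed

end

lemma norm_diff_add_le:
  fixes x y z :: "'a::real_normed_vector"
  shows "norm (x - y + z) \<le> norm x + norm y + norm z"
  using norm_triangle_ineq[of "x - y" z] norm_triangle_ineq4[of x y] by simp

context levy_process begin

text \<open>The centring constants \<open>c k\<close> of \<open>X k\<close> are not additive, but tightness forces
  \<open>c l - c k - c (l - k)\<close> to be of order \<open>m\<close> for \<open>k \<le> l \<le> m\<close>. The maximal inequality
    for the centred sums
  then bounds the largest of \<open>m\<close> independent copies of \<open>X 1\<close>, which must therefore exceed a multiple
  of \<open>m\<close> with probability at most \<open>1/m\<close>.\<close>

lemma stable_tail:
  assumes stable: "\<And>a. a > 0 \<Longrightarrow> \<exists>c. distr M borel (X a) = distr M borel (\<lambda>\<omega>. a powr \<beta> *\<^sub>R X 1 \<omega> + c)"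
    and \<beta>: "\<beta> \<le> 1"
  obtains C where "C > 0" "\<And>u. u > 0 \<Longrightarrow> prob {\<omega>\<in>space M. norm (X 1 \<omega>) > u} \<le> C / u"
proof -
  obtain c' where c': "\<And>a. a > 0 \<Longrightarrow> distr M borel (X a) = distr M borel (\<lambda>\<omega>. a powr \<beta> *\<^sub>R X 1 \<omega>
      + c' a)"
    using stable by metis
  \<comment> \<open>The scaling relation covers positive times only; at 0 the right centring is 0
    because \<open>X 0\<close> vanishes almost surely.\<close>
  define c where "c k = (if k = 0 then 0 else c' (real k))" for k :: nat
  obtain a where a: "a \<ge> max 1 (norm (c 1))" "prob {\<omega>\<in>space M. norm (X 1 \<omega>) > a} < 1/10"
    by (rule prob_tight[OF X_measurable[of 1], of "1/10" "max 1 (norm (c 1))"]) auto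
  define T where "T = (\<lambda>u. prob {\<omega>\<in>space M. norm (X 1 \<omega>) > u})"
  have center: "prob {\<omega>\<in>space M. norm (X (real k) \<omega> - c k) > real m * a} \<le> 1/10" if "k \<le> m" for k m
  proof (cases "k = 0")
    case True
    have "prob {\<omega>\<in>space M. norm (X (real k) \<omega> - c k) > real m * a} = prob {}"
    proof (rule finite_measure_eq_AE)
      show "AE x in M. (x \<in> {\<omega>\<in>space M. norm (X (real k) \<omega> - c k) > real m * a}) = (x \<in> {})"
        using X_zero
      proof eventually_elim
        case (elim \<omega>)
        then show ?case using a(1) by (auto simp: True c_def not_less)
      qed
    qed measurable
    then show ?thesis by simp
  next
    case False
    have "prob {\<omega>\<in>space M. norm (X (real k) \<omega> - c k) > real m * a} =
      prob {\<omega>\<in>space M. norm ((real k powr \<beta> *\<^sub>R X 1 \<omega> + c k) - c k) > real m * a}"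
      by (rule law_eq) (use c'[of "real k"] False in \<open>auto simp: c_def\<close>)
    also have "\<dots> \<le> prob {\<omega>\<in>space M. norm (X 1 \<omega>) > a}"
    proof (rule finite_measure_mono)
      \<comment> \<open>Here \<open>\<beta> \<le> 1\<close> enters: the centred \<open>X k\<close>
        spreads at most linearly in \<open>k\<close>, so the single level \<open>real m * a\<close>
        serves for all \<open>k \<le> m\<close>.\<close>
      have "real k powr \<beta> \<le> real k powr 1" using False \<beta> by (intro powr_mono) auto
      then have km: "real k powr \<beta> \<le> real m" using False that by simp
      show "{\<omega>\<in>space M. norm ((real k powr \<beta> *\<^sub>R X 1 \<omega> + c k) - c k) > real m * a} \<subseteq> {\<omega>\<in>space M.
          norm (X 1 \<omega>) > a}"
      proof
        fix \<omega> assume "\<omega> \<in> {\<omega>\<in>space M. norm ((real k powr \<beta> *\<^sub>R X 1 \<omega> + c k) - c k) > real m * a}"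
        then have *: "\<omega> \<in> space M" "real m * a < real k powr \<beta> * norm (X 1 \<omega>)" by auto
        note *(2)
        also have "real k powr \<beta> * norm (X 1 \<omega>) \<le> real m * norm (X 1 \<omega>)" using km
          by (intro mult_right_mono) auto
        finally have "real m * a < real m * norm (X 1 \<omega>)" .
        then show "\<omega> \<in> {\<omega>\<in>space M. norm (X 1 \<omega>) > a}"
          using *(1) mult_less_cancel_left_pos[of "real m"] False that by auto
      qed
    qed measurable
    also have "\<dots> \<le> 1/10" using a by simp
    finally show ?thesis .
  qed
  have center_inc: "prob {\<omega>\<in>space M. norm (X (real l) \<omega> - X (real k) \<omega> - c (l - k)) > real m * a}
      \<le> 1/10"
    if "k \<le> l" "l \<le> m" for k l m
  proof (cases "k = l")
    case True
    have "(real m * a < 0) = False" using a(1) by (simp add: not_less)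
    then show ?thesis using True by (simp add: c_def)
  next
    case False
    have "prob {\<omega>\<in>space M. norm (X (real l) \<omega> - X (real k) \<omega> - c (l - k)) > real m * a} =
      prob {\<omega>\<in>space M. norm (X (real l - real k) \<omega> - c (l - k)) > real m * a}"
      by (rule increment_law) (use that False in auto)
    also have "\<dots> \<le> 1/10" using center[of "l - k" m] that by (simp add: of_nat_diff)
    finally show ?thesis .
  qed
  \<comment> \<open>The claim is deterministic: if it failed, three events of probability at most
    1/10 each would cover the whole space.\<close>
  have drift: "norm (c l - c k - c (l - k)) \<le> 3 * (real m * a)" if "k \<le> l" "l \<le> m" for k l m
  proof (rule ccontr)
    assume neg: "\<not> ?thesis"
    let ?E1 = "{\<omega>\<in>space M. norm (X (real l) \<omega> - c l) > real m * a}"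
    let ?E2 = "{\<omega>\<in>space M. norm (X (real k) \<omega> - c k) > real m * a}"
    let ?E3 = "{\<omega>\<in>space M. norm (X (real l) \<omega> - X (real k) \<omega> - c (l - k)) > real m * a}"
    have "space M \<subseteq> ?E1 \<union> ?E2 \<union> ?E3"
    proof
      fix \<omega> assume \<omega>: "\<omega> \<in> space M"
      have "c l - c k - c (l - k) = (X (real l) \<omega> - X (real k) \<omega> - c (l - k)) - (X (real l) \<omega> - c l)
          + (X (real k) \<omega> - c k)"
        by simp
      then have "norm (c l - c k - c (l - k)) \<le> norm (X (real l) \<omega> - X (real k) \<omega> - c (l - k))
          + norm (X (real l) \<omega> - c l) + norm (X (real k) \<omega> - c k)"
        by (simp only: norm_diff_add_le)
      then show "\<omega> \<in> ?E1 \<union> ?E2 \<union> ?E3" using neg \<omega> by (auto simp: not_le not_less)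
    qed
    then have "prob (space M) \<le> prob (?E1 \<union> ?E2 \<union> ?E3)" by (intro finite_measure_mono) measurable
    also have "\<dots> \<le> prob (?E1 \<union> ?E2) + prob ?E3" by (intro measure_Un_le) measurable
    also have "prob (?E1 \<union> ?E2) \<le> prob ?E1 + prob ?E2" by (intro measure_Un_le) measurable
    finally show False
      using center[of l m] center[of k m] center_inc[OF that] that prob_space by simp
  qed
  have mT: "real m * T (14 * (real m * a)) \<le> 1" if "m \<ge> 1" for m :: nat
  proof -
    define \<rho> where "\<rho> = real m * a"
    have "\<rho> > 0" using that a(1) by (auto simp: \<rho>_def)
    define \<xi> where "\<xi> i \<omega> = X (real (Suc i)) \<omega> - X (real i) \<omega>" for i \<omega>
    define Y where "Y i \<omega> = \<xi> i \<omega> - (c (Suc i) - c i)" for i \<omega>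
    have \<xi>_measurable: "\<xi> i \<in> borel_measurable M" for i unfolding \<xi>_def by measurable
    have \<xi>_indep: "indep_vars (\<lambda>_. borel) \<xi> {..<m}"
      unfolding \<xi>_def by (rule X_indep) (auto simp: strict_mono_on_def)
    then have Y_indep: "indep_vars (\<lambda>_. borel) Y {..<m}"
      unfolding Y_def by (rule indep_vars_compose2) auto
    have Ysum: "(\<Sum>i\<in>{k..<l}. Y i \<omega>) = X (real l) \<omega> - X (real k) \<omega> - (c l - c k)" if "k \<le> l"
      for k l \<omega>
      unfolding Y_def \<xi>_def sum_subtractf[of "\<lambda>i. X (real (Suc i)) \<omega> - X (real i) \<omega>"]
        telescope_increments[OF that] sum_Suc_diff'[OF that] ..
    have Ysum0: "(\<Sum>i<l. Y i \<omega>) = X (real l) \<omega> - X 0 \<omega> - c l" for l \<omega>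
      using Ysum[of 0 l \<omega>] by (simp add: atLeast0LessThan c_def)
    \<comment> \<open>The level \<open>4 * \<rho>\<close> is \<open>\<rho>\<close> for the centred
      increment plus \<open>3 * \<rho>\<close> for the drift defect of the centring
      constants.\<close>
    have q: "9/10 \<le> prob {\<omega>\<in>space M. norm (\<Sum>i\<in>{k..<m}. Y i \<omega>) \<le> 4 * \<rho>}" if "k \<le> m" for k
    proof -
      have "prob {\<omega>\<in>space M. norm (\<Sum>i\<in>{k..<m}. Y i \<omega>) > 4 * \<rho>}
        \<le> prob {\<omega>\<in>space M. norm (X (real m) \<omega> - X (real k) \<omega> - c (m - k)) > \<rho>}"
      proof (rule finite_measure_mono)
        show "{\<omega>\<in>space M. norm (\<Sum>i\<in>{k..<m}. Y i \<omega>) > 4 * \<rho>} \<subseteq> {\<omega>\<in>space M. norm (X (real m) \<omega>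
            - X (real k) \<omega> - c (m - k)) > \<rho>}"
        proof
          fix \<omega> assume \<omega>: "\<omega> \<in> {\<omega>\<in>space M. norm (\<Sum>i\<in>{k..<m}. Y i \<omega>) > 4 * \<rho>}"
          have "(\<Sum>i\<in>{k..<m}. Y i \<omega>) = (X (real m) \<omega> - X (real k) \<omega> - c (m - k)) - (c m - c k - c (m
              - k))"
            using Ysum[OF that] by simp
          then have "norm (\<Sum>i\<in>{k..<m}. Y i \<omega>) \<le> norm (X (real m) \<omega> - X (real k) \<omega> - c (m - k))
              + norm (c m - c k - c (m - k))"
            by (metis norm_triangle_ineq4)
          then show "\<omega> \<in> {\<omega>\<in>space M. norm (X (real m) \<omega> - X (real k) \<omega> - c (m - k)) > \<rho>}"
            using \<omega> drift[OF that order.refl] by (simp add: \<rho>_def)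
        qed
      qed measurable
      also have "\<dots> \<le> 1/10" unfolding \<rho>_def by (rule center_inc[OF that order.refl])
      finally have "prob {\<omega>\<in>space M. norm (\<Sum>i\<in>{k..<m}. Y i \<omega>) > 4 * \<rho>} \<le> 1/10" .
      moreover have "prob {\<omega>\<in>space M. norm (\<Sum>i\<in>{k..<m}. Y i \<omega>) \<le> 4 * \<rho>} = 1 - prob {\<omega>\<in>space M.
          norm (\<Sum>i\<in>{k..<m}. Y i \<omega>) > 4 * \<rho>}"
        unfolding Ysum[OF that] by (subst prob_compl[symmetric]) (auto intro!: arg_cong[where f =
          prob])
      ultimately show ?thesis by simp
    qed
    have "9/10 * prob {\<omega>\<in>space M. \<exists>k\<le>m. norm (\<Sum>i<k. Y i \<omega>) > \<rho> + 4 * \<rho>} \<le> prob {\<omega>\<in>space M.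
        norm (\<Sum>i<m. Y i \<omega>) > \<rho>}"
      by (rule ottaviani[OF Y_indep q]) auto
    also have "\<dots> \<le> 1/10"
      unfolding Ysum0 using center_inc[of 0 m m] by (simp add: \<rho>_def)
    finally have max: "prob {\<omega>\<in>space M. \<exists>k\<le>m. norm (\<Sum>i<k. Y i \<omega>) > 5 * \<rho>} \<le> 1/9" by simp
    have cdiff: "norm (c (Suc i) - c i) \<le> 4 * \<rho>" if "i < m" for i
    proof -
      have "norm (c (Suc i) - c i - c (Suc i - i)) \<le> 3 * (real m * a)" using that
        by (intro drift) auto
      moreover have "norm (c (Suc i) - c i) \<le> norm (c (Suc i) - c i - c 1) + norm (c 1)"
        by (metis diff_add_cancel norm_triangle_ineq)
      moreover have "norm (c 1) \<le> \<rho>"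
      proof -
        have "norm (c 1) \<le> 1 * a" using a(1) by simp
        also have "\<dots> \<le> real m * a" using \<open>m \<ge> 1\<close> a(1) by (intro mult_right_mono) auto
        finally show ?thesis by (simp add: \<rho>_def)
      qed
      ultimately show ?thesis by (simp add: \<rho>_def)
    qed
    define p where "p = T (14 * \<rho>)"
    have p: "0 \<le> p" "p \<le> 1" by (simp_all add: p_def T_def)
    have one: "prob (\<xi> i -` {x. norm x \<le> 14 * \<rho>} \<inter> space M) = 1 - p" for i
    proof -
      have "prob (\<xi> i -` {x. norm x \<le> 14 * \<rho>} \<inter> space M) = prob {\<omega>\<in>space M. norm (X (real (Suc i)) \<omega>
          - X (real i) \<omega>) \<le> 14 * \<rho>}"
        by (auto intro!: arg_cong[where f = prob] simp: \<xi>_def)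
      also have "\<dots> = prob {\<omega>\<in>space M. norm (X (real (Suc i) - real i) \<omega>) \<le> 14 * \<rho>}"
        by (rule increment_law) auto
      also have "\<dots> = prob {\<omega>\<in>space M. norm (X 1 \<omega>) \<le> 14 * \<rho>}" by simp
      also have "\<dots> = 1 - p" unfolding p_def T_def
        by (subst prob_compl[symmetric]) (auto intro!: arg_cong[where f = prob])
      finally show ?thesis .
    qed
    have "1 - 1/9 \<le> 1 - prob {\<omega>\<in>space M. \<exists>k\<le>m. norm (\<Sum>i<k. Y i \<omega>) > 5 * \<rho>}" using max by simp
    also have "\<dots> = prob (space M - {\<omega>\<in>space M. \<exists>k\<le>m. norm (\<Sum>i<k. Y i \<omega>) > 5 * \<rho>})"
      unfolding Ysum0 by (rule prob_compl[symmetric]) measurable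
    also have "\<dots> \<le> prob (\<Inter>i\<in>{..<m}. \<xi> i -` {x. norm x \<le> 14 * \<rho>} \<inter> space M)"
    proof (rule finite_measure_mono)
      show "space M - {\<omega>\<in>space M. \<exists>k\<le>m. norm (\<Sum>i<k. Y i \<omega>) > 5 * \<rho>} \<subseteq> (\<Inter>i\<in>{..<m}. \<xi> i -` {x. norm x
          \<le> 14 * \<rho>} \<inter> space M)"
      proof
        fix \<omega> assume "\<omega> \<in> space M - {\<omega>\<in>space M. \<exists>k\<le>m. norm (\<Sum>i<k. Y i \<omega>) > 5 * \<rho>}"
        then have \<omega>: "\<omega> \<in> space M" "\<And>k. k \<le> m \<Longrightarrow> norm (\<Sum>i<k. Y i \<omega>) \<le> 5 * \<rho>" by (auto simp: not_less)
        have "norm (\<xi> i \<omega>) \<le> 14 * \<rho>" if "i < m" for i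
        proof -
          have "\<xi> i \<omega> = ((\<Sum>i<Suc i. Y i \<omega>) - (\<Sum>i<i. Y i \<omega>)) + (c (Suc i) - c i)"
            by (simp add: Y_def)
          then have "norm (\<xi> i \<omega>) \<le> norm (\<Sum>i<Suc i. Y i \<omega>) + norm (\<Sum>i<i. Y i \<omega>) + norm (c (Suc i)
              - c i)"
            by (simp only: norm_diff_add_le)
          \<comment> \<open>Origin of the 14: two consecutive partial sums of size at most
            \<open>5 * \<rho>\<close> and one increment of the centring constants.\<close>
          also have "\<dots> \<le> 5 * \<rho> + 5 * \<rho> + 4 * \<rho>" using that by (intro add_mono \<omega>(2) cdiff) auto
          finally show ?thesis by simp
        qed
        then show "\<omega> \<in> (\<Inter>i\<in>{..<m}. \<xi> i -` {x. norm x \<le> 14 * \<rho>} \<inter> space M)" using \<omega>(1) by auto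
      qed
      show "(\<Inter>i\<in>{..<m}. \<xi> i -` {x. norm x \<le> 14 * \<rho>} \<inter> space M) \<in> sets M"
        using \<open>m \<ge> 1\<close> by (intro sets.finite_INT measurable_sets[of _ M borel]) (auto simp:
          lessThan_empty_iff \<xi>_measurable)
    qed
    also have "\<dots> = (\<Prod>i\<in>{..<m}. prob (\<xi> i -` {x. norm x \<le> 14 * \<rho>} \<inter> space M))"
      using \<open>m \<ge> 1\<close> by (intro indep_varsD[OF \<xi>_indep]) (auto simp: lessThan_empty_iff)
    also have "\<dots> = (1 - p) ^ m" unfolding one by simp
    finally have low: "8/9 \<le> (1 - p) ^ m" by simp
    \<comment> \<open>Bernoulli's inequality applied to \<open>(1 + p) ^ m\<close> turns a lower
      bound for \<open>(1 - p) ^ m\<close> into an upper bound for \<open>m * p\<close>, since the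
      product of the two powers is at most 1.\<close>
    have "8/9 * (1 + real m * p) \<le> (1 - p) ^ m * (1 + p) ^ m"
      using low Bernoulli_inequality[of p m] p by (intro mult_mono) auto
    also have "\<dots> = ((1 - p) * (1 + p)) ^ m" by (simp add: power_mult_distrib)
    also have "\<dots> \<le> 1" using p by (intro power_le_one) (auto simp: algebra_simps mult_le_one)
    finally show ?thesis by (simp add: p_def \<rho>_def)
  qed
  have "a > 0" using a(1) by simp
  show thesis
  \<comment> \<open>For \<open>u\<close> below \<open>28 * a\<close> the bound exceeds 1. Beyond
    that, \<open>u / (14 * a)\<close> is at least 2 and rounding down loses at most half of it,
    which doubles the 14.\<close>
  proof (rule that[of "28 * a"])
    fix u :: real assume "u > 0"
    show "prob {\<omega>\<in>space M. norm (X 1 \<omega>) > u} \<le> 28 * a / u"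
    proof (cases "u < 28 * a")
      case True
      then have "1 \<le> 28 * a / u" using \<open>u > 0\<close> by simp
      then show ?thesis using prob_le_1 order.trans by blast
    next
      case False
      define m where "m = nat \<lfloor>u / (14 * a)\<rfloor>"
      have x: "u / (14 * a) \<ge> 2" using False \<open>a > 0\<close> by (simp add: field_simps)
      have m1: "real m \<le> u / (14 * a)" "real m > u / (14 * a) - 1"
        unfolding m_def using x by (simp_all add: of_nat_nat)
      have m: "m \<ge> 1" using m1 x by linarith
      have mu: "14 * (real m * a) \<le> u" using m1(1) \<open>a > 0\<close> by (simp add: field_simps)
      have mh: "real m \<ge> u / (28 * a)" using m1(2) x by (simp add: field_simps)
      have "prob {\<omega>\<in>space M. norm (X 1 \<omega>) > u} \<le> T (14 * (real m * a))"
        unfolding T_def using mu by (intro finite_measure_mono) auto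
      also have "\<dots> \<le> 1 / real m" using mT[OF m] m by (simp add: field_simps)
      also have "\<dots> \<le> 1 / (u / (28 * a))" using mh m \<open>u > 0\<close> \<open>a > 0\<close> by (intro divide_left_mono) auto
      finally show ?thesis by simp
    qed
  qed (use \<open>a > 0\<close> in simp)
qed

text \<open>At the exponential level \<open>exp (\<delta> * real n)\<close> the tail bound
  \<open>C / u\<close> already gives geometrically small probabilities, so Borel--Cantelli applies
  on the intervals from \<open>-n\<close> to \<open>-n + 1\<close>.\<close>

lemma unit_increments_growth:
  assumes tail: "C > 0" "\<And>u. u > 0 \<Longrightarrow> prob {\<omega>\<in>space M. norm (X 1 \<omega>) > u} \<le> C / u" and "\<delta> > 0"
  obtains v where "v \<ge> 0" "AE \<omega> in M. \<forall>\<^sub>F n in sequentially. \<forall>N k. k \<le> (2::nat) ^ N \<longrightarrow>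
      norm (X (- real n + real k / 2 ^ N) \<omega> - X (- real n) \<omega>) \<le> exp (\<delta> * real n) + v"
proof -
  obtain v where v: "v \<ge> 0" "\<And>s. s \<in> {0..1} \<Longrightarrow> prob {\<omega>\<in>space M. norm (X s \<omega>) > v} \<le> 1/2"
    by (rule unit_interval_tight) blast
  define A where "A n = {\<omega>\<in>space M. \<exists>N k. k \<le> (2::nat) ^ N \<and> norm (X (- real n + real k / 2 ^ N) \<omega>
      - X (- real n) \<omega>) > exp (\<delta> * real n) + v}" for n
  have Am: "A n \<in> sets M" for n unfolding A_def by measurable
  have Ab: "prob (A n) \<le> 2 * C * exp (- \<delta>) ^ n" for n
  proof -
    have "prob (A n) \<le> 2 * prob {\<omega>\<in>space M. norm (X 1 \<omega>) > exp (\<delta> * real n)}"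
      unfolding A_def by (rule dyadic_maximal[OF v])
    also have "\<dots> \<le> 2 * (C / exp (\<delta> * real n))" by (intro mult_left_mono tail(2)) auto
    also have "\<dots> = 2 * C * exp (- \<delta>) ^ n" by (simp add: exp_of_nat_mult[symmetric] exp_minus
      field_simps)
    finally show ?thesis .
  qed
  have "summable (\<lambda>n. 2 * C * exp (- \<delta>) ^ n)" using \<open>\<delta> > 0\<close>
    by (intro summable_mult summable_geometric) simp
  then have "summable (\<lambda>n. prob (A n))"
    by (rule summable_comparison_test'[of _ 0]) (use Ab in simp)
  then have "AE \<omega> in M. eventually (\<lambda>n. \<omega> \<in> space M - A n) sequentially"
    by (intro borel_cantelli_AE1 Am) (auto simp: emeasure_eq_measure)
  then have "AE \<omega> in M. \<forall>\<^sub>F n in sequentially. \<forall>N k. k \<le> (2::nat) ^ N \<longrightarrow>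
      norm (X (- real n + real k / 2 ^ N) \<omega> - X (- real n) \<omega>) \<le> exp (\<delta> * real n) + v"
    by eventually_elim (auto simp: A_def not_less elim!: eventually_mono)
  then show thesis using that v(1) by blast
qed

end

text \<open>Right continuity recovers the value at \<open>t\<close> from dyadic points strictly
  after it. The right end point is treated apart, because such points would leave the interval
  there.\<close>

lemma dyadic_bound_extends:
  fixes \<omega> :: "real \<Rightarrow> 'b::real_normed_vector"
  assumes "cadlag \<omega>" and dy: "\<And>N k. k \<le> (2::nat) ^ N \<Longrightarrow> norm (\<omega> (a + real k / 2 ^ N) - \<omega> a) \<le> B"
    and t: "a \<le> t" "t \<le> a + 1"
  shows "norm (\<omega> t - \<omega> a) \<le> B"
proof (cases "t = a + 1")
  case True then show ?thesis using dy[of 1 0] by simp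
next
  case False
  define k where "k N = nat \<lfloor>(t - a) * real (2 ^ N)\<rfloor> + 1" for N :: nat
  have fl: "real (k N) = of_int \<lfloor>(t - a) * real (2 ^ N)\<rfloor> + 1" for N
    unfolding k_def using t by simp
  have "filterlim (\<lambda>N. real (k N) / real (2 ^ N)) (at_right (t - a)) sequentially"
    unfolding fl by (rule floor_approx_at_right) (auto simp: power_one_over[symmetric]
      LIMSEQ_power_zero)
  then have "(\<lambda>N. \<omega> (real (k N) / real (2 ^ N) + a)) \<longlonglongrightarrow> \<omega> (t - a + a)"
    by (rule filterlim_compose[OF cadlagD[OF cadlag_shift[OF assms(1)]]])
  then have lim: "(\<lambda>N. norm (\<omega> (a + real (k N) / 2 ^ N) - \<omega> a)) \<longlonglongrightarrow> norm (\<omega> t - \<omega> a)"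
    by (intro tendsto_intros) (simp add: add.commute)
  have "k N \<le> 2 ^ N" for N
  proof -
    have "(t - a) * 2 ^ N < 1 * 2 ^ N" using t False by (intro mult_strict_right_mono) auto
    then have "\<lfloor>(t - a) * real (2 ^ N)\<rfloor> < 2 ^ N" by (simp add: floor_less_iff)
    then have "\<lfloor>(t - a) * real (2 ^ N)\<rfloor> + 1 \<le> 2 ^ N" by simp
    then have "real_of_int (\<lfloor>(t - a) * real (2 ^ N)\<rfloor> + 1) \<le> real_of_int (2 ^ N)"
      by (simp only: of_int_le_iff)
    then have "real (k N) \<le> 2 ^ N" unfolding fl by simp
    then show ?thesis by (metis of_nat_le_iff of_nat_numeral of_nat_power)
  qed
  then have "norm (\<omega> (a + real (k N) / 2 ^ N) - \<omega> a) \<le> B" for N by (rule dy)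
  then show ?thesis by (intro tendsto_upperbound[OF lim]) auto
qed

text \<open>Adding up the increments over about \<open>n\<close> unit intervals costs a factor of
  order \<open>n\<close>, absorbed by a second exponential; this is why the rate doubles to
  \<open>2 * \<delta>\<close>.\<close>

lemma unit_increments_exp_bound:
  fixes \<omega> :: "real \<Rightarrow> 'b::real_normed_vector"
  assumes cad: "cadlag \<omega>" and "\<delta> > 0" "v \<ge> 0"
    and ev: "\<forall>\<^sub>F n in sequentially. \<forall>N k. k \<le> (2::nat) ^ N \<longrightarrow>
      norm (\<omega> (- real n + real k / 2 ^ N) - \<omega> (- real n)) \<le> exp (\<delta> * real n) + v"
  shows "\<exists>C. \<forall>r\<le>T. norm (\<omega> r) \<le> C * exp (- (2 * \<delta>) * r)"
proof -
  obtain n0 where n0: "\<And>n N k. n \<ge> n0 \<Longrightarrow> k \<le> (2::nat) ^ N \<Longrightarrow>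
      norm (\<omega> (- real n + real k / 2 ^ N) - \<omega> (- real n)) \<le> exp (\<delta> * real n) + v"
    using ev unfolding eventually_sequentially by blast
  have unit: "norm (\<omega> r - \<omega> (- real n)) \<le> (1 + v) * exp (\<delta> * real n)"
    if "n \<ge> n0" "- real n \<le> r" "r \<le> - real n + 1" for r n
  proof -
    have "norm (\<omega> r - \<omega> (- real n)) \<le> exp (\<delta> * real n) + v * 1"
      using dyadic_bound_extends[OF cad n0[OF that(1)] that(2,3)] by simp
    also have "\<dots> \<le> exp (\<delta> * real n) + v * exp (\<delta> * real n)"
      using \<open>\<delta> > 0\<close> \<open>v \<ge> 0\<close> by (intro add_left_mono mult_left_mono) auto
    finally show ?thesis by (simp add: algebra_simps)
  qed
  define A where "A = norm (\<omega> (- real n0))"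
  have grid: "norm (\<omega> (- real (n0 + j))) \<le> A + real j * ((1 + v) * exp (\<delta> * real (n0 + j)))" for j
  proof (induction j)
    case (Suc j)
    have "norm (\<omega> (- real (n0 + j)) - \<omega> (- real (n0 + Suc j))) \<le> (1 + v) * exp (\<delta> * real (n0
        + Suc j))"
      by (rule unit) auto
    moreover have "norm (\<omega> (- real (n0 + Suc j))) \<le> norm (\<omega> (- real (n0 + j))) + norm (\<omega> (- real (n0
        + j)) - \<omega> (- real (n0 + Suc j)))"
      by (metis norm_minus_commute norm_triangle_sub)
    moreover have "real j * ((1 + v) * exp (\<delta> * real (n0 + j))) \<le> real j * ((1 + v) * exp (\<delta> * real
        (n0 + Suc j)))"
      using \<open>\<delta> > 0\<close> \<open>v \<ge> 0\<close> by (intro mult_left_mono) auto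
    ultimately show ?case using Suc by (simp add: algebra_simps)
  qed (simp add: A_def)
  \<comment> \<open>The factor \<open>exp (2 * \<delta>)\<close> pays for rounding
    \<open>- r\<close> up to an integer, and \<open>1 / \<delta>\<close> comes from bounding
    \<open>n\<close> by \<open>exp (\<delta> * n) / \<delta>\<close>.\<close>
  define E where "E = (A + (1 + 1 / \<delta>) * (1 + v)) * exp (2 * \<delta>)"
  have far: "norm (\<omega> r) \<le> E * exp (- (2 * \<delta>) * r)" if "r \<le> - real n0" for r
  proof -
    define n where "n = nat \<lceil>- r\<rceil>"
    have n: "- r \<le> real n" "real n < - r + 1" using that ceiling_correct[of "- r"]
      by (auto simp: n_def)
    then have nn: "n \<ge> n0" using that by linarith
    define j where "j = n - n0"
    have j: "n = n0 + j" using nn by (simp add: j_def)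
    let ?e = "exp (\<delta> * real n)"
    have "\<delta> * real n \<le> ?e" using exp_ge_add_one_self[of "\<delta> * real n"] by linarith
    then have ne: "real n \<le> 1 / \<delta> * ?e" using \<open>\<delta> > 0\<close> by (simp add: field_simps)
    have e1: "?e \<ge> 1" using \<open>\<delta> > 0\<close> by simp
    have "norm (\<omega> r) \<le> norm (\<omega> (- real n)) + norm (\<omega> r - \<omega> (- real n))" by (metis norm_triangle_sub)
    also have "\<dots> \<le> (A + real n * ((1 + v) * ?e)) + (1 + v) * ?e"
    proof (intro add_mono unit nn)
      have "norm (\<omega> (- real n)) \<le> A + real j * ((1 + v) * ?e)" using grid[of j] by (simp add: j)
      also have "\<dots> \<le> A + real n * ((1 + v) * ?e)"
        using \<open>v \<ge> 0\<close> by (intro add_left_mono mult_right_mono) (auto simp: j)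
      finally show "norm (\<omega> (- real n)) \<le> A + real n * ((1 + v) * ?e)" .
    qed (use n in auto)
    also have "\<dots> = A + (real n + 1) * ((1 + v) * ?e)" by (simp add: algebra_simps)
    also have "\<dots> \<le> A * (?e * ?e) + ((1 / \<delta> * ?e + ?e) * ((1 + v) * ?e))"
    proof (intro add_mono mult_right_mono)
      have "A * 1 \<le> A * (?e * ?e)" using e1 by (intro mult_left_mono) (auto simp: A_def mult_ge1_I)
      then show "A \<le> A * (?e * ?e)" by simp
    qed (use ne e1 \<open>v \<ge> 0\<close> in auto)
    also have "\<dots> = (A + (1 + 1 / \<delta>) * (1 + v)) * (?e * ?e)"
      by (simp add: algebra_simps add_divide_distrib)
    also have "\<dots> \<le> (A + (1 + 1 / \<delta>) * (1 + v)) * (exp (2 * \<delta>) * exp (- (2 * \<delta>) * r))"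
    proof (rule mult_left_mono)
      have "\<delta> * real n \<le> \<delta> * (- r + 1)" using n \<open>\<delta> > 0\<close> by (intro mult_left_mono) auto
      then show "?e * ?e \<le> exp (2 * \<delta>) * exp (- (2 * \<delta>) * r)"
        unfolding mult_exp_exp by (simp add: algebra_simps)
    qed (use \<open>\<delta> > 0\<close> \<open>v \<ge> 0\<close> in \<open>auto simp: A_def\<close>)
    finally show ?thesis by (simp add: E_def mult.assoc)
  qed
  obtain B where B: "B > 0" "\<forall>r\<in>{- real n0..T}. norm (\<omega> r) \<le> B" using cadlag_bounded[OF cad]
    by blast
  have "E \<ge> 0" using \<open>\<delta> > 0\<close> \<open>v \<ge> 0\<close> by (simp add: E_def A_def)
  have "norm (\<omega> r) \<le> (E + B * exp (2 * \<delta> * T)) * exp (- (2 * \<delta>) * r)" if "r \<le> T" for r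
  proof (cases "r \<le> - real n0")
    case True
    have "E * exp (- (2 * \<delta>) * r) \<le> (E + B * exp (2 * \<delta> * T)) * exp (- (2 * \<delta>) * r)"
      using B(1) by (intro mult_right_mono) auto
    then show ?thesis using far[OF True] by linarith
  next
    case False
    have "norm (\<omega> r) \<le> B * 1" using B(2) False that by simp
    also have "\<dots> \<le> B * (exp (2 * \<delta> * T) * exp (- (2 * \<delta>) * r))"
      using B(1) that \<open>\<delta> > 0\<close> unfolding mult_exp_exp by (intro mult_left_mono) auto
    also have "\<dots> \<le> (E + B * exp (2 * \<delta> * T)) * exp (- (2 * \<delta>) * r)" using \<open>E \<ge> 0\<close>
      by (simp add: algebra_simps)
    finally show ?thesis .
  qed
  then show ?thesis by blast
qed

text \<open>Stability with \<open>1 / \<alpha> < 1\<close>, read at \<open>t = 1\<close>, gives the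
  tail bound. The growth rate may be any positive \<open>d\<close>, so it can be matched to the
  weight exponent; half of it is spent on the individual increments.\<close>

lemma stable_paths_exp_bound:
  fixes P :: "(real \<Rightarrow> 'b::euclidean_space) measure"
  assumes law: "two_sided_stable_levy_process \<alpha> P (\<lambda>t \<omega>. \<omega> t)" and "1 < \<alpha>" "d > 0"
  shows "AE \<omega> in P. cadlag \<omega> \<and> \<omega> 0 = 0 \<and> (\<forall>T. \<exists>C. \<forall>r\<le>T. norm (\<omega> r) \<le> C * exp (- d * r))"
proof -
  have lp: "two_sided_levy_process P (\<lambda>t \<omega>. \<omega> t)" using law
    by (simp add: two_sided_stable_levy_process_def)
  then interpret levy_process P "\<lambda>t \<omega>. \<omega> t"
    by (intro levy_process.intro levy_process_axioms.intro) (auto simp: two_sided_levy_process_def)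
  have "\<exists>c. distr P borel (\<lambda>\<omega>. \<omega> a) = distr P borel (\<lambda>\<omega>. a powr (1/\<alpha>) *\<^sub>R \<omega> 1 + c)" if a: "a > 0"
    for a
  proof -
    have "\<forall>a>0. \<exists>c. \<forall>t\<ge>0. distr P borel (\<lambda>\<omega>. \<omega> (a * t)) = distr P borel (\<lambda>\<omega>. a powr (1/\<alpha>) *\<^sub>R \<omega> t
        + t *\<^sub>R c)"
      using law by (simp add: two_sided_stable_levy_process_def)
    then obtain c where "\<forall>t\<ge>0. distr P borel (\<lambda>\<omega>. \<omega> (a * t)) = distr P borel (\<lambda>\<omega>.
        a powr (1/\<alpha>) *\<^sub>R \<omega> t + t *\<^sub>R c)"
      using a by meson
    then have "distr P borel (\<lambda>\<omega>. \<omega> (a * 1)) = distr P borel (\<lambda>\<omega>. a powr (1/\<alpha>) *\<^sub>R \<omega> 1 + 1 *\<^sub>R c)"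
      by (metis zero_le_one)
    then show ?thesis by auto
  qed
  then obtain C where C: "C > 0" "\<And>u. u > 0 \<Longrightarrow> prob {\<omega>\<in>space P. norm (\<omega> 1) > u} \<le> C / u"
    using stable_tail[of "1/\<alpha>"] \<open>1 < \<alpha>\<close> by auto
  obtain v where v: "v \<ge> 0" "AE \<omega> in P. \<forall>\<^sub>F n in sequentially. \<forall>N k. k \<le> (2::nat) ^ N \<longrightarrow>
      norm (\<omega> (- real n + real k / 2 ^ N) - \<omega> (- real n)) \<le> exp (d / 2 * real n) + v"
    using unit_increments_growth[OF C, of "d / 2"] \<open>d > 0\<close> by auto
  have cad: "AE \<omega> in P. cadlag \<omega>"
    using lp by (intro AE_I2) (auto simp: two_sided_levy_process_def)
  from v(2) cad X_zero show ?thesis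
  proof eventually_elim
    case (elim \<omega>)
    then show ?case
      using unit_increments_exp_bound[of \<omega> "d / 2" v] \<open>d > 0\<close> v(1) by auto
  qed
qed

section \<open>The tracking theorem\<close>

theorem corollary1:
  fixes S :: "real^'n1^'n1" and F :: "real^'n2^'n2"
    and g1 :: "(real^'n1) \<times> (real^'n2) \<Rightarrow> real^'n1"
    and g2 :: "(real^'n1) \<times> (real^'n2) \<Rightarrow> real^'n2"
    and P :: "(real \<Rightarrow> real^'n2) measure"
    and \<sigma> \<alpha> \<gamma>\<^sub>s \<gamma>\<^sub>f K \<gamma> :: real
  assumes sigma_pos: "\<sigma> > 0"
    and alpha: "1 < \<alpha>" "\<alpha> < 2"
    and S_spectrum: "\<And>c. eigenvalue S c \<Longrightarrow> Re c \<ge> 0"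
    and F_spectrum: "\<And>c. eigenvalue F c \<Longrightarrow> Re c < 0"
    and g_zero: "g1 (0, 0) = 0" "g2 (0, 0) = 0"
    and P_sets: "sets P = sets skorokhod_borel"
    and P_law: "two_sided_stable_levy_process \<alpha> P (\<lambda>t \<omega>. \<omega> t)"
    and A1_signs: "\<gamma>\<^sub>s > 0" "\<gamma>\<^sub>f < 0"
    and A1_S: "\<And>t x. t \<le> 0 \<Longrightarrow> norm (matrix_exp (t *\<^sub>R S) *v x) \<le> exp (\<gamma>\<^sub>s * t) * norm x"
    and A1_F: "\<And>t y. t \<ge> 0 \<Longrightarrow> norm (matrix_exp (t *\<^sub>R F) *v y) \<le> exp (\<gamma>\<^sub>f * t) * norm y"
    and A2_pos: "K > 0"
    and A2_g1: "\<And>x1 y1 x2 y2. norm (g1 (x1, y1) - g1 (x2, y2)) \<le> K * (norm (x1 - x2) + norm (y1 - y2))"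
    and A2_g2: "\<And>x1 y1 x2 y2. norm (g2 (x1, y1) - g2 (x2, y2)) \<le> K * (norm (x1 - x2) + norm (y1 - y2))"
    and A3: "K < - \<gamma>\<^sub>f"
    and gamma: "\<gamma> > 0" "K < - (\<gamma> + \<gamma>\<^sub>f)"
  shows "\<exists>\<epsilon>\<^sub>0>0. \<forall>\<epsilon>. 0 < \<epsilon> \<and> \<epsilon> < \<epsilon>\<^sub>0 \<longrightarrow>
    (\<forall>(z0 :: (real \<Rightarrow> real^'n2) \<Rightarrow> (real^'n1) \<times> (real^'n2))
      (\<phi> :: real \<Rightarrow> (real \<Rightarrow> real^'n2) \<Rightarrow> (real^'n1) \<times> (real^'n2)).
      (AE \<omega> in P. slow_fast_solution S F g1 g2 \<sigma> \<alpha> \<epsilon> \<omega> (z0 \<omega>) (\<lambda>t. \<phi> t \<omega>)) \<longrightarrow>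
      (\<exists>z0_bar \<phi>_bar. AE \<omega> in P.
         z0_bar \<omega> \<in> slow_manifold S F g1 g2 \<sigma> \<alpha> \<gamma> \<epsilon> \<omega> \<and>
         slow_fast_solution S F g1 g2 \<sigma> \<alpha> \<epsilon> \<omega> (z0_bar \<omega>) (\<lambda>t. \<phi>_bar t \<omega>) \<and>
         reduced_solution S F g1 g2 \<sigma> \<alpha> \<gamma> \<epsilon> \<omega> (fst (z0_bar \<omega>)) (\<lambda>t. \<phi>_bar t \<omega>) \<and>
         (\<forall>t\<ge>0. norm (\<phi> t \<omega> - \<phi>_bar t \<omega>) \<le>
            exp (- (\<gamma> / \<epsilon>) * t) / (1 - (\<epsilon> * K / (\<gamma> + \<epsilon> * \<gamma>\<^sub>s) - K / (\<gamma> + \<gamma>\<^sub>f)))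
              * norm (z0 \<omega> - z0_bar \<omega>))))"
proof -
  \<comment> \<open>The slow summand of the contraction constant is at most
    \<open>\<epsilon> * K / \<gamma>\<close>; \<open>e0\<close> is the value at which this bound
    equals the room \<open>1 + K / (\<gamma> + \<gamma>\<^sub>f)\<close> left by the fast summand,
    positive because \<open>K < - (\<gamma> + \<gamma>\<^sub>f)\<close>.\<close>
  define e0 where "e0 = \<gamma> * (1 + K / (\<gamma> + \<gamma>\<^sub>f)) / K"
  have neg: "\<gamma> + \<gamma>\<^sub>f < 0" using gamma A2_pos by linarith
  have k0: "1 + K / (\<gamma> + \<gamma>\<^sub>f) > 0" using gamma(2) neg by (simp add: field_simps)
  have "e0 > 0" unfolding e0_def using k0 gamma(1) A2_pos by simp
  show ?thesis
  proof (intro exI[of _ e0] conjI allI impI)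
    fix \<epsilon> :: real and z0 :: "(real \<Rightarrow> real^'n2) \<Rightarrow> (real^'n1) \<times> (real^'n2)"
      and \<phi> :: "real \<Rightarrow> (real \<Rightarrow> real^'n2) \<Rightarrow> (real^'n1) \<times> (real^'n2)"
    assume \<epsilon>: "0 < \<epsilon> \<and> \<epsilon> < e0"
      and sol: "AE \<omega> in P. slow_fast_solution S F g1 g2 \<sigma> \<alpha> \<epsilon> \<omega> (z0 \<omega>) (\<lambda>t. \<phi> t \<omega>)"
    have "\<epsilon> * K / (\<gamma> + \<epsilon> * \<gamma>\<^sub>s) \<le> \<epsilon> * K / \<gamma>"
      using \<epsilon> A1_signs A2_pos gamma(1) by (intro divide_left_mono mult_pos_pos add_pos_pos) auto
    also have "\<dots> < e0 * K / \<gamma>" using \<epsilon> A2_pos gamma(1) by (intro divide_strict_right_mono mult_strict_right_mono) auto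
    also have "\<dots> = 1 + K / (\<gamma> + \<gamma>\<^sub>f)" unfolding e0_def using A2_pos gamma(1) by simp
    finally have small: "\<epsilon> * K / (\<gamma> + \<epsilon> * \<gamma>\<^sub>s) - K / (\<gamma> + \<gamma>\<^sub>f) < 1" by linarith
    interpret slow_fast_system S F g1 g2 \<sigma> \<alpha> \<epsilon> \<gamma>\<^sub>s \<gamma>\<^sub>f K \<gamma>
    proof
      show "norm (g1 v - g1 w) \<le> K * pair_norm (v - w)" "norm (g2 v - g2 w) \<le> K * pair_norm (v - w)" for v w
        using A2_g1[of "fst v" "snd v" "fst w" "snd w"] A2_g2[of "fst v" "snd v" "fst w" "snd w"]
        by (simp_all add: pair_norm_def)
      show "g1 0 = 0" "g2 0 = 0" using g_zero by (simp_all add: zero_prod_def)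
    qed (use \<epsilon> A1_signs A1_S A1_F A2_pos gamma(1) neg small in \<open>auto simp: mexp_def\<close>)
    define Q where "Q \<omega> z1 \<psi> \<longleftrightarrow> z1 \<in> slow_manifold S F g1 g2 \<sigma> \<alpha> \<gamma> \<epsilon> \<omega> \<and>
      slow_fast_solution S F g1 g2 \<sigma> \<alpha> \<epsilon> \<omega> z1 \<psi> \<and>
      reduced_solution S F g1 g2 \<sigma> \<alpha> \<gamma> \<epsilon> \<omega> (fst z1) \<psi> \<and>
      (\<forall>t\<ge>0. norm (\<phi> t \<omega> - \<psi> t) \<le>
        exp (- (\<gamma> / \<epsilon>) * t) / (1 - (\<epsilon> * K / (\<gamma> + \<epsilon> * \<gamma>\<^sub>s) - K / (\<gamma> + \<gamma>\<^sub>f))) * norm (z0 \<omega> - z1))"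
      for \<omega> z1 \<psi>
    have "AE \<omega> in P. cadlag \<omega> \<and> \<omega> 0 = 0 \<and> (\<forall>T. \<exists>C. \<forall>r\<le>T. norm (\<omega> r) \<le> C * exp (- (\<gamma> / \<epsilon>) * r))"
      using stable_paths_exp_bound[OF P_law alpha(1), of "\<gamma> / \<epsilon>"] \<epsilon> gamma(1) by simp
    with sol have ex: "AE \<omega> in P. \<exists>z1 \<psi>. Q \<omega> z1 \<psi>"
    proof eventually_elim
      case (elim \<omega>)
      then have "tame \<omega>" by (simp add: tame_def b_def)
      with elim show ?case unfolding Q_def by (intro pathwise_tracking) auto
    qed
    \<comment> \<open>Existence path by path is turned into functions of \<open>\<omega>\<close> by
      choice, first the point on the manifold and then a solution through it.\<close>
    define z1 where "z1 \<omega> = (SOME z. \<exists>\<psi>. Q \<omega> z \<psi>)" for \<omega>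
    define \<psi> where "\<psi> t \<omega> = (SOME \<psi>. Q \<omega> (z1 \<omega>) \<psi>) t" for t \<omega>
    from ex have "AE \<omega> in P. Q \<omega> (z1 \<omega>) (\<lambda>t. \<psi> t \<omega>)"
    proof eventually_elim
      case (elim \<omega>)
      have "\<exists>\<psi>. Q \<omega> (z1 \<omega>) \<psi>" unfolding z1_def using elim by (rule someI_ex)
      then show ?case unfolding \<psi>_def by (rule someI_ex)
    qed
    then show "\<exists>z0_bar \<phi>_bar. AE \<omega> in P.
         z0_bar \<omega> \<in> slow_manifold S F g1 g2 \<sigma> \<alpha> \<gamma> \<epsilon> \<omega> \<and>
         slow_fast_solution S F g1 g2 \<sigma> \<alpha> \<epsilon> \<omega> (z0_bar \<omega>) (\<lambda>t. \<phi>_bar t \<omega>) \<and>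
         reduced_solution S F g1 g2 \<sigma> \<alpha> \<gamma> \<epsilon> \<omega> (fst (z0_bar \<omega>)) (\<lambda>t. \<phi>_bar t \<omega>) \<and>
         (\<forall>t\<ge>0. norm (\<phi> t \<omega> - \<phi>_bar t \<omega>) \<le>
            exp (- (\<gamma> / \<epsilon>) * t) / (1 - (\<epsilon> * K / (\<gamma> + \<epsilon> * \<gamma>\<^sub>s) - K / (\<gamma> + \<gamma>\<^sub>f)))
              * norm (z0 \<omega> - z0_bar \<omega>))"
      unfolding Q_def by blast
  qed (rule \<open>e0 > 0\<close>)
qed

end
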